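(* Let $0<\hat s<s<1<n$. Then $$\left(\int_0^\infty\mathrm{Cap}_{H^{\hat s,1}_-}\big(\{x\in\mathbb R^n:|u(x)|>t^{\frac{n-s}{n-\hat s}}\}\big)\,dt\right)^{\frac{n-s}{n-\hat s}}\lesssim[u]_{H^{s,1}_-}\qquad\forall\ u\in\mathcal S,$$ with an implicit constant independent of $u$.
   Context: All functions are real-valued on $\mathbb R^n$ ($n\in\mathbb N$); $\mathcal S$ is the Schwartz class and $\hat f(\xi)=\int f(x)e^{-2\pi ix\cdot\xi}dx$. For $\sigma\in(0,1)$ and $u\in\mathcal S$, $\nabla^\sigma_-u=(\nabla^\sigma_1u,\dots,\nabla^\sigma_nu)$ with $(\nabla^\sigma_ju)^\wedge(\xi)=(-2\pi i\xi_j)(2\pi|\xi|)^{\sigma-1}\hat u(\xi)$, and $[u]_{H^{\sigma,1}_-}=\sum_{j=1}^n\|\nabla^\sigma_ju\|_{L^1}$. For compact $K$, $\mathrm{Cap}_{H^{\sigma,1}_-}(K)=\inf\{[u]_{H^{\sigma,1}_-}:u\in\mathcal S,\ u\ge1\text{ on }K\}$; for open $O$, $\mathrm{Cap}_{H^{\sigma,1}_-}(O)=\sup\{\mathrm{Cap}_{H^{\sigma,1}_-}(K):K\subset O\text{ compact}\}$. $A\lesssim B$ means $A\le cB$ for a positive constant $c$. *)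

theory Defs
  imports "HOL-Analysis.Analysis"
begin

definition partial_deriv :: "'n::finite \<Rightarrow> (real^'n \<Rightarrow> real) \<Rightarrow> real^'n \<Rightarrow> real" where
  "partial_deriv j f = (\<lambda>x. frechet_derivative f (at x) (axis j 1))"

definition iter_partial_deriv :: "'n::finite list \<Rightarrow> (real^'n \<Rightarrow> real) \<Rightarrow> real^'n \<Rightarrow> real" where
  "iter_partial_deriv js f = foldr partial_deriv js f"

(* Total differentiability of every iterated partial derivative makes all of them continuous,
   so the first condition says that f is smooth. *)
definition schwartz_class :: "(real^'n::finite \<Rightarrow> real) set" where
  "schwartz_class = {f.
     (\<forall>js. iter_partial_deriv js f differentiable_on UNIV) \<and>
     (\<forall>js k::nat. bounded (range (\<lambda>x. norm x ^ k * iter_partial_deriv js f x)))}"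

definition fourier :: "(real^'n::finite \<Rightarrow> complex) \<Rightarrow> real^'n \<Rightarrow> complex" where
  "fourier f \<xi> = (LINT x|lborel. f x * exp (- 2 * of_real pi * \<i> * of_real (x \<bullet> \<xi>)))"

definition inv_fourier :: "(real^'n::finite \<Rightarrow> complex) \<Rightarrow> real^'n \<Rightarrow> complex" where
  "inv_fourier g x = (LINT \<xi>|lborel. g \<xi> * exp (2 * of_real pi * \<i> * of_real (x \<bullet> \<xi>)))"

(* The function with Fourier transform (- 2 pi i xi_j) (2 pi |xi|)^(\<sigma> - 1) u^(xi). For \<sigma> in (0,1)
   and u in the Schwartz class this symbol is absolutely integrable, so the inverse Fourier
   integral converges and is the continuous representative. Its values are real, because the
   symbol is conjugate-symmetric; only their absolute values are used below. At xi = 0 the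
   symbol evaluates to 0, its limit there. *)
definition nabla_minus :: "real \<Rightarrow> (real^'n::finite \<Rightarrow> real) \<Rightarrow> 'n \<Rightarrow> real^'n \<Rightarrow> complex" where
  "nabla_minus \<sigma> u j =
     inv_fourier (\<lambda>\<xi>. (- 2 * of_real pi * \<i> * of_real (\<xi> $ j))
        * of_real ((2 * pi * norm \<xi>) powr (\<sigma> - 1)) * fourier (\<lambda>x. of_real (u x)) \<xi>)"

definition seminorm_minus :: "real \<Rightarrow> (real^'n::finite \<Rightarrow> real) \<Rightarrow> ennreal" where
  "seminorm_minus \<sigma> u = (\<Sum>j\<in>UNIV. \<integral>\<^sup>+x. ennreal (norm (nabla_minus \<sigma> u j x)) \<partial>lborel)"

definition cap_compact :: "real \<Rightarrow> (real^'n::finite) set \<Rightarrow> ennreal" where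
  "cap_compact \<sigma> K = (INF u\<in>{u \<in> schwartz_class. \<forall>x\<in>K. 1 \<le> u x}. seminorm_minus \<sigma> u)"

definition cap_open :: "real \<Rightarrow> (real^'n::finite) set \<Rightarrow> ennreal" where
  "cap_open \<sigma> U = (SUP K\<in>{K. compact K \<and> K \<subseteq> U}. cap_compact \<sigma> K)"

(* Real powers on [0, \<infinity>], intended for exponents a > 0. *)
definition ennreal_powr :: "ennreal \<Rightarrow> real \<Rightarrow> ennreal" where
  "ennreal_powr x a = (if x = top then top else ennreal (enn2real x powr a))"

end

theory Submission
  imports Defs "HOL-Probability.Probability"
begin

text \<open>
  Write \<open>n\<close> for the dimension, \<open>p\<^sub>t\<close> for the heat kernel and \<open>w\<close> for the Riesz potential of order
  \<open>1 - s\<close> of \<open>u\<close>, so that the fractional gradient of \<open>u\<close> is \<open>- \<nabla>w\<close>. Subordination to the heat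
  semigroup recovers \<open>u\<close> as a constant multiple of the integral of
  \<open>t\<^bsup>(s-1)/2\<^esup> \<Delta>(p\<^sub>t * w)\<close> over \<open>t > 0\<close>.

  Let \<open>A\<close> be the total mass of \<open>\<nabla>w\<close> and fix a level \<open>\<lambda> = A R\<^bsup>s-n\<^esup>\<close>. Times \<open>t\<close> much larger than
  \<open>R\<^sup>2\<close> contribute little to \<open>u\<close>. At a time \<open>t = \<theta> R\<^sup>2\<close> the values of \<open>w\<close> that are small
  or large compared with \<open>A R\<^bsup>1-n\<^esup>\<close>, up to powers of \<open>\<theta>\<close>, contribute little as well: the small
  ones because both derivatives can be put on the heat kernel, the large ones by the weak-type
  Sobolev inequality for \<open>w\<close>. Hence on the superlevel set of \<open>u\<close> the superposition of the kernels
  \<open>p\<^bsub>2t\<^esub>\<close> against the part of \<open>|\<nabla>w|\<close> that lives on the remaining values of \<open>w\<close> is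
  bounded below by a multiple of \<open>\<lambda>\<close>, and this superposition is an admissible function for the
  capacity once it is replaced by a finite sum of Gaussians; the seminorm of \<open>p\<^sub>t\<close> of order \<open>\<sigma>\<close>
  is at most a multiple of \<open>t\<^bsup>-\<sigma>/2\<^esup>\<close>.

  When the resulting bound is integrated over the levels, every point is charged, for fixed \<open>\<theta>\<close>,
  only on a range of levels of logarithmic length \<open>O(1 + |log \<theta>|)\<close>, and the factor
  \<open>\<theta>\<^bsup>(s-s')/2\<^esup> d\<theta>/\<theta>\<close> makes this integrable. Without the truncation the same point would be charged at
  all levels and the integral would diverge.
\<close>

section \<open>Gaussian integrals\<close>

text \<open>The seminorm controls only an L^1 norm, on which neither maximal functions nor Riesz
  transforms are bounded, and cutting \<open>u\<close> itself does not interact well with a nonlocal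
  operator. The potential \<open>w\<close> has an ordinary gradient in L^1, and truncating
  \<open>w\<close> merely multiplies that gradient by a function of \<open>w\<close>; hence all
  cutting is done on \<open>w\<close>. The exponents come from scaling. Capacities of order s' scale
  like R^(n-s'), and writing the level A R^(s-n) as \<tau>^((n-s)/(n-s')) makes R^(n-s') a constant
  multiple of 1/\<tau>, so the levels are integrated against d\<tau>/\<tau>. The two discarded parts
  diverge at time 0 unless the cut-off heights carry positive powers of \<theta>; such powers
  enlarge the retained range of values only polynomially in 1/\<theta>, which costs a logarithm
  after integration over the levels. The constants are fixed in the order \<kappa> (late times),
  then \<delta> (discarded values). Each of the two errors gets a quarter of \<Gamma> times the
  level, which leaves one half for the retained part; neither choice looks at
  \<open>u\<close>.\<close>

lemma gauss_fourier_real: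
  fixes a \<eta> :: real assumes "a > 0"
  shows "has_bochner_integral lborel (\<lambda>x. exp (- a * x\<^sup>2) * exp (\<i> * of_real (x * \<eta>)))
    (complex_of_real (sqrt (pi / a) * exp (- \<eta>\<^sup>2 / (4 * a))))"
proof -
  \<comment> \<open>Replacing x by x / c turns exp(-x^2/2) into exp(-a x^2), so the transform
    becomes the characteristic function of the standard normal law.\<close>
  define c where "c = 1 / sqrt (2 * a)"
  have c: "c > 0" "c\<^sup>2 = 1 / (2 * a)" using assms by (auto simp: c_def power_divide)
  let ?f = "\<lambda>x::real. std_normal_density x *\<^sub>R iexp (c * \<eta> * x)"
  have "integrable lborel ?f"
    by (rule Bochner_Integration.integrable_bound[OF integrable_std_normal_moment[of 0]]) (auto intro!: AE_I2)
  moreover have "(LINT x|lborel. ?f x) = char std_normal_distribution (c * \<eta>)"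
    unfolding char_def by (subst integral_density) (auto intro!: AE_I2)
  ultimately have "has_bochner_integral lborel ?f (complex_of_real (exp (- ((c * \<eta>)\<^sup>2) / 2)))"
    by (metis char_std_normal_distribution has_bochner_integral_iff)
  then have "has_bochner_integral lborel (\<lambda>x. ?f (0 + (1/c) * x)) (complex_of_real (exp (- ((c * \<eta>)\<^sup>2) / 2)) /\<^sub>R \<bar>1/c\<bar>)"
    by (subst (asm) lborel_has_bochner_integral_real_affine_iff[of "1/c" _ _ 0]) (use c in auto)
  then have "has_bochner_integral lborel (\<lambda>x. complex_of_real (sqrt (2*pi)) * ?f (0 + (1/c) * x)) 
     (complex_of_real (sqrt (2*pi)) * (complex_of_real (exp (- ((c * \<eta>)\<^sup>2) / 2)) /\<^sub>R \<bar>1/c\<bar>))"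
    by (rule has_bochner_integral_mult_right)
  moreover have "complex_of_real (sqrt (2*pi)) * ?f (0 + (1/c) * x) = exp (- a * x\<^sup>2) * exp (\<i> * of_real (x * \<eta>))" for x
  proof -
    have "(1/c * x)\<^sup>2 / 2 = a * x\<^sup>2" using c assms by (simp add: power_divide)
    then show ?thesis using c by (simp add: std_normal_density_def scaleR_conv_of_real mult.commute)
  qed
  moreover have "complex_of_real (sqrt (2*pi)) * (complex_of_real (exp (- ((c * \<eta>)\<^sup>2) / 2)) /\<^sub>R \<bar>1/c\<bar>)
     = complex_of_real (sqrt (pi / a) * exp (- \<eta>\<^sup>2 / (4 * a)))"
  proof -
    have "sqrt (2*pi) * c = sqrt (pi / a)" unfolding c_def by (simp add: real_sqrt_divide real_sqrt_mult)
    moreover have "- ((c * \<eta>)\<^sup>2) / 2 = - \<eta>\<^sup>2 / (4 * a)" using c by (simp add: power_mult_distrib)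
    ultimately show ?thesis using c by (simp add: scaleR_conv_of_real mult_ac flip: of_real_mult)
  qed
  ultimately show ?thesis by simp
qed

text \<open>Lebesgue measure is the image of a product of one-dimensional measures under the
  coordinate expansion, so tensor products integrate factor by factor. This serves both the Gaussian
  and the majorant \<open>bracket\<close>.\<close>

lemma has_bochner_integral_lborel_prod:
  fixes f :: "'a::euclidean_space \<Rightarrow> real \<Rightarrow> 'b::{real_normed_field,banach,second_countable_topology}"
  assumes "\<And>b. b \<in> Basis \<Longrightarrow> has_bochner_integral lborel (f b) (I b)"
  shows "has_bochner_integral lborel (\<lambda>x. \<Prod>b\<in>Basis. f b (x \<bullet> b)) (\<Prod>b\<in>Basis. I b)"
proof -
  interpret product_sigma_finite "\<lambda>b::'a. lborel :: real measure" by standard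
  have m[measurable]: "\<And>b. b \<in> Basis \<Longrightarrow> f b \<in> borel_measurable borel"
    using assms borel_measurable_has_bochner_integral by fastforce
  let ?T = "\<lambda>g. \<Sum>b\<in>Basis. g b *\<^sub>R (b::'a)" let ?P = "\<Pi>\<^sub>M b\<in>(Basis::'a set). (lborel::real measure)"
  have T[measurable]: "?T \<in> measurable ?P borel" by measurable
  have F[measurable]: "(\<lambda>x::'a. \<Prod>b\<in>Basis. f b (x \<bullet> b)) \<in> borel_measurable borel"
    by (intro borel_measurable_prod) auto
  have e: "(\<Prod>b\<in>Basis. f b (?T g \<bullet> b)) = (\<Prod>b\<in>Basis. f b (g b))" for g :: "'a \<Rightarrow> real"
    by (intro prod.cong) auto
  have "integrable ?P (\<lambda>g. \<Prod>b\<in>Basis. f b (g b))"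
    by (rule product_integrable_prod) (use assms in \<open>auto simp: has_bochner_integral_iff\<close>)
  moreover have "(LINT g|?P. (\<Prod>b\<in>Basis. f b (g b))) = (\<Prod>b\<in>Basis. I b)"
    by (subst product_integral_prod) (use assms in \<open>auto simp: has_bochner_integral_iff\<close>)
  ultimately show ?thesis
    by (subst lborel_eq) (simp add: has_bochner_integral_iff integrable_distr_eq[OF T F] integral_distr[OF T F] e)
qed

lemma gauss_fourier:
  fixes \<eta> :: "'a::euclidean_space" assumes "a > 0"
  shows "has_bochner_integral lborel (\<lambda>x::'a. exp (- a * (norm x)\<^sup>2) * exp (\<i> * of_real (x \<bullet> \<eta>)))
    (complex_of_real (sqrt (pi / a) ^ DIM('a) * exp (- (norm \<eta>)\<^sup>2 / (4 * a))))"
proof -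
  have n2: "(norm x)\<^sup>2 = (\<Sum>b\<in>Basis. (x \<bullet> b)\<^sup>2)" for x :: 'a
    unfolding power2_norm_eq_inner by (subst euclidean_inner) (simp add: power2_eq_square)
  have 1: "has_bochner_integral lborel (\<lambda>x. \<Prod>b\<in>Basis. exp (- a * (x \<bullet> b)\<^sup>2) * exp (\<i> * of_real ((x \<bullet> b) * (\<eta> \<bullet> b))))
     (\<Prod>b\<in>(Basis::'a set). complex_of_real (sqrt (pi / a) * exp (- (\<eta> \<bullet> b)\<^sup>2 / (4 * a))))"
    by (rule has_bochner_integral_lborel_prod) (rule gauss_fourier_real[OF assms])
  have 2: "(\<Prod>b\<in>Basis. exp (- a * (x \<bullet> b)\<^sup>2) * exp (\<i> * of_real ((x \<bullet> b) * (\<eta> \<bullet> b))))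
     = exp (- a * (norm x)\<^sup>2) * exp (\<i> * of_real (x \<bullet> \<eta>))" for x
  proof -
    have "x \<bullet> \<eta> = (\<Sum>b\<in>Basis. (x \<bullet> b) * (\<eta> \<bullet> b))" by (rule euclidean_inner)
    then show ?thesis by (simp add: n2 prod.distrib exp_sum sum_distrib_left flip: of_real_prod sum_negf)
  qed
  have 3: "(\<Prod>b\<in>(Basis::'a set). complex_of_real (sqrt (pi / a) * exp (- (\<eta> \<bullet> b)\<^sup>2 / (4 * a))))
     = complex_of_real (sqrt (pi / a) ^ DIM('a) * exp (- (norm \<eta>)\<^sup>2 / (4 * a)))"
    by (simp add: n2 prod.distrib exp_sum sum_divide_distrib flip: of_real_prod sum_negf)
  show ?thesis using 1 by (simp only: 2 3)
qed

section \<open>Translations and the heat kernel\<close>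

lemma lborel_distr_reflect: "distr lborel borel (\<lambda>y. x - y) = (lborel :: 'a::euclidean_space measure)"
  using lborel_affine[of "-1::real" x] by (simp add: density_1)

lemma has_bochner_integral_reflect:
  fixes f :: "'a::euclidean_space \<Rightarrow> 'b::{banach,second_countable_topology}"
  assumes "has_bochner_integral lborel f I"
  shows "has_bochner_integral lborel (\<lambda>y. f (x - y)) I"
proof -
  have m: "f \<in> borel_measurable borel" using borel_measurable_has_bochner_integral[OF assms] by simp
  have "has_bochner_integral (distr lborel borel (\<lambda>y. x - y)) f I" using assms by (simp add: lborel_distr_reflect)
  then show ?thesis using m by (simp add: has_bochner_integral_iff integrable_distr_eq integral_distr)
qed

lemma has_bochner_integral_translate:
  fixes f :: "'a::euclidean_space \<Rightarrow> 'b::{banach,second_countable_topology}"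
  assumes "has_bochner_integral lborel f I"
  shows "has_bochner_integral lborel (\<lambda>y. f (y + x)) I"
proof -
  have m: "f \<in> borel_measurable borel" using borel_measurable_has_bochner_integral[OF assms] by simp
  have "has_bochner_integral (distr lborel borel ((+) x)) f I" using assms by (simp add: lborel_distr_plus)
  then show ?thesis using m by (simp add: has_bochner_integral_iff integrable_distr_eq integral_distr add.commute)
qed

lemma has_vector_derivative_iff_quotient:
  fixes f :: "real \<Rightarrow> 'b::real_normed_vector"
  shows "(f has_vector_derivative D) (at 0) \<longleftrightarrow> ((\<lambda>h. (f h - f 0) /\<^sub>R h) \<longlongrightarrow> D) (at 0)"
proof -
  have eq: "norm (f h - f 0 - h *\<^sub>R D) / norm h = norm ((f h - f 0) /\<^sub>R h - D)" if "h \<noteq> 0" for h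
  proof -
    have "(f h - f 0) /\<^sub>R h - D = (f h - f 0 - h *\<^sub>R D) /\<^sub>R h"
      using that by (simp add: scaleR_diff_right)
    then show ?thesis by (simp add: divide_inverse_commute)
  qed
  have "(f has_vector_derivative D) (at 0) \<longleftrightarrow> ((\<lambda>h. norm (f h - f 0 - h *\<^sub>R D) / norm h) \<longlongrightarrow> 0) (at 0)"
    by (simp add: has_vector_derivative_def has_derivative_at bounded_linear_scaleR_left)
  also have "\<dots> \<longleftrightarrow> ((\<lambda>h. norm ((f h - f 0) /\<^sub>R h - D)) \<longlongrightarrow> 0) (at 0)"
    by (rule tendsto_cong) (intro eventually_at_filter[THEN iffD2, OF always_eventually] allI impI eq)
  also have "\<dots> \<longleftrightarrow> ((\<lambda>h. (f h - f 0) /\<^sub>R h) \<longlongrightarrow> D) (at 0)"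
    unfolding tendsto_norm_zero_iff Lim_null[symmetric] ..
  finally show ?thesis .
qed

text \<open>The difference quotients along \<open>e\<close> integrate to zero by translation invariance.\<close>
lemma integral_directional_derivative_eq_0:
  fixes f :: "'a::euclidean_space \<Rightarrow> 'b::{banach,second_countable_topology}"
  assumes f: "integrable lborel f" and g: "integrable lborel g"
    and D: "\<And>y. ((\<lambda>h. f (y + h *\<^sub>R e)) has_vector_derivative f' y) (at 0)"
    and B: "\<And>y h. \<bar>h\<bar> \<le> 1 \<Longrightarrow> norm (f' (y + h *\<^sub>R e)) \<le> g y"
  shows "has_bochner_integral lborel f' 0"
proof -
  \<comment> \<open>\<open>D\<close> speaks of the parameter 0 only, but of every base point; moving
    the base point gives the derivative at every parameter of the line.\<close>
  have D': "((\<lambda>h. f (y + h *\<^sub>R e)) has_vector_derivative f' (y + h *\<^sub>R e)) (at h)" for y h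
  proof -
    have "((\<lambda>k. f ((y + h *\<^sub>R e) + k *\<^sub>R e)) has_vector_derivative f' (y + h *\<^sub>R e)) (at 0)" by (rule D)
    moreover have "((\<lambda>h'. h' - h) has_vector_derivative 1) (at h)" by (auto intro!: derivative_eq_intros)
    ultimately have "((\<lambda>k. f ((y + h *\<^sub>R e) + k *\<^sub>R e)) \<circ> (\<lambda>h'. h' - h) has_vector_derivative (1 *\<^sub>R f' (y + h *\<^sub>R e))) (at h)"
      by (intro vector_diff_chain_at) auto
    then show ?thesis by (simp add: o_def algebra_simps)
  qed
  define s where "s i y = real (Suc i) *\<^sub>R (f (y + (1 / real (Suc i)) *\<^sub>R e) - f y)" for i y
  have fm[measurable]: "f \<in> borel_measurable borel" using f by auto
  have sm: "s i \<in> borel_measurable lborel" for i unfolding s_def by measurable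
  have lim: "(\<lambda>i. s i y) \<longlonglongrightarrow> f' y" for y
  proof -
    have "((\<lambda>h. (f (y + h *\<^sub>R e) - f y) /\<^sub>R h) \<longlongrightarrow> f' y) (at 0)"
      using D[of y] by (simp add: has_vector_derivative_iff_quotient)
    then have "((\<lambda>i. (f (y + (1 / real (Suc i)) *\<^sub>R e) - f y) /\<^sub>R (1 / real (Suc i))) \<longlonglongrightarrow> f' y)"
      by (rule filterlim_compose) (use LIMSEQ_inverse_real_of_nat in \<open>simp add: filterlim_at inverse_eq_divide\<close>)
    then show ?thesis by (simp add: s_def)
  qed
  \<comment> \<open>Mean value inequality on the segment from y to y + e: as \<open>g\<close> bounds
    the derivative on all of it, one integrable function dominates every difference
    quotient.\<close>
  have bd: "norm (s i y) \<le> g y" for i y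
  proof -
    let ?h = "1 / real (Suc i)"
    have "norm (f (y + ?h *\<^sub>R e) - f (y + 0 *\<^sub>R e)) \<le> g y * norm (?h - 0)"
    proof (rule differentiable_bound[where S="{0..1}" and f'="\<lambda>h k. k *\<^sub>R f' (y + h *\<^sub>R e)"])
      fix h :: real assume "h \<in> {0..1}"
      then show "((\<lambda>h. f (y + h *\<^sub>R e)) has_derivative (\<lambda>k. k *\<^sub>R f' (y + h *\<^sub>R e))) (at h within {0..1})"
        using D'[of y h] by (auto simp: has_vector_derivative_def intro: has_derivative_at_withinI)
      show "onorm (\<lambda>k. k *\<^sub>R f' (y + h *\<^sub>R e)) \<le> g y"
        by (rule onorm_le) (use B[of h y] \<open>h \<in> {0..1}\<close> in \<open>auto simp: mult.commute intro!: mult_left_mono\<close>)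
    qed auto
    then show ?thesis unfolding s_def norm_scaleR by (simp add: field_simps del: of_nat_Suc)
  qed
  have f'm: "f' \<in> borel_measurable lborel"
    by (rule borel_measurable_LIMSEQ_metric[OF sm lim])
  have "(\<lambda>i. integral\<^sup>L lborel (s i)) \<longlonglongrightarrow> integral\<^sup>L lborel f'"
    by (rule integral_dominated_convergence[OF f'm sm g]) (auto simp: lim bd)
  moreover have "integral\<^sup>L lborel (s i) = 0" for i
  proof -
    have "has_bochner_integral lborel (\<lambda>y. f (y + (1 / real (Suc i)) *\<^sub>R e)) (integral\<^sup>L lborel f)"
      by (rule has_bochner_integral_translate) (use f in \<open>simp add: has_bochner_integral_iff\<close>)
    then show ?thesis unfolding s_def using f by (simp add: has_bochner_integral_iff)
  qed
  ultimately have "integral\<^sup>L lborel f' = 0" by (simp add: LIMSEQ_const_iff)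
  moreover have "integrable lborel f'"
    by (rule integrable_dominated_convergence[where s=s, OF f'm _ g]) (use sm lim bd in auto)
  ultimately show ?thesis by (simp add: has_bochner_integral_iff)
qed

section \<open>The heat kernel: transforms, derivatives and Gaussian majorants\<close>

definition heat :: "real \<Rightarrow> real^'n::finite \<Rightarrow> real" where
  "heat t x = exp (- (norm x)\<^sup>2 / (4 * t)) / sqrt (4 * pi * t) ^ CARD('n)"

lemma heat_nonneg [simp]: "t > 0 \<Longrightarrow> heat t x \<ge> 0" and heat_pos: "t > 0 \<Longrightarrow> heat t x > 0"
  by (auto simp: heat_def)

lemma heat_measurable [measurable]:
  assumes [measurable]: "f \<in> borel_measurable M" "g \<in> borel_measurable M"
  shows "(\<lambda>z. heat (f z) (g z)) \<in> borel_measurable M"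
  unfolding heat_def by measurable

lemma heat_minus_commute: "heat t (x - y) = heat t (y - x)"
  by (simp add: heat_def norm_minus_commute)

lemma heat_le: assumes "t > 0" shows "heat t (x::real^'n::finite) \<le> 1 / sqrt t ^ CARD('n)"
proof -
  have "exp (- (norm x)\<^sup>2 / (4 * t)) \<le> 1" using assms by simp
  moreover have "sqrt t ^ CARD('n) \<le> sqrt (4 * pi * t) ^ CARD('n)"
    using assms pi_ge_two by (intro power_mono) (auto simp: mult_le_cancel_right2 intro: order.trans[of 1 "4*2"])
  ultimately show ?thesis unfolding heat_def using assms by (intro frac_le) auto
qed

lemma heat_fourier:
  fixes \<xi> :: "real^'n::finite" assumes "t > 0"
  shows "has_bochner_integral lborel (\<lambda>x. heat t x * exp (\<i> * of_real (x \<bullet> \<xi>))) (complex_of_real (exp (- t * (norm \<xi>)\<^sup>2)))"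
proof -
  have "has_bochner_integral lborel (\<lambda>x. of_real (1 / sqrt (4 * pi * t) ^ CARD('n)) * (exp (- (1/(4*t)) * (norm x)\<^sup>2) * exp (\<i> * of_real (x \<bullet> \<xi>))))
    (of_real (1 / sqrt (4 * pi * t) ^ CARD('n)) * (complex_of_real (sqrt (pi / (1/(4*t))) ^ DIM(real^'n) * exp (- (norm \<xi>)\<^sup>2 / (4 * (1/(4*t)))))))"
    by (intro has_bochner_integral_mult_right gauss_fourier) (use assms in auto)
  moreover have "sqrt (pi / (1/(4*t))) ^ DIM(real^'n) = sqrt (4 * pi * t) ^ CARD('n)" by (simp add: mult_ac)
  moreover have "sqrt (4 * pi * t) ^ CARD('n) \<noteq> 0" using assms by simp
  ultimately show ?thesis using assms by (simp add: heat_def field_simps)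
qed

lemma heat_inv_fourier:
  fixes x :: "real^'n::finite" assumes "t > 0"
  shows "has_bochner_integral lborel (\<lambda>\<xi>. exp (- t * (2 * pi * norm \<xi>)\<^sup>2) * exp (2 * of_real pi * \<i> * of_real (x \<bullet> \<xi>))) (complex_of_real (heat t x))"
proof -
  have h: "has_bochner_integral lborel (\<lambda>\<xi>. exp (- (t * (2*pi)\<^sup>2) * (norm \<xi>)\<^sup>2) * exp (\<i> * of_real (\<xi> \<bullet> ((2*pi) *\<^sub>R x))))
    (complex_of_real (sqrt (pi / (t * (2*pi)\<^sup>2)) ^ DIM(real^'n) * exp (- (norm ((2*pi) *\<^sub>R x))\<^sup>2 / (4 * (t * (2*pi)\<^sup>2)))))"
    by (intro gauss_fourier) (use assms in auto)
  have v: "sqrt (pi / (t * (2*pi)\<^sup>2)) ^ DIM(real^'n) * exp (- (norm ((2*pi) *\<^sub>R x))\<^sup>2 / (4 * (t * (2*pi)\<^sup>2))) = heat t x"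
  proof -
    have 1: "pi / (t * (2*pi)\<^sup>2) = 1 / (4 * pi * t)" by (simp add: power2_eq_square)
    have 2: "(norm ((2*pi) *\<^sub>R x))\<^sup>2 / (4 * (t * (2*pi)\<^sup>2)) = (norm x)\<^sup>2 / (4 * t)"
      by (simp add: power_mult_distrib)
    show ?thesis unfolding heat_def minus_divide_left[symmetric] 1 2 by (simp add: real_sqrt_divide power_divide)
  qed
  have "(\<lambda>\<xi>. exp (- (t * (2*pi)\<^sup>2) * (norm \<xi>)\<^sup>2) * exp (\<i> * of_real (\<xi> \<bullet> ((2*pi) *\<^sub>R x))))
    = (\<lambda>\<xi>. exp (- t * (2 * pi * norm \<xi>)\<^sup>2) * exp (2 * of_real pi * \<i> * of_real (x \<bullet> \<xi>)))"
    by (simp add: fun_eq_iff power_mult_distrib mult_ac inner_commute)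
  then show ?thesis using h unfolding v by simp
qed

lemma heat_integral: "t > 0 \<Longrightarrow> has_bochner_integral lborel (heat t :: real^'n::finite \<Rightarrow> real) 1"
  using has_bochner_integral_Re[OF heat_fourier[of t 0]] by simp

lemma heat_integrable [simp]: "t > 0 \<Longrightarrow> integrable lborel (\<lambda>y. heat t (x - y::real^'n::finite))"
  "t > 0 \<Longrightarrow> integrable lborel (\<lambda>y. heat t (y::real^'n::finite))"
  using has_bochner_integral_reflect[OF heat_integral] heat_integral by (blast intro: has_bochner_integral_iff[THEN iffD1, THEN conjunct1])+

lemma nn_integral_heat: assumes "t > 0" shows "(\<integral>\<^sup>+y. heat t (x - y::real^'n::finite) \<partial>lborel) = 1"
  "(\<integral>\<^sup>+y. heat t (y - x::real^'n::finite) \<partial>lborel) = 1"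
proof -
  show "(\<integral>\<^sup>+y. heat t (x - y::real^'n::finite) \<partial>lborel) = 1"
    using has_bochner_integral_reflect[OF heat_integral[OF assms], of x] assms
    by (subst nn_integral_eq_integral) (auto simp: has_bochner_integral_iff)
  then show "(\<integral>\<^sup>+y. heat t (y - x::real^'n::finite) \<partial>lborel) = 1" by (simp add: heat_minus_commute)
qed

text \<open>The first and, next, the pure second partial derivative of the heat kernel in closed
  form, as \<open>heat_directional\<close> and \<open>dheat_directional\<close> confirm. Mixed
  derivatives do not occur because the Laplacian is used as the divergence of a gradient.\<close>

definition dheat :: "real \<Rightarrow> 'n::finite \<Rightarrow> real^'n \<Rightarrow> real" where
  "dheat t j x = - (x $ j) / (2 * t) * heat t x"

definition ddheat :: "real \<Rightarrow> 'n::finite \<Rightarrow> real^'n \<Rightarrow> real" where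
  "ddheat t j x = ((x $ j)\<^sup>2 / (4 * t\<^sup>2) - 1 / (2 * t)) * heat t x"

lemma borel_measurable_cart_nth [measurable (raw)]:
  fixes g :: "'a \<Rightarrow> real^'n"
  assumes "g \<in> borel_measurable M" shows "(\<lambda>z. g z $ j) \<in> borel_measurable M"
  unfolding cart_eq_inner_axis using assms by measurable

lemma dheat_measurable [measurable]:
  assumes [measurable]: "f \<in> borel_measurable M" "g \<in> borel_measurable M"
  shows "(\<lambda>z. dheat (f z) j (g z)) \<in> borel_measurable M" "(\<lambda>z. ddheat (f z) j (g z)) \<in> borel_measurable M"
  unfolding dheat_def ddheat_def by measurable

lemma norm_add_axis_sq: "(norm (x + h *\<^sub>R axis j (1::real)))\<^sup>2 = (norm x)\<^sup>2 + 2 * h * x $ j + h\<^sup>2"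
  unfolding power2_norm_eq_inner
  by (simp add: inner_add_left inner_add_right inner_axis inner_axis' power2_eq_square algebra_simps)

lemma heat_directional:
  assumes "t > 0"
  shows "((\<lambda>h. heat t (x + h *\<^sub>R axis j 1)) has_vector_derivative dheat t j x) (at 0)"
proof -
  have "((\<lambda>h. exp (- ((norm x)\<^sup>2 + 2 * h * x $ j + h\<^sup>2) / (4 * t)) / sqrt (4 * pi * t) ^ CARD('a)) has_real_derivative
     (exp (- (norm x)\<^sup>2 / (4 * t)) * (- (2 * x $ j) / (4 * t))) / sqrt (4 * pi * t) ^ CARD('a)) (at 0)"
    by (rule DERIV_cdivide) (use assms in \<open>auto intro!: derivative_eq_intros\<close>)
  then show ?thesis
    unfolding heat_def norm_add_axis_sq dheat_def has_real_derivative_iff_has_vector_derivative[symmetric]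
    by (rule DERIV_cong) simp
qed

lemma dheat_directional:
  assumes "t > 0"
  shows "((\<lambda>h. dheat t j (x + h *\<^sub>R axis j 1)) has_vector_derivative ddheat t j x) (at 0)"
proof -
  have "((\<lambda>h. - (x $ j + h) / (2 * t)) has_real_derivative - 1 / (2 * t)) (at 0)"
    using assms by (auto intro!: derivative_eq_intros)
  moreover have "(x + h *\<^sub>R axis j 1) $ j = x $ j + h" for h by (simp add: axis_def)
  ultimately have "((\<lambda>h. - ((x + h *\<^sub>R axis j 1) $ j) / (2 * t)) has_real_derivative - 1 / (2 * t)) (at 0)" by simp
  from DERIV_mult[OF this heat_directional[OF assms, of x j, folded has_real_derivative_iff_has_vector_derivative]]
  show ?thesis unfolding dheat_def ddheat_def has_real_derivative_iff_has_vector_derivative[symmetric]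
    by (rule DERIV_cong) (use assms in \<open>simp add: field_simps power2_eq_square\<close>)
qed

text \<open>Half of the exponent is split off. It can absorb polynomial weights at the price of
  doubling the time, which is the origin of every factor \<open>sqrt 2 ^ CARD('n)\<close>.\<close>

lemma heat_double:
  assumes "t > 0"
  shows "heat t (x::real^'n::finite) = sqrt 2 ^ CARD('n) * exp (- ((norm x)\<^sup>2 / t / 8)) * heat (2 * t) x"
proof -
  have "sqrt (4 * pi * (2 * t)) = sqrt 2 * sqrt (4 * pi * t)" using real_sqrt_mult[of 2 "4 * pi * t"] by (simp only: mult_ac)
  moreover have "exp (- (norm x)\<^sup>2 / (4 * t)) = exp (- ((norm x)\<^sup>2 / t / 8)) * exp (- (norm x)\<^sup>2 / (4 * (2 * t)))"
    by (subst exp_add[symmetric]) (use assms in \<open>simp add: field_simps\<close>)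
  ultimately show ?thesis using assms by (simp add: heat_def power_mult_distrib)
qed

lemma norm_heat_le:
  assumes "t > 0"
  shows "norm x * heat t (x::real^'n::finite) \<le> 2 * sqrt 2 ^ CARD('n) * sqrt t * heat (2 * t) x"
proof -
  define z where "z = norm x / sqrt t"
  have z: "z \<ge> 0" "norm x = z * sqrt t" "(norm x)\<^sup>2 / t = z\<^sup>2" using assms by (auto simp: z_def power_divide)
  \<comment> \<open>The square expands to 1 + z^2/8 - z/2, so z is at most 2 (1 + z^2/8), and 1 + y
    is at most exp y.\<close>
  have "0 \<le> (z / 2 - 1)\<^sup>2 / 2 + 1 / 2" by simp
  then have "z \<le> 2 * (1 + z\<^sup>2 / 8)" by (simp add: power2_eq_square field_simps)
  also have "\<dots> \<le> 2 * exp (z\<^sup>2 / 8)" by (intro mult_left_mono exp_ge_add_one_self) auto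
  finally have "z * exp (- (z\<^sup>2 / 8)) \<le> 2" by (simp add: exp_minus field_simps)
  then have "(z * exp (- (z\<^sup>2 / 8))) * (sqrt 2 ^ CARD('n) * sqrt t * heat (2 * t) x) \<le> 2 * (sqrt 2 ^ CARD('n) * sqrt t * heat (2 * t) x)"
    using assms by (intro mult_right_mono) auto
  moreover have "norm x * heat t x = (z * exp (- (z\<^sup>2 / 8))) * (sqrt 2 ^ CARD('n) * sqrt t * heat (2 * t) x)"
    unfolding heat_double[OF assms] z(3) by (subst z(2)) (simp only: mult_ac)
  ultimately show ?thesis by (simp only: mult_ac)
qed

lemma heat_le_double: assumes "t > 0" shows "heat t (x::real^'n::finite) \<le> sqrt 2 ^ CARD('n) * heat (2 * t) x"
  unfolding heat_double[OF assms] using assms by (intro mult_right_mono) auto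

lemma dheat_le:
  assumes "t > 0"
  shows "\<bar>dheat t j (x::real^'n::finite)\<bar> \<le> 2 * sqrt 2 ^ CARD('n) / sqrt t * heat (2 * t) x"
proof -
  have "\<bar>dheat t j x\<bar> = \<bar>x $ j\<bar> * heat t x / (2 * t)" using assms by (simp add: dheat_def abs_mult)
  also have "\<dots> \<le> norm x * heat t x / (2 * t)"
    using assms component_le_norm_cart[of x j] by (intro divide_right_mono mult_right_mono) auto
  also have "\<dots> \<le> 2 * sqrt 2 ^ CARD('n) * sqrt t * heat (2 * t) x / (2 * t)"
    using assms norm_heat_le[OF assms, of x] by (intro divide_right_mono) auto
  also have "\<dots> = sqrt 2 ^ CARD('n) / sqrt t * heat (2 * t) x"
    using assms by (simp add: real_div_sqrt field_simps)
  \<comment> \<open>A factor 2 is given away so that this bound and \<open>ddheat_le\<close> share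
    one constant, later called \<open>K\<close>.\<close>
  also have "\<dots> \<le> 2 * sqrt 2 ^ CARD('n) / sqrt t * heat (2 * t) x"
    using assms by (intro mult_right_mono divide_right_mono) auto
  finally show ?thesis .
qed

lemma ddheat_le:
  assumes "t > 0"
  shows "\<bar>ddheat t j (x::real^'n::finite)\<bar> \<le> 2 * sqrt 2 ^ CARD('n) / t * heat (2 * t) x"
proof -
  define z where "z = (norm x)\<^sup>2 / t"
  have "z \<ge> 0" using assms by (simp add: z_def)
  have "\<bar>(x $ j)\<^sup>2 / (4 * t\<^sup>2) - 1 / (2 * t)\<bar> \<le> (x $ j)\<^sup>2 / (4 * t\<^sup>2) + 1 / (2 * t)"
    using assms by (intro abs_leI) auto
  also have "\<dots> \<le> (norm x)\<^sup>2 / (4 * t\<^sup>2) + 1 / (2 * t)"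
    using assms component_le_norm_cart[of x j] by (intro add_right_mono divide_right_mono) (auto simp: abs_le_square_iff[symmetric])
  also have "\<dots> \<le> 2 / t * (1 + z / 8)" using assms by (simp add: z_def field_simps power2_eq_square)
  also have "\<dots> \<le> 2 / t * exp (z / 8)" using assms exp_ge_add_one_self[of "z / 8"] by (intro mult_left_mono) auto
  finally have "\<bar>ddheat t j x\<bar> \<le> 2 / t * exp (z / 8) * heat t x"
    using assms unfolding ddheat_def abs_mult by (intro mult_mono) auto
  also have "\<dots> = 2 * sqrt 2 ^ CARD('n) / t * heat (2 * t) x * (exp (z / 8) * exp (- (z/8)))"
    unfolding heat_double[OF assms] z_def by (simp add: mult_ac)
  also have "exp (z / 8) * exp (- (z/8)) = 1" by (simp flip: exp_add)
  finally show ?thesis by simp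
qed

text \<open>Supplies the majorant for \<open>integral_directional_derivative_eq_0\<close>: a single
  integrable function that dominates the kernel under all shifts of length at most 1. It rests on
  |x|^2 being at most 2|x + e|^2 + 2|e|^2.\<close>

lemma heat_shift_le:
  assumes "t > 0" "norm e \<le> 1"
  shows "heat t (x + e::real^'n::finite) \<le> exp (1 / (4 * t)) * sqrt 2 ^ CARD('n) * heat (2 * t) x"
proof -
  have "(norm x)\<^sup>2 \<le> (norm (x + e) + norm e)\<^sup>2"
    using norm_triangle_ineq4[of "x + e" e] by (intro power_mono) auto
  also have "\<dots> \<le> 2 * (norm (x + e))\<^sup>2 + 2 * (norm e)\<^sup>2" using sum_squares_bound[of "norm (x + e)" "norm e"] by (simp add: power2_sum)
  finally have "(norm x)\<^sup>2 / 2 \<le> (norm (x + e))\<^sup>2 + 1"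
    using power_le_one[OF norm_ge_zero assms(2), of 2] by simp
  then have "(norm x)\<^sup>2 / 2 / (4 * t) \<le> ((norm (x + e))\<^sup>2 + 1) / (4 * t)" using assms by (intro divide_right_mono) auto
  then have "- (norm (x + e))\<^sup>2 / (4 * t) \<le> 1 / (4 * t) + (- (norm x)\<^sup>2 / (4 * (2 * t)))"
    by (simp add: add_divide_distrib)
  then have 1: "exp (- (norm (x + e))\<^sup>2 / (4 * t)) \<le> exp (1 / (4 * t)) * exp (- (norm x)\<^sup>2 / (4 * (2 * t)))"
    by (simp flip: exp_add)
  have 2: "sqrt (4 * pi * (2 * t)) = sqrt 2 * sqrt (4 * pi * t)" using real_sqrt_mult[of 2 "4 * pi * t"] by (simp only: mult_ac)
  have "heat t (x + e) \<le> exp (1 / (4 * t)) * exp (- (norm x)\<^sup>2 / (4 * (2 * t))) / sqrt (4 * pi * t) ^ CARD('n)"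
    unfolding heat_def by (intro divide_right_mono 1) (use assms in auto)
  also have "\<dots> = exp (1 / (4 * t)) * sqrt 2 ^ CARD('n) * heat (2 * t) x"
    unfolding heat_def 2 power_mult_distrib by simp
  finally show ?thesis .
qed

lemma has_vector_derivative_reflect:
  fixes k :: "'a::real_vector \<Rightarrow> 'b::real_normed_vector"
  assumes "\<And>z. ((\<lambda>h. k (z + h *\<^sub>R e)) has_vector_derivative k' z) (at 0)"
  shows "((\<lambda>h. k (x - (y + h *\<^sub>R e))) has_vector_derivative - k' (x - y)) (at 0)"
proof -
  have "((\<lambda>h. k ((x - y) + h *\<^sub>R e)) \<circ> uminus has_vector_derivative ((-1) *\<^sub>R k' (x - y))) (at 0)"
    using assms[of "x - y"] by (intro vector_diff_chain_at) (auto intro!: derivative_eq_intros)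
  moreover have "x - (y + h *\<^sub>R e) = (x - y) + (- h) *\<^sub>R e" for h by (simp add: algebra_simps)
  ultimately show ?thesis by (simp only: o_def) simp
qed

text \<open>The product of k(x - y) and f(y) has directional derivative k f' - k' f in y, and the
  integral of such a derivative vanishes. The kernel is kept abstract because the application has
  \<open>dheat\<close> for \<open>k\<close> and \<open>ddheat\<close> for \<open>k'\<close>.\<close>

lemma heat_kernel_ibp:
  fixes f f' :: "real^'n::finite \<Rightarrow> real"
  assumes t: "t > 0" and km: "k \<in> borel_measurable borel"
    and k: "\<And>z. ((\<lambda>h. k (z + h *\<^sub>R axis j 1)) has_vector_derivative k' z) (at 0)"
    and kb: "\<And>z. \<bar>k z\<bar> \<le> M * heat t z" "\<And>z. \<bar>k' z\<bar> \<le> M * heat t z"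
    and f: "\<And>y. ((\<lambda>h. f (y + h *\<^sub>R axis j 1)) has_vector_derivative f' y) (at 0)"
    and fm [measurable]: "f \<in> borel_measurable borel" "f' \<in> borel_measurable borel" "k' \<in> borel_measurable borel"
    and fb: "\<And>y. \<bar>f y\<bar> \<le> B" "\<And>y. \<bar>f' y\<bar> \<le> B"
  shows "(LINT y|lborel. k' (x - y) * f y) = (LINT y|lborel. k (x - y) * f' y)"
proof -
  note [measurable] = km
  have B: "B \<ge> 0" using fb(1)[of 0] by simp
  have M: "M \<ge> 0" using kb(1)[of 0] heat_pos[OF t, of 0] by (smt (verit) mult_neg_pos)
  have hb: "\<bar>p * q\<bar> \<le> B * M * heat t z" if "\<bar>p\<bar> \<le> M * heat t z" "\<bar>q\<bar> \<le> B" for p q and z :: "real^'n"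
    using mult_mono[OF that] that B by (simp add: abs_mult mult_ac)
  have i: "integrable lborel (\<lambda>y. a (x - y) * b y)"
    if "a \<in> borel_measurable borel" "b \<in> borel_measurable borel" "\<And>z. \<bar>a z\<bar> \<le> M * heat t z" "\<And>z. \<bar>b z\<bar> \<le> B" for a b :: "real^'n \<Rightarrow> real"
    by (rule Bochner_Integration.integrable_bound[of _ "\<lambda>y. B * M * heat t (x - y)"])
       (use that t hb[OF that(3) that(4)] B M in \<open>auto\<close>)
  have "has_bochner_integral lborel (\<lambda>y. k (x - y) * f' y - k' (x - y) * f y) 0"
  proof (rule integral_directional_derivative_eq_0[where f="\<lambda>y. k (x - y) * f y" and e="axis j 1"
        and g="\<lambda>y. 2 * B * M * (exp (1 / (4 * t)) * sqrt 2 ^ CARD('n) * heat (2 * t) (x - y))"])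
    show "integrable lborel (\<lambda>y. k (x - y) * f y)" by (rule i) (use kb fb in auto)
    show "integrable lborel (\<lambda>y. 2 * B * M * (exp (1 / (4 * t)) * sqrt 2 ^ CARD('n) * heat (2 * t) (x - y)))"
      using t by auto
    fix y h
    show "((\<lambda>h. k (x - (y + h *\<^sub>R axis j 1)) * f (y + h *\<^sub>R axis j 1)) has_vector_derivative
         k (x - y) * f' y - k' (x - y) * f y) (at 0)"
      by (rule has_vector_derivative_eq_rhs, rule has_vector_derivative_mult[OF has_vector_derivative_reflect[of k, OF k] f]) simp
    assume "\<bar>h\<bar> \<le> (1::real)"
    let ?z = "x - (y + h *\<^sub>R axis j 1)"
    have "\<bar>k ?z * f' (y + h *\<^sub>R axis j 1) - k' ?z * f (y + h *\<^sub>R axis j 1)\<bar> \<le> B * M * heat t ?z + B * M * heat t ?z"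
      by (rule order.trans[OF abs_triangle_ineq4]) (intro add_mono hb kb fb)
    also have "\<dots> = 2 * B * M * heat t ((x - y) + (- h) *\<^sub>R axis j 1)" by (simp add: algebra_simps)
    also have "\<dots> \<le> 2 * B * M * (exp (1 / (4 * t)) * sqrt 2 ^ CARD('n) * heat (2 * t) (x - y))"
      using B M \<open>\<bar>h\<bar> \<le> 1\<close> by (intro mult_left_mono heat_shift_le t) auto
    finally show "norm (k ?z * f' (y + h *\<^sub>R axis j 1) - k' ?z * f (y + h *\<^sub>R axis j 1)) \<le> \<dots>" by simp
  qed
  moreover have "integrable lborel (\<lambda>y. k (x - y) * f' y)" "integrable lborel (\<lambda>y. k' (x - y) * f y)"
    by (rule i; use kb fb in auto)+
  ultimately show ?thesis by (simp add: has_bochner_integral_iff)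
qed

text \<open>A Gaussian in frequency is itself a multiple of a heat kernel at the reciprocal time, so
  the kernel majorants can be used on the Fourier side too.\<close>

lemma gauss_eq_heat:
  assumes "t > 0"
  shows "exp (- t * (2 * pi * norm (\<xi>::real^'n::finite))\<^sup>2) = sqrt (1 / (4 * pi * t)) ^ CARD('n) * heat (1 / (16 * pi\<^sup>2 * t)) \<xi>"
proof -
  have 1: "4 * pi * (1 / (16 * pi\<^sup>2 * t)) = 1 / (4 * pi * t)" by (simp add: power2_eq_square)
  have 2:  "- (norm \<xi>)\<^sup>2 / (4 * (1 / (16 * pi\<^sup>2 * t))) = - t * (2 * pi * norm \<xi>)\<^sup>2"
    using assms by (simp add: power_mult_distrib)
  show ?thesis using assms unfolding heat_def 1 2 by simp
qed

text \<open>Instead of differentiating under the integral in x, the integrand is differentiated in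
  the frequency. That the integral of this derivative is zero expresses the transform of \<xi>_j
  times a Gaussian by x_j times the heat kernel. The symbol carries the sign convention of
  \<open>nabla_minus\<close>.\<close>

lemma dheat_inv_fourier:
  fixes x :: "real^'n::finite" assumes t: "t > 0"
  shows "has_bochner_integral lborel (\<lambda>\<xi>. (- 2 * of_real pi * \<i> * of_real (\<xi> $ j)) * exp (- t * (2 * pi * norm \<xi>)\<^sup>2) * exp (2 * of_real pi * \<i> * of_real (x \<bullet> \<xi>))) (complex_of_real (- dheat t j x))"
proof -
  define f where "f \<xi> = complex_of_real (exp (- t * (2 * pi * norm \<xi>)\<^sup>2)) * exp (2 * of_real pi * \<i> * of_real (x \<bullet> \<xi>))" for \<xi>
  define T where "T = 1 / (16 * pi\<^sup>2 * t)"
  define c where "c = sqrt (1 / (4 * pi * t)) ^ CARD('n)"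
  have T: "T > 0" and c: "c > 0" using t by (auto simp: T_def c_def)
  have fint: "has_bochner_integral lborel f (complex_of_real (heat t x))"
    using heat_inv_fourier[OF t, of x] unfolding f_def by (simp only: of_real_exp)
  have nf: "norm (f \<xi>) = c * heat T \<xi>" for \<xi>
  proof -
    have "norm (f \<xi>) = exp (- t * (2 * pi * norm \<xi>)\<^sup>2)" by (simp add: f_def norm_mult)
    then show ?thesis unfolding gauss_eq_heat[OF t] c_def T_def .
  qed
  have "has_bochner_integral lborel (\<lambda>\<xi>. of_real (- 8 * pi\<^sup>2 * t * \<xi> $ j) * f \<xi> + (2 * of_real pi * \<i> * of_real (x $ j)) * f \<xi>) 0"
  proof (rule integral_directional_derivative_eq_0[where f=f and e="axis j 1"
        and g="\<lambda>\<xi>. c * (8 * pi\<^sup>2 * t * (2 * sqrt 2 ^ CARD('n) * sqrt T) * (exp (1 / (4 * (2*T))) * sqrt 2 ^ CARD('n) * heat (2 * (2*T)) \<xi>)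
            + 2 * pi * \<bar>x $ j\<bar> * (exp (1 / (4 * T)) * sqrt 2 ^ CARD('n) * heat (2 * T) \<xi>))"])
    show "integrable lborel f" using fint by (simp add: has_bochner_integral_iff)
    show "integrable lborel (\<lambda>\<xi>. c * (8 * pi\<^sup>2 * t * (2 * sqrt 2 ^ CARD('n) * sqrt T) * (exp (1 / (4 * (2*T))) * sqrt 2 ^ CARD('n) * heat (2 * (2*T)) \<xi>)
            + 2 * pi * \<bar>x $ j\<bar> * (exp (1 / (4 * T)) * sqrt 2 ^ CARD('n) * heat (2 * T) (\<xi>::real^'n))))"
      using T by auto
    fix y :: "real^'n" and h :: real
    have e: "f (y + h *\<^sub>R axis j 1) = complex_of_real (exp (- t * (2 * pi)\<^sup>2 * ((norm y)\<^sup>2 + 2 * h * y $ j + h\<^sup>2))) * exp (2 * of_real pi * \<i> * of_real (x \<bullet> y + h * x $ j))" for h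
      unfolding f_def power_mult_distrib norm_add_axis_sq by (simp add: inner_add_right inner_axis mult_ac)
    show "((\<lambda>h. f (y + h *\<^sub>R axis j 1)) has_vector_derivative of_real (- 8 * pi\<^sup>2 * t * y $ j) * f y + (2 * of_real pi * \<i> * of_real (x $ j)) * f y) (at 0)"
    proof -
      have 1: "((\<lambda>h. complex_of_real (exp (- t * (2 * pi)\<^sup>2 * ((norm y)\<^sup>2 + 2 * h * y $ j + h\<^sup>2)))) has_vector_derivative
          of_real (exp (- t * (2 * pi * norm y)\<^sup>2) * (- 8 * pi\<^sup>2 * t * y $ j))) (at 0)"
        by (rule has_vector_derivative_of_real) (auto intro!: derivative_eq_intros simp: power_mult_distrib)
      have 2: "((\<lambda>h. exp (2 * of_real pi * \<i> * of_real (x \<bullet> y + h * x $ j))) has_vector_derivative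
          (2 * of_real pi * \<i> * of_real (x $ j)) * exp (2 * of_real pi * \<i> * of_real (x \<bullet> y))) (at 0)"
      proof -
        have "((\<lambda>z. exp (2 * of_real pi * \<i> * (of_real (x \<bullet> y) + z * of_real (x $ j)))) has_field_derivative
          (2 * of_real pi * \<i> * of_real (x $ j)) * exp (2 * of_real pi * \<i> * of_real (x \<bullet> y))) (at (of_real 0))"
          by (rule derivative_eq_intros refl | simp)+
        from has_vector_derivative_real_field[OF this] show ?thesis by simp
      qed
      show ?thesis unfolding e
        by (rule has_vector_derivative_eq_rhs, rule has_vector_derivative_mult[OF 1 2])
           (simp add: f_def power_mult_distrib algebra_simps)
    qed
    assume "\<bar>h\<bar> \<le> 1"
    let ?y = "y + h *\<^sub>R axis j 1"
    have "norm (of_real (- 8 * pi\<^sup>2 * t * ?y $ j) * f ?y + (2 * of_real pi * \<i> * of_real (x $ j)) * f ?y)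
       \<le> norm (of_real (- 8 * pi\<^sup>2 * t * ?y $ j) * f ?y) + norm ((2 * of_real pi * \<i> * of_real (x $ j)) * f ?y)"
      by (rule norm_triangle_ineq)
    also have "\<dots> = c * (8 * pi\<^sup>2 * t * (\<bar>?y $ j\<bar> * heat T ?y) + 2 * pi * \<bar>x $ j\<bar> * heat T ?y)"
      unfolding norm_mult nf norm_of_real using t by (simp add: abs_mult) (simp add: algebra_simps)
    also have "\<dots> \<le> c * (8 * pi\<^sup>2 * t * (2 * sqrt 2 ^ CARD('n) * sqrt T * heat (2 * T) ?y) + 2 * pi * \<bar>x $ j\<bar> * heat T ?y)"
    proof -
      have "\<bar>?y $ j\<bar> * heat T ?y \<le> norm ?y * heat T ?y"
        using T component_le_norm_cart[of ?y j] by (intro mult_right_mono) auto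
      also note norm_heat_le[OF T, of ?y]
      finally show ?thesis using c t by (intro mult_left_mono add_right_mono) auto
    qed
    also have "\<dots> \<le> c * (8 * pi\<^sup>2 * t * (2 * sqrt 2 ^ CARD('n) * sqrt T * (exp (1 / (4 * (2*T))) * sqrt 2 ^ CARD('n) * heat (2 * (2*T)) y))
            + 2 * pi * \<bar>x $ j\<bar> * (exp (1 / (4 * T)) * sqrt 2 ^ CARD('n) * heat (2 * T) y))"
      using c t T \<open>\<bar>h\<bar> \<le> 1\<close> by (intro mult_left_mono add_mono heat_shift_le) auto
    finally show "norm (of_real (- 8 * pi\<^sup>2 * t * ?y $ j) * f ?y + (2 * of_real pi * \<i> * of_real (x $ j)) * f ?y) \<le>
        c * (8 * pi\<^sup>2 * t * (2 * sqrt 2 ^ CARD('n) * sqrt T) * (exp (1 / (4 * (2*T))) * sqrt 2 ^ CARD('n) * heat (2 * (2*T)) y)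
            + 2 * pi * \<bar>x $ j\<bar> * (exp (1 / (4 * T)) * sqrt 2 ^ CARD('n) * heat (2 * T) y))" by (simp add: mult_ac)
  qed
  from has_bochner_integral_diff[OF this has_bochner_integral_mult_right[OF fint, of "2 * of_real pi * \<i> * of_real (x $ j)"]]
  have "has_bochner_integral lborel (\<lambda>\<xi>. of_real (- 8 * pi\<^sup>2 * t * \<xi> $ j) * f \<xi>) (- (2 * of_real pi * \<i> * of_real (x $ j) * heat t x))"
    by simp
  \<comment> \<open>This factor turns -8 pi^2 t \<xi>_j into -2 pi i \<xi>_j.\<close>
  from has_bochner_integral_mult_right[OF this, of "\<i> / (4 * of_real pi * of_real t)"]
  have h: "has_bochner_integral lborel (\<lambda>\<xi>. \<i> / (4 * of_real pi * of_real t) * (of_real (- 8 * pi\<^sup>2 * t * \<xi> $ j) * f \<xi>))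
      (\<i> / (4 * of_real pi * of_real t) * (- (2 * of_real pi * \<i> * of_real (x $ j) * heat t x)))" .
  have e1: "\<i> / (4 * of_real pi * of_real t) * (of_real (- 8 * pi\<^sup>2 * t * \<xi> $ j) * f \<xi>) = (- 2 * of_real pi * \<i> * of_real (\<xi> $ j)) * exp (- t * (2 * pi * norm \<xi>)\<^sup>2) * exp (2 * of_real pi * \<i> * of_real (x \<bullet> \<xi>))" for \<xi>
    using t by (simp add: f_def field_simps power2_eq_square of_real_exp)
  have e2: "\<i> / (4 * of_real pi * of_real t) * (- (2 * of_real pi * \<i> * of_real (x $ j) * heat t x)) = complex_of_real (- dheat t j x)"
    using t by (simp add: dheat_def field_simps power2_eq_square)
  show ?thesis using h unfolding e1 e2 .
qed

section \<open>Subordination\<close>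

lemma nn_integral_powr_from_0:
  fixes a T :: real assumes "a > 0" "T \<ge> 0"
  shows "(\<integral>\<^sup>+t\<in>{0<..T}. ennreal (t powr (a - 1)) \<partial>lborel) = ennreal (T powr a / a)"
proof -
  have "(\<integral>\<^sup>+t\<in>{0..T}. ennreal (t powr (a - 1)) \<partial>lborel) = ennreal (T powr a / a)"
    using has_integral_powr_from_0[of "a - 1" T] assms by (intro nn_integral_has_integral_lebesgue') auto
  \<comment> \<open>The endpoint may be dropped pointwise, since \<open>0 powr (a - 1)\<close> is
    0.\<close>
  moreover have "(\<integral>\<^sup>+t\<in>{0..T}. ennreal (t powr (a - 1)) \<partial>lborel) = (\<integral>\<^sup>+t\<in>{0<..T}. ennreal (t powr (a - 1)) \<partial>lborel)"
    by (intro nn_integral_cong) (auto simp: indicator_def)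
  ultimately show ?thesis by simp
qed

lemma nn_integral_powr_to_inf:
  fixes a T :: real assumes "a > 0" "T > 0"
  shows "(\<integral>\<^sup>+t\<in>{T..}. ennreal (t powr (- a - 1)) \<partial>lborel) = ennreal (T powr - a / a)"
proof (rule nn_integral_has_integral_lebesgue')
  have "((\<lambda>x. x powr (- a - 1)) has_integral - (T powr (- a - 1 + 1)) / (- a - 1 + 1)) {T..}"
    using assms by (intro has_integral_powr_to_inf) auto
  then show "((\<lambda>x. x powr (- a - 1)) has_integral T powr - a / a) {T..}" by simp
qed simp

text \<open>Split at \<tau> = t: below it \<tau> is dropped from the root, above it t is dropped.
  The condition z > 0 gives convergence at 0 and z < 1/2 gives it at infinity. The exact value is a
  Beta function times the same power of t.\<close>

lemma nn_integral_powr_div_sqrt: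
  fixes z t :: real assumes z: "0 < z" "z < 1/2" and t: "t > 0"
  shows "(\<integral>\<^sup>+\<tau>\<in>{0<..}. ennreal (\<tau> powr (z - 1) / sqrt (t + \<tau>)) \<partial>lborel) \<le> ennreal ((1 / z + 1 / (1/2 - z)) * t powr (z - 1/2))"
proof -
  have "(\<integral>\<^sup>+\<tau>\<in>{0<..}. ennreal (\<tau> powr (z - 1) / sqrt (t + \<tau>)) \<partial>lborel)
     \<le> (\<integral>\<^sup>+\<tau>. ennreal (t powr (-1/2)) * (ennreal (\<tau> powr (z - 1)) * indicator {0<..t} \<tau>) + ennreal (\<tau> powr (- (1/2 - z) - 1)) * indicator {t..} \<tau> \<partial>lborel)"
  proof (intro nn_integral_mono)
    fix \<tau> :: real
    show "ennreal (\<tau> powr (z - 1) / sqrt (t + \<tau>)) * indicator {0<..} \<tau> \<le>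
      ennreal (t powr (-1/2)) * (ennreal (\<tau> powr (z - 1)) * indicator {0<..t} \<tau>) + ennreal (\<tau> powr (- (1/2 - z) - 1)) * indicator {t..} \<tau>"
    proof (cases "\<tau> > 0")
      case True
      have "\<tau> powr (z - 1) / sqrt (t + \<tau>) \<le> t powr (-1/2) * \<tau> powr (z - 1)"
      proof -
        have "1 / sqrt (t + \<tau>) \<le> 1 / sqrt t" using t True by (intro divide_left_mono) auto
        also have "\<dots> = t powr (-1/2)" using t by (simp add: powr_minus powr_half_sqrt inverse_eq_divide)
        finally have "\<tau> powr (z - 1) * (1 / sqrt (t + \<tau>)) \<le> \<tau> powr (z - 1) * t powr (-1/2)"
          by (intro mult_left_mono) auto
        then show ?thesis by (simp add: mult_ac)
      qed
      moreover have "\<tau> powr (z - 1) / sqrt (t + \<tau>) \<le> \<tau> powr (- (1/2 - z) - 1)"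
      proof -
        have "1 / sqrt (t + \<tau>) \<le> 1 / sqrt \<tau>" using t True by (intro divide_left_mono) auto
        also have "\<dots> = \<tau> powr (-1/2)" using True by (simp add: powr_minus powr_half_sqrt inverse_eq_divide)
        finally have "\<tau> powr (z - 1) * (1 / sqrt (t + \<tau>)) \<le> \<tau> powr (z - 1) * \<tau> powr (-1/2)"
          by (intro mult_left_mono) auto
        also have "\<dots> = \<tau> powr (- (1/2 - z) - 1)" by (simp add: powr_add[symmetric] algebra_simps)
        finally show ?thesis by (simp add: mult_ac)
      qed
      ultimately show ?thesis using True t
        by (cases "\<tau> < t"; cases "\<tau> = t") (auto simp: indicator_def ennreal_mult'[symmetric] intro!: ennreal_leI add_increasing2)
    qed auto
  qed
  also have "\<dots> = ennreal (t powr (-1/2)) * ennreal (t powr z / z) + ennreal (t powr (- (1/2 - z)) / (1/2 - z))"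
    using t z nn_integral_powr_from_0[of z t] nn_integral_powr_to_inf[of "1/2 - z" t] by (subst nn_integral_add) (auto simp: nn_integral_cmult)
  also have "\<dots> = ennreal (t powr (-1/2) * (t powr z / z) + t powr (- (1/2 - z)) / (1/2 - z))"
    using z t by (intro trans[OF arg_cong2[where f=plus] ennreal_plus[symmetric]] ennreal_mult'[symmetric] refl) auto
  also have "t powr (-1/2) * (t powr z / z) + t powr (- (1/2 - z)) / (1/2 - z) = (1 / z + 1 / (1/2 - z)) * t powr (z - 1/2)"
  proof -
    have "t powr (-1/2) * t powr z = t powr (z - 1/2)" by (simp add: powr_add[symmetric])
    then show ?thesis by (simp add: ring_distribs)
  qed
  finally show ?thesis .
qed

text \<open>Euler's integral after the substitution of t / b for t. For b = (2 pi |\<xi>|)^2 it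
  writes a negative power of |\<xi>| as an average of Gaussian symbols.\<close>

lemma has_bochner_integral_gamma:
  fixes z b :: real assumes "z > 0" "b > 0"
  shows "has_bochner_integral lborel (\<lambda>t. indicator {0<..} t * (t powr (z - 1) * exp (- t * b))) (Gamma z * b powr (- z))"
proof (rule has_bochner_integral_nn_integral)
  have "(\<integral>\<^sup>+t. ennreal (indicator {0<..} t * (t powr (z - 1) * exp (- t * b))) \<partial>lborel)
     = \<bar>1/b\<bar> * (\<integral>\<^sup>+t. ennreal (indicator {0<..} (0 + 1/b * t) * ((0 + 1/b * t) powr (z - 1) * exp (- (0 + 1/b * t) * b))) \<partial>lborel)"
    by (rule nn_integral_real_affine) (use assms in auto)
  also have "(\<integral>\<^sup>+t. ennreal (indicator {0<..} (0 + 1/b * t) * ((0 + 1/b * t) powr (z - 1) * exp (- (0 + 1/b * t) * b))) \<partial>lborel)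
     = (\<integral>\<^sup>+t. ennreal ((1/b) powr (z - 1)) * ennreal (indicator {0..} t * t powr (z - 1) / exp t) \<partial>lborel)"
    using assms by (intro nn_integral_cong) (auto simp: indicator_def powr_divide exp_minus field_simps zero_less_mult_iff simp flip: ennreal_mult')
  also have "\<dots> = ennreal ((1/b) powr (z - 1)) * ennreal (Gamma z)"
    by (subst nn_integral_cmult) (auto simp: Gamma_conv_nn_integral_real[OF assms(1)])
  also have "\<bar>1/b\<bar> * (ennreal ((1/b) powr (z - 1)) * ennreal (Gamma z)) = ennreal (\<bar>1/b\<bar> * (1/b) powr (z - 1) * Gamma z)"
    using assms by (simp add: mult.assoc flip: ennreal_mult')
  also have "\<bar>1/b\<bar> * (1/b) powr (z - 1) * Gamma z = Gamma z * b powr (- z)"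
    using assms by (simp add: powr_divide powr_diff powr_minus field_simps)
  finally show "(\<integral>\<^sup>+t. ennreal (indicator {0<..} t * (t powr (z - 1) * exp (- t * b))) \<partial>lborel) = ennreal (Gamma z * b powr (- z))" .
qed (use assms in auto)

text \<open>\<open>has_bochner_integral_gamma\<close> under the frequency integral, followed by
  Fubini. The averaging weight is positive, so integrability on the product space is exactly
  assumption \<open>i\<close>. The origin, where the Euler integral diverges, is excluded as a null
  set.\<close>

lemma has_bochner_integral_subordination:
  fixes G :: "real^'n::finite \<Rightarrow> complex"
  assumes z: "z > 0" and [measurable]: "G \<in> borel_measurable borel"
    and i: "integrable lborel (\<lambda>\<xi>. (2 * pi * norm \<xi>) powr (- 2 * z) *\<^sub>R G \<xi>)"
  shows "has_bochner_integral lborel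
     (\<lambda>\<tau>. indicator {0<..} \<tau> *\<^sub>R (\<tau> powr (z - 1) *\<^sub>R (LINT \<xi>|lborel. exp (- \<tau> * (2 * pi * norm \<xi>)\<^sup>2) *\<^sub>R G \<xi>)))
     (Gamma z *\<^sub>R (LINT \<xi>|lborel. (2 * pi * norm \<xi>) powr (- 2 * z) *\<^sub>R G \<xi>))"
proof -
  define f where "f \<xi> \<tau> = (indicator {0<..} \<tau> * (\<tau> powr (z - 1) * exp (- \<tau> * (2 * pi * norm \<xi>)\<^sup>2))) *\<^sub>R G \<xi>" for \<xi> \<tau>
  have g: "has_bochner_integral lborel (\<lambda>\<tau>. indicator {0<..} \<tau> * (\<tau> powr (z - 1) * exp (- \<tau> * (2 * pi * norm \<xi>)\<^sup>2)))
     (Gamma z * (2 * pi * norm \<xi>) powr (- 2 * z))" if "\<xi> \<noteq> 0" for \<xi> :: "real^'n"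
  proof -
    have "((2 * pi * norm \<xi>)\<^sup>2) powr (- z) = (2 * pi * norm \<xi>) powr (- 2 * z)"
      using that powr_powr[of "2 * pi * norm \<xi>" 2 "- z"] by simp
    then show ?thesis using has_bochner_integral_gamma[OF z, of "(2 * pi * norm \<xi>)\<^sup>2"] that by simp
  qed
  have n0: "AE \<xi> in lborel. \<xi> \<noteq> (0::real^'n)" by (rule AE_lborel_singleton)
  have fi: "has_bochner_integral lborel (f \<xi>) ((Gamma z * (2 * pi * norm \<xi>) powr (- 2 * z)) *\<^sub>R G \<xi>)" if "\<xi> \<noteq> 0" for \<xi> :: "real^'n"
    unfolding f_def using g[OF that] by (rule has_bochner_integral_scaleR_left)
  have fn: "(LINT \<tau>|lborel. norm (f \<xi> \<tau>)) = Gamma z * norm ((2 * pi * norm \<xi>) powr (- 2 * z) *\<^sub>R G \<xi>)" if "\<xi> \<noteq> 0" for \<xi> :: "real^'n"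
  proof -
    have "norm (f \<xi> \<tau>) = (indicator {0<..} \<tau> * (\<tau> powr (z - 1) * exp (- \<tau> * (2 * pi * norm \<xi>)\<^sup>2))) * norm (G \<xi>)" for \<tau>
      by (simp add: f_def indicator_def)
    then have "(LINT \<tau>|lborel. norm (f \<xi> \<tau>)) = (LINT \<tau>|lborel. (indicator {0<..} \<tau> * (\<tau> powr (z - 1) * exp (- \<tau> * (2 * pi * norm \<xi>)\<^sup>2))) * norm (G \<xi>))"
      by (simp only:)
    also have "\<dots> = (Gamma z * (2 * pi * norm \<xi>) powr (- 2 * z)) * norm (G \<xi>)"
      by (rule has_bochner_integral_integral_eq[OF has_bochner_integral_mult_left[OF g[OF that]]])
    finally show ?thesis by simp
  qed
  have F: "integrable (lborel \<Otimes>\<^sub>M lborel) (case_prod f)"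
  proof (rule lborel_pair.Fubini_integrable)
    show "case_prod f \<in> borel_measurable (lborel \<Otimes>\<^sub>M lborel)" unfolding f_def by measurable
    have "integrable lborel (\<lambda>\<xi>. LINT \<tau>|lborel. norm (f \<xi> \<tau>)) \<longleftrightarrow>
        integrable lborel (\<lambda>\<xi>. Gamma z * norm ((2 * pi * norm \<xi>) powr (- 2 * z) *\<^sub>R G \<xi>))"
    proof (rule integrable_cong_AE)
      show "(\<lambda>\<xi>. LINT \<tau>|lborel. norm (f \<xi> \<tau>)) \<in> borel_measurable lborel" unfolding f_def by measurable
      show "AE \<xi> in lborel. (LINT \<tau>|lborel. norm (f \<xi> \<tau>)) = Gamma z * norm ((2 * pi * norm \<xi>) powr (- 2 * z) *\<^sub>R G \<xi>)"
        using n0 by eventually_elim (rule fn)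
    qed measurable
    then show "integrable lborel (\<lambda>\<xi>. LINT \<tau>|lborel. norm (case_prod f (\<xi>, \<tau>)))" using integrable_norm[OF i] by simp
    show "AE \<xi> in lborel. integrable lborel (\<lambda>\<tau>. case_prod f (\<xi>, \<tau>))"
      using n0 fi by (auto simp: has_bochner_integral_iff elim!: eventually_mono)
  qed
  have s: "(LINT \<xi>|lborel. f \<xi> \<tau>) = indicator {0<..} \<tau> *\<^sub>R (\<tau> powr (z - 1) *\<^sub>R (LINT \<xi>|lborel. exp (- \<tau> * (2 * pi * norm \<xi>)\<^sup>2) *\<^sub>R G \<xi>))" for \<tau>
    unfolding f_def by (simp flip: scaleR_scaleR)
  have "(LINT \<tau>|lborel. (LINT \<xi>|lborel. f \<xi> \<tau>)) = (LINT \<xi>|lborel. (LINT \<tau>|lborel. f \<xi> \<tau>))"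
    by (rule lborel_pair.Fubini_integral[OF F])
  also have "\<dots> = (LINT \<xi>|lborel. (Gamma z * (2 * pi * norm \<xi>) powr (- 2 * z)) *\<^sub>R G \<xi>)"
  proof (rule integral_cong_AE)
    show "(\<lambda>\<xi>. LINT \<tau>|lborel. f \<xi> \<tau>) \<in> borel_measurable lborel" unfolding f_def by measurable
    show "AE \<xi> in lborel. (LINT \<tau>|lborel. f \<xi> \<tau>) = (Gamma z * (2 * pi * norm \<xi>) powr (- 2 * z)) *\<^sub>R G \<xi>"
      using n0 by eventually_elim (rule has_bochner_integral_integral_eq[OF fi])
  qed measurable
  also have "\<dots> = Gamma z *\<^sub>R (LINT \<xi>|lborel. (2 * pi * norm \<xi>) powr (- 2 * z) *\<^sub>R G \<xi>)"
    by (simp flip: scaleR_scaleR)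
  finally show ?thesis using lborel_pair.integrable_snd[OF F] by (simp add: s has_bochner_integral_iff)
qed

lemma has_bochner_integral_norm_le:
  "has_bochner_integral M f I \<Longrightarrow> ennreal (norm I) \<le> (\<integral>\<^sup>+x. norm (f x) \<partial>M)"
  using integral_norm_bound_ennreal[of M f] by (simp add: has_bochner_integral_iff)

lemma fourier_heat:
  fixes y \<xi> :: "real^'n::finite" assumes "t > 0"
  shows "has_bochner_integral lborel (\<lambda>x. of_real (heat t (x - y)) * exp (- 2 * of_real pi * \<i> * of_real (x \<bullet> \<xi>)))
     (exp (- t * (2 * pi * norm \<xi>)\<^sup>2) * exp (- 2 * of_real pi * \<i> * of_real (y \<bullet> \<xi>)))"
proof -
  have "has_bochner_integral lborel (\<lambda>x. heat t (x + - y) * exp (\<i> * of_real ((x + - y) \<bullet> ((- 2 * pi) *\<^sub>R \<xi>)))) (complex_of_real (exp (- t * (norm ((- 2 * pi) *\<^sub>R \<xi>))\<^sup>2)))"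
    by (rule has_bochner_integral_translate[OF heat_fourier[OF assms]])
  from has_bochner_integral_mult_left[OF this, of "exp (- 2 * of_real pi * \<i> * of_real (y \<bullet> \<xi>))"]
  show ?thesis
    by (simp add: mult.assoc inner_diff_left ring_distribs mult_ac flip: exp_add)
qed

text \<open>The dimension counts the components, \<open>2 * sqrt 2 ^ CARD('n)\<close> comes from
  \<open>dheat_le\<close>, and the rest from subordination with z = (1 - \<sigma>)/2: 1 / Gamma z,
  and 1/z + 1/(1/2 - z) from \<open>nn_integral_powr_div_sqrt\<close>.\<close>

definition seminorm_heat_const :: "real \<Rightarrow> 'n::finite itself \<Rightarrow> real" where
  "seminorm_heat_const \<sigma> _ = CARD('n) * (2 * sqrt 2 ^ CARD('n) * (2 / (1 - \<sigma>) + 2 / \<sigma>) / Gamma ((1 - \<sigma>) / 2))"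

context
  fixes \<sigma> t :: real and j :: "'n::finite"
  assumes \<sigma>: "0 < \<sigma>" "\<sigma> < 1" and t: "t > 0"
begin

text \<open>The factor \<xi>_j cancels the singularity at the origin: the symbol is at most (2 pi
  |\<xi>|)^\<sigma>, hence at most 1 + 2 pi |\<xi>| because 0 < \<sigma> < 1. Gaussian moments of
  order 0 and 1 therefore dominate.\<close>

lemma integrable_symbol_heat:
  fixes x :: "real^'n"
  shows "integrable lborel (\<lambda>\<xi>. (- 2 * of_real pi * \<i> * of_real (\<xi> $ j)) * of_real ((2 * pi * norm \<xi>) powr (\<sigma> - 1)) * (exp (- t * (2 * pi * norm \<xi>)\<^sup>2) * exp (2 * of_real pi * \<i> * of_real (x \<bullet> \<xi>))))"
proof (rule Bochner_Integration.integrable_bound)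
  let ?g = "\<lambda>\<xi>::real^'n. exp (- t * (2 * pi * norm \<xi>)\<^sup>2) + (\<Sum>i\<in>UNIV. 2 * pi * \<bar>\<xi> $ i\<bar> * exp (- t * (2 * pi * norm \<xi>)\<^sup>2))"
  have "integrable lborel (\<lambda>\<xi>::real^'n. exp (- t * (2 * pi * norm \<xi>)\<^sup>2))"
    using has_bochner_integral_Re[OF heat_inv_fourier[OF t, of 0]] by (auto simp: has_bochner_integral_iff)
  moreover have "integrable lborel (\<lambda>\<xi>::real^'n. 2 * pi * \<bar>\<xi> $ i\<bar> * exp (- t * (2 * pi * norm \<xi>)\<^sup>2))" for i
  proof -
    have "integrable lborel (\<lambda>\<xi>::real^'n. (- 2 * of_real pi * \<i> * of_real (\<xi> $ i)) * exp (- t * (2 * pi * norm \<xi>)\<^sup>2) * exp (2 * of_real pi * \<i> * of_real (0 \<bullet> \<xi>)))"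
      using dheat_inv_fourier[OF t, of i 0] by (simp only: has_bochner_integral_iff)
    from integrable_norm[OF this] show ?thesis by (simp add: norm_mult)
  qed
  ultimately show "integrable lborel ?g" by auto
  show "AE \<xi> in lborel. norm ((- 2 * of_real pi * \<i> * of_real (\<xi> $ j)) * of_real ((2 * pi * norm \<xi>) powr (\<sigma> - 1)) * (exp (- t * (2 * pi * norm \<xi>)\<^sup>2) * exp (2 * of_real pi * \<i> * of_real (x \<bullet> \<xi>)))) \<le> norm (?g \<xi>)"
  proof (rule AE_I2)
    fix \<xi> :: "real^'n"
    have "2 * pi * \<bar>\<xi> $ j\<bar> * (2 * pi * norm \<xi>) powr (\<sigma> - 1) \<le> 1 + (\<Sum>i\<in>UNIV. 2 * pi * \<bar>\<xi> $ i\<bar>)"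
    proof (cases "\<xi> = 0")
      case False
      define r where "r = 2 * pi * norm \<xi>"
      have r: "r > 0" using False by (simp add: r_def)
      have "2 * pi * \<bar>\<xi> $ j\<bar> * r powr (\<sigma> - 1) \<le> r * r powr (\<sigma> - 1)"
        unfolding r_def using component_le_norm_cart[of \<xi> j] by (intro mult_right_mono mult_left_mono) auto
      also have "\<dots> = r powr \<sigma>" using r by (simp add: powr_diff)
      also have "\<dots> \<le> 1 + r"
      proof (cases "r \<le> 1")
        case True then have "r powr \<sigma> \<le> 1" using r \<sigma> by (intro powr_le1) auto
        then show ?thesis using r by simp
      next
        case False then have "r powr \<sigma> \<le> r powr 1" using r \<sigma> by (intro powr_mono) auto
        then show ?thesis using r by simp
      qed
      also have "r \<le> (\<Sum>i\<in>UNIV. 2 * pi * \<bar>\<xi> $ i\<bar>)"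
        unfolding r_def sum_distrib_left[symmetric] by (intro mult_left_mono norm_le_l1_cart) auto
      finally show ?thesis by (simp add: r_def)
    qed (auto intro!: sum_nonneg add_nonneg_nonneg)
    from mult_right_mono[OF this, of "exp (- t * (2 * pi * norm \<xi>)\<^sup>2)"]
    have "2 * pi * \<bar>\<xi> $ j\<bar> * (2 * pi * norm \<xi>) powr (\<sigma> - 1) * exp (- t * (2 * pi * norm \<xi>)\<^sup>2) \<le> ?g \<xi>"
      by (simp add: ring_distribs sum_distrib_right)
    then show "norm ((- 2 * of_real pi * \<i> * of_real (\<xi> $ j)) * of_real ((2 * pi * norm \<xi>) powr (\<sigma> - 1)) * (exp (- t * (2 * pi * norm \<xi>)\<^sup>2) * exp (2 * of_real pi * \<i> * of_real (x \<bullet> \<xi>)))) \<le> norm (?g \<xi>)"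
      by (simp add: norm_mult mult_ac)
  qed
qed measurable

text \<open>The power (2 pi |\<xi>|)^(\<sigma>-1) is an average of Gaussian symbols of times \<tau>,
  and times add when the symbols are multiplied. So the fractional gradient of the kernel at time t
  is an average of ordinary gradients at the times t + \<tau>.\<close>

lemma norm_nabla_heat_le:
  fixes x y :: "real^'n"
  shows "ennreal (norm (nabla_minus \<sigma> (\<lambda>x. heat t (x - y)) j x)) \<le>
    ennreal (1 / Gamma ((1 - \<sigma>) / 2)) * (\<integral>\<^sup>+\<tau>\<in>{0<..}. ennreal (\<tau> powr ((1 - \<sigma>) / 2 - 1) * \<bar>dheat (t + \<tau>) j (x - y)\<bar>) \<partial>lborel)"
proof -
  define z where "z = (1 - \<sigma>) / 2"
  have z: "z > 0" "\<sigma> - 1 = - 2 * z" using \<sigma> by (auto simp: z_def)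
  have gz: "Gamma z > 0" using z by simp
  define G where "G \<xi> = (- 2 * of_real pi * \<i> * of_real (\<xi> $ j)) * (exp (- t * (2 * pi * norm \<xi>)\<^sup>2) * exp (2 * of_real pi * \<i> * of_real ((x - y) \<bullet> \<xi>)))" for \<xi> :: "real^'n"
  have [measurable]: "G \<in> borel_measurable borel" unfolding G_def by measurable
  have "nabla_minus \<sigma> (\<lambda>x. heat t (x - y)) j x = (LINT \<xi>|lborel. (2 * pi * norm \<xi>) powr (- 2 * z) *\<^sub>R G \<xi>)"
    unfolding nabla_minus_def inv_fourier_def fourier_def has_bochner_integral_integral_eq[OF fourier_heat[OF t]] G_def z(2)
    by (intro Bochner_Integration.integral_cong refl)
       (simp add: scaleR_conv_of_real inner_diff_left ring_distribs mult_ac exp_diff exp_minus field_simps)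
  moreover have "integrable lborel (\<lambda>\<xi>. (2 * pi * norm \<xi>) powr (- 2 * z) *\<^sub>R G \<xi>)"
    using integrable_symbol_heat[of "x - y"] unfolding G_def z(2) by (simp add: scaleR_conv_of_real mult_ac)
  ultimately have h: "has_bochner_integral lborel
     (\<lambda>\<tau>. indicator {0<..} \<tau> *\<^sub>R (\<tau> powr (z - 1) *\<^sub>R (LINT \<xi>|lborel. exp (- \<tau> * (2 * pi * norm \<xi>)\<^sup>2) *\<^sub>R G \<xi>)))
     (Gamma z *\<^sub>R nabla_minus \<sigma> (\<lambda>x. heat t (x - y)) j x)"
    using has_bochner_integral_subordination[OF z(1), of G] by simp
  have k: "(LINT \<xi>|lborel. exp (- \<tau> * (2 * pi * norm \<xi>)\<^sup>2) *\<^sub>R G \<xi>) = of_real (- dheat (t + \<tau>) j (x - y))" if "\<tau> > 0" for \<tau>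
  proof -
    have "exp (- \<tau> * (2 * pi * norm \<xi>)\<^sup>2) *\<^sub>R G \<xi> = (- 2 * of_real pi * \<i> * of_real (\<xi> $ j)) * exp (- (t + \<tau>) * (2 * pi * norm \<xi>)\<^sup>2) * exp (2 * of_real pi * \<i> * of_real ((x - y) \<bullet> \<xi>))" for \<xi>
    proof -
      have "complex_of_real (exp (- (t + \<tau>) * (2 * pi * norm \<xi>)\<^sup>2)) = of_real (exp (- \<tau> * (2 * pi * norm \<xi>)\<^sup>2)) * of_real (exp (- t * (2 * pi * norm \<xi>)\<^sup>2))"
        by (simp add: ring_distribs flip: of_real_mult exp_add)
      then show ?thesis unfolding G_def by (simp add: scaleR_conv_of_real)
    qed
    then show ?thesis using dheat_inv_fourier[of "t + \<tau>" j "x - y"] t that by (simp only: has_bochner_integral_iff)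
  qed
  have "ennreal (norm (Gamma z *\<^sub>R nabla_minus \<sigma> (\<lambda>x. heat t (x - y)) j x)) \<le>
     (\<integral>\<^sup>+\<tau>. norm (indicator {0<..} \<tau> *\<^sub>R (\<tau> powr (z - 1) *\<^sub>R (LINT \<xi>|lborel. exp (- \<tau> * (2 * pi * norm \<xi>)\<^sup>2) *\<^sub>R G \<xi>))) \<partial>lborel)"
    by (rule has_bochner_integral_norm_le[OF h])
  also have "\<dots> = (\<integral>\<^sup>+\<tau>\<in>{0<..}. ennreal (\<tau> powr (z - 1) * \<bar>dheat (t + \<tau>) j (x - y)\<bar>) \<partial>lborel)"
  proof (intro nn_integral_cong)
    fix \<tau> :: real
    show "ennreal (norm (indicator {0<..} \<tau> *\<^sub>R (\<tau> powr (z - 1) *\<^sub>R (LINT \<xi>|lborel. exp (- \<tau> * (2 * pi * norm \<xi>)\<^sup>2) *\<^sub>R G \<xi>))))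
      = ennreal (\<tau> powr (z - 1) * \<bar>dheat (t + \<tau>) j (x - y)\<bar>) * indicator {0<..} \<tau>"
      by (cases "\<tau> > 0"; use k[of \<tau>] in simp)
  qed
  finally have "ennreal (1 / Gamma z) * ennreal (Gamma z * norm (nabla_minus \<sigma> (\<lambda>x. heat t (x - y)) j x)) \<le> ennreal (1 / Gamma z) * \<dots>"
    using gz by (intro mult_left_mono) auto
  then show ?thesis using gz unfolding z_def[symmetric] by (simp flip: ennreal_mult)
qed

text \<open>After Tonelli, the gradient at time t + \<tau> has L^1 norm of order (t +
  \<tau>)^(-1/2), and \<open>nn_integral_powr_div_sqrt\<close> produces the power z - 1/2 =
  -\<sigma>/2 of t.\<close>

lemma nn_integral_nabla_heat_le:
  fixes y :: "real^'n"
  shows "(\<integral>\<^sup>+x. norm (nabla_minus \<sigma> (\<lambda>x. heat t (x - y)) j x) \<partial>lborel) \<le>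
    ennreal (2 * sqrt 2 ^ CARD('n) * (2 / (1 - \<sigma>) + 2 / \<sigma>) / Gamma ((1 - \<sigma>) / 2) * t powr (- \<sigma> / 2))"
proof -
  define z where "z = (1 - \<sigma>) / 2"
  have z: "z > 0" "z < 1/2" "\<sigma> = 1 - 2 * z" using \<sigma> by (auto simp: z_def field_simps)
  have gz: "Gamma z > 0" using z by simp
  let ?C = "2 * sqrt 2 ^ CARD('n) :: real"
  have d: "(\<integral>\<^sup>+x. ennreal \<bar>dheat r j (x - y)\<bar> \<partial>lborel) \<le> ennreal (?C / sqrt r)" if "r > 0" for r
  proof -
    have "(\<integral>\<^sup>+x. ennreal \<bar>dheat r j (x - y)\<bar> \<partial>lborel) \<le> (\<integral>\<^sup>+x. ennreal (?C / sqrt r) * ennreal (heat (2 * r) (x - y)) \<partial>lborel)"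
      using dheat_le[OF that, of j] that by (intro nn_integral_mono) (auto simp flip: ennreal_mult')
    also have "\<dots> = ennreal (?C / sqrt r)" using that nn_integral_heat(2)[of "2 * r" y] by (subst nn_integral_cmult) auto
    finally show ?thesis .
  qed
  have "(\<integral>\<^sup>+x. norm (nabla_minus \<sigma> (\<lambda>x. heat t (x - y)) j x) \<partial>lborel) \<le>
    (\<integral>\<^sup>+x. ennreal (1 / Gamma z) * (\<integral>\<^sup>+\<tau>\<in>{0<..}. ennreal (\<tau> powr (z - 1) * \<bar>dheat (t + \<tau>) j (x - y)\<bar>) \<partial>lborel) \<partial>lborel)"
    by (intro nn_integral_mono norm_nabla_heat_le[folded z_def])
  also have "\<dots> = ennreal (1 / Gamma z) * (\<integral>\<^sup>+x. (\<integral>\<^sup>+\<tau>\<in>{0<..}. ennreal (\<tau> powr (z - 1) * \<bar>dheat (t + \<tau>) j (x - y)\<bar>) \<partial>lborel) \<partial>lborel)"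
    by (subst nn_integral_cmult) auto
  also have "(\<integral>\<^sup>+x. (\<integral>\<^sup>+\<tau>\<in>{0<..}. ennreal (\<tau> powr (z - 1) * \<bar>dheat (t + \<tau>) j (x - y)\<bar>) \<partial>lborel) \<partial>lborel)
     = (\<integral>\<^sup>+\<tau>. (\<integral>\<^sup>+x. ennreal (\<tau> powr (z - 1) * \<bar>dheat (t + \<tau>) j (x - y)\<bar>) * indicator {0<..} \<tau> \<partial>lborel) \<partial>lborel)"
    by (subst lborel_pair.Fubini') auto
  also have "\<dots> = (\<integral>\<^sup>+\<tau>\<in>{0<..}. ennreal (\<tau> powr (z - 1)) * (\<integral>\<^sup>+x. ennreal \<bar>dheat (t + \<tau>) j (x - y)\<bar> \<partial>lborel) \<partial>lborel)"
    by (intro nn_integral_cong) (auto simp: ennreal_mult' nn_integral_cmult indicator_def)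
  also have "\<dots> \<le> (\<integral>\<^sup>+\<tau>. ennreal ?C * (ennreal (\<tau> powr (z - 1) / sqrt (t + \<tau>)) * indicator {0<..} \<tau>) \<partial>lborel)"
  proof (intro nn_integral_mono)
    fix \<tau> :: real
    show "ennreal (\<tau> powr (z - 1)) * (\<integral>\<^sup>+x. ennreal \<bar>dheat (t + \<tau>) j (x - y)\<bar> \<partial>lborel) * indicator {0<..} \<tau>
      \<le> ennreal ?C * (ennreal (\<tau> powr (z - 1) / sqrt (t + \<tau>)) * indicator {0<..} \<tau>)"
    proof (cases "\<tau> > 0")
      case True
      have "ennreal (\<tau> powr (z - 1)) * (\<integral>\<^sup>+x. ennreal \<bar>dheat (t + \<tau>) j (x - y)\<bar> \<partial>lborel) \<le> ennreal (\<tau> powr (z - 1)) * ennreal (?C / sqrt (t + \<tau>))"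
        using t True by (intro mult_left_mono d) auto
      also have "\<dots> = ennreal ?C * ennreal (\<tau> powr (z - 1) / sqrt (t + \<tau>))"
        using t True by (subst (1 2) ennreal_mult'[symmetric]) (auto simp: mult_ac)
      finally show ?thesis using True by simp
    qed simp
  qed
  also have "\<dots> = ennreal ?C * (\<integral>\<^sup>+\<tau>\<in>{0<..}. ennreal (\<tau> powr (z - 1) / sqrt (t + \<tau>)) \<partial>lborel)"
    by (rule nn_integral_cmult) measurable
  also have "\<dots> \<le> ennreal ?C * ennreal ((1 / z + 1 / (1/2 - z)) * t powr (z - 1/2))"
    by (intro mult_left_mono nn_integral_powr_div_sqrt z t) simp
  also have "\<dots> = ennreal (?C * (1 / z + 1 / (1/2 - z)) * t powr (z - 1/2))"
    by (subst ennreal_mult'[symmetric]) (auto simp: mult.assoc)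
  finally have "(\<integral>\<^sup>+x. norm (nabla_minus \<sigma> (\<lambda>x. heat t (x - y)) j x) \<partial>lborel) \<le> ennreal (1 / Gamma z) * ennreal (?C * (1 / z + 1 / (1/2 - z)) * t powr (z - 1/2))"
    by (meson mult_left_mono order_trans zero_le)
  also have "\<dots> = ennreal (?C * (1 / z + 1 / (1/2 - z)) / Gamma z * t powr (z - 1/2))"
    using gz z by (simp flip: ennreal_mult')
  also have "1 / z + 1 / (1/2 - z) = 2 / (1 - \<sigma>) + 2 / \<sigma>" using \<sigma> by (auto simp: z_def field_simps)
  also have "z - 1/2 = - \<sigma> / 2" using \<sigma> by (auto simp: z_def field_simps)
  finally show ?thesis by (simp add: z_def)
qed

end

section \<open>Capacity of superpositions of heat kernels\<close>

lemma power_times_exp_bounded: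
  fixes c r :: real assumes "c > 0" "r \<ge> 0"
  shows "r ^ k * exp (- c * r\<^sup>2) \<le> 1 + fact k / c ^ k"
proof -
  have "(c * r\<^sup>2) ^ k / fact k \<le> exp (c * r\<^sup>2)"
  proof -
    have "(\<Sum>n\<in>{k}. (c * r\<^sup>2) ^ n /\<^sub>R fact n) \<le> exp (c * r\<^sup>2)"
      unfolding exp_def by (rule sum_le_suminf[OF summable_exp_generic]) (use assms in auto)
    then show ?thesis by (simp add: divide_inverse_commute)
  qed
  moreover have "(c * r\<^sup>2) ^ k = c ^ k * r ^ (2 * k)" by (simp add: power_mult_distrib flip: power_mult)
  ultimately have 1: "r ^ (2 * k) * exp (- c * r\<^sup>2) \<le> fact k / c ^ k"
    using assms by (simp only: exp_minus mult_minus_left) (simp add: field_simps)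
  \<comment> \<open>A single term of the exponential series bounds even powers; the odd ones are
    reduced to them.\<close>
  have "r ^ k \<le> 1 + r ^ (2 * k)"
  proof (cases "r \<le> 1")
    case True then show ?thesis using assms power_le_one[of r k] by (simp add: add_increasing2)
  next
    case False then have "r ^ k \<le> r ^ (2 * k)" by (intro power_increasing) auto
    then show ?thesis by linarith
  qed
  then have "r ^ k * exp (- c * r\<^sup>2) \<le> (1 + r ^ (2 * k)) * exp (- c * r\<^sup>2)" by (intro mult_right_mono) auto
  also have "\<dots> \<le> 1 + fact k / c ^ k" using 1 assms by (auto simp: ring_distribs intro!: add_mono)
  finally show ?thesis .
qed

text \<open>The span of polynomial multiples of translated Gaussians. It is closed under partial
  derivatives, so decay of its members themselves already yields every condition in
  \<open>schwartz_class\<close>.\<close>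

inductive gauss_poly :: "(real^'n::finite \<Rightarrow> real) \<Rightarrow> bool" where
  heat: "t > 0 \<Longrightarrow> gauss_poly (\<lambda>x. heat t (x - y))"
| times_coord: "gauss_poly f \<Longrightarrow> gauss_poly (\<lambda>x. x $ i * f x)"
| lincomb: "gauss_poly f \<Longrightarrow> gauss_poly g \<Longrightarrow> gauss_poly (\<lambda>x. a * f x + b * g x)"

lemma heat_has_derivative:
  assumes "t > 0"
  shows "((\<lambda>x. heat t (x - y)) has_derivative (\<lambda>h. - ((x - y) \<bullet> h) / (2 * t) * heat t (x - y))) (at x)"
proof -
  let ?q = "\<lambda>x. - ((x - y) \<bullet> (x - y)) / (4 * t)"
  have "(?q has_derivative (\<lambda>h. - (2 * ((x - y) \<bullet> h)) / (4 * t))) (at x)"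
    using assms by (auto intro!: derivative_eq_intros simp: inner_commute field_simps)
  then have "((\<lambda>x. exp (?q x)) has_derivative (\<lambda>h. - (2 * ((x - y) \<bullet> h)) / (4 * t) * exp (?q x))) (at x)"
    by (rule has_derivative_eq_rhs[OF has_derivative_exp]) (simp add: fun_eq_iff mult.commute)
  from has_derivative_mult_right[OF this, of "1 / sqrt (4 * pi * t) ^ CARD('a)"]
  show ?thesis unfolding heat_def power2_norm_eq_inner by (simp add: fun_eq_iff mult_ac)
qed

lemma partial_deriv_eq: "(f has_derivative f') (at x) \<Longrightarrow> partial_deriv j f x = f' (axis j 1)"
  unfolding partial_deriv_def by (simp add: frechet_derivative_at[symmetric])

lemma gauss_poly_partial:
  "gauss_poly f \<Longrightarrow> f differentiable_on UNIV \<and> (\<forall>j. gauss_poly (partial_deriv j f))"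
proof (induction rule: gauss_poly.induct)
  case (heat t y)
  have "partial_deriv j (\<lambda>x. heat t (x - y)) = (\<lambda>x. (- 1 / (2 * t)) * (x $ j * heat t (x - y)) + y $ j / (2 * t) * heat t (x - y))" for j
    by (rule ext, subst partial_deriv_eq[OF heat_has_derivative[OF heat]]) (use heat in \<open>simp add: inner_axis field_simps\<close>)
  then have "gauss_poly (partial_deriv j (\<lambda>x. heat t (x - y)))" for j
    by (simp only:) (intro gauss_poly.intros heat)
  then show ?case using heat_has_derivative[OF heat]
    by (auto simp: differentiable_on_def differentiable_def intro: has_derivative_at_withinI)
next
  case (times_coord f i)
  have D: "(f has_derivative frechet_derivative f (at x)) (at x)" for x
    using times_coord by (simp add: differentiable_on_def frechet_derivative_works[symmetric])
  have E: "((\<lambda>x. x $ i * f x) has_derivative (\<lambda>h. x $ i * frechet_derivative f (at x) h + h $ i * f x)) (at x)" for x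
    by (intro has_derivative_mult D bounded_linear_imp_has_derivative bounded_linear_vec_nth)
  have "partial_deriv j (\<lambda>x. x $ i * f x) = (\<lambda>x. 1 * (x $ i * partial_deriv j f x) + (if i = j then 1 else 0) * f x)" for j
    using partial_deriv_eq[OF E] by (auto simp: fun_eq_iff partial_deriv_def axis_def)
  then have "gauss_poly (partial_deriv j (\<lambda>x. x $ i * f x))" for j
    using times_coord by (simp only:) (intro gauss_poly.lincomb gauss_poly.times_coord; blast)
  then show ?case using E
    by (auto simp: differentiable_on_def differentiable_def intro: has_derivative_at_withinI)
next
  case (lincomb f g a b)
  have D: "(f has_derivative frechet_derivative f (at x)) (at x)" "(g has_derivative frechet_derivative g (at x)) (at x)" for x
    using lincomb by (simp_all add: differentiable_on_def frechet_derivative_works[symmetric])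
  have E: "((\<lambda>x. a * f x + b * g x) has_derivative (\<lambda>h. a * frechet_derivative f (at x) h + b * frechet_derivative g (at x) h)) (at x)" for x
    by (intro has_derivative_add has_derivative_mult_right D)
  have "partial_deriv j (\<lambda>x. a * f x + b * g x) = (\<lambda>x. a * partial_deriv j f x + b * partial_deriv j g x)" for j
    using partial_deriv_eq[OF E] by (auto simp: fun_eq_iff partial_deriv_def)
  then show ?case using lincomb E
    by (auto simp: differentiable_on_def differentiable_def intro!: gauss_poly.lincomb intro: has_derivative_at_withinI)
qed

lemma gauss_poly_bounded:
  fixes f :: "real^'n::finite \<Rightarrow> real"
  shows "gauss_poly f \<Longrightarrow> \<exists>B. \<forall>x. \<bar>norm x ^ k * f x\<bar> \<le> B"
\<comment> \<open>The power k is generalised because a coordinate factor is paid for with one more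
  power of the norm.\<close>
proof (induction arbitrary: k rule: gauss_poly.induct)
  case (heat t y)
  let ?c = "1 / (8 * t)"
  have "\<bar>norm x ^ k * heat t (x - y)\<bar> \<le> exp ((norm y)\<^sup>2 / (4 * t)) * (1 + fact k / ?c ^ k) / sqrt (4 * pi * t) ^ CARD('n)" for x :: "real^'n"
  proof -
    have "(norm x)\<^sup>2 \<le> (norm (x - y) + norm y)\<^sup>2"
      using norm_triangle_sub[of x y] by (intro power_mono) (auto simp: algebra_simps)
    also have "\<dots> \<le> 2 * (norm (x - y))\<^sup>2 + 2 * (norm y)\<^sup>2"
      using sum_squares_bound[of "norm (x - y)" "norm y"] by (simp add: power2_sum)
    finally have "- (norm (x - y))\<^sup>2 / (4 * t) \<le> (norm y)\<^sup>2 / (4 * t) + (- ?c * (norm x)\<^sup>2)"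
      using heat by (simp add: field_simps)
    then have "exp (- (norm (x - y))\<^sup>2 / (4 * t)) \<le> exp ((norm y)\<^sup>2 / (4 * t)) * exp (- ?c * (norm x)\<^sup>2)"
      unfolding exp_add[symmetric] by (simp only: exp_le_cancel_iff)
    then have "norm x ^ k * exp (- (norm (x - y))\<^sup>2 / (4 * t)) \<le> norm x ^ k * (exp ((norm y)\<^sup>2 / (4 * t)) * exp (- ?c * (norm x)\<^sup>2))"
      by (intro mult_left_mono) auto
    also have "\<dots> = exp ((norm y)\<^sup>2 / (4 * t)) * (norm x ^ k * exp (- ?c * (norm x)\<^sup>2))" by simp
    also have "\<dots> \<le> exp ((norm y)\<^sup>2 / (4 * t)) * (1 + fact k / ?c ^ k)"
      using heat by (intro mult_left_mono power_times_exp_bounded) auto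
    finally have "norm x ^ k * exp (- (norm (x - y))\<^sup>2 / (4 * t)) / sqrt (4 * pi * t) ^ CARD('n) \<le> exp ((norm y)\<^sup>2 / (4 * t)) * (1 + fact k / ?c ^ k) / sqrt (4 * pi * t) ^ CARD('n)"
      using heat by (intro divide_right_mono) auto
    then show ?thesis using heat by (simp add: heat_def)
  qed
  then show ?case by blast
next
  case (times_coord f i)
  obtain B where B: "\<And>x. \<bar>norm x ^ Suc k * f x\<bar> \<le> B" using times_coord.IH by blast
  have "\<bar>norm x ^ k * (x $ i * f x)\<bar> \<le> B" for x
  proof -
    have "\<bar>norm x ^ k * (x $ i * f x)\<bar> = norm x ^ k * \<bar>f x\<bar> * \<bar>x $ i\<bar>" by (simp add: abs_mult)
    also have "\<dots> \<le> norm x ^ k * \<bar>f x\<bar> * norm x" by (intro mult_left_mono component_le_norm_cart) auto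
    also have "\<dots> = \<bar>norm x ^ Suc k * f x\<bar>" by (simp add: abs_mult)
    finally show ?thesis using B[of x] by linarith
  qed
  then show ?case by blast
next
  case (lincomb f g a b)
  obtain B C where B: "\<And>x. \<bar>norm x ^ k * f x\<bar> \<le> B" "\<And>x. \<bar>norm x ^ k * g x\<bar> \<le> C" using lincomb.IH by metis
  have "\<bar>norm x ^ k * (a * f x + b * g x)\<bar> \<le> \<bar>a\<bar> * B + \<bar>b\<bar> * C" for x
  proof -
    have "norm x ^ k * (a * f x + b * g x) = a * (norm x ^ k * f x) + b * (norm x ^ k * g x)" by (simp add: algebra_simps)
    moreover have "\<bar>a * (norm x ^ k * f x)\<bar> \<le> \<bar>a\<bar> * B" "\<bar>b * (norm x ^ k * g x)\<bar> \<le> \<bar>b\<bar> * C"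
      using B[of x] by (auto simp: abs_mult[of a] abs_mult[of b] intro!: mult_left_mono)
    ultimately show ?thesis by linarith
  qed
  then show ?case by blast
qed

lemma gauss_poly_schwartz: assumes "gauss_poly f" shows "f \<in> schwartz_class"
proof -
  have "gauss_poly (iter_partial_deriv js f)" for js
    unfolding iter_partial_deriv_def by (induction js) (use assms gauss_poly_partial in auto)
  then show ?thesis unfolding schwartz_class_def
    using gauss_poly_partial gauss_poly_bounded by (fastforce simp: bounded_iff)
qed

lemma gauss_poly_sum_heat:
  fixes N :: nat
  assumes "\<And>i. i < N \<Longrightarrow> t i > 0"
  shows "gauss_poly (\<lambda>x. \<Sum>i<N. m i * heat (t i) (x - y i :: real^'n::finite))"
  using assms
proof (induction N)
  case 0
  \<comment> \<open>The zero function is no constructor case; it is obtained as a combination with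
    vanishing coefficients.\<close>
  have "gauss_poly (\<lambda>x. 0 * heat 1 (x - 0 :: real^'n) + 0 * heat 1 (x - 0))" by (intro gauss_poly.intros) auto
  then show ?case by simp
next
  case (Suc N)
  then have "gauss_poly (\<lambda>x. 1 * (\<Sum>i<N. m i * heat (t i) (x - y i)) + m N * heat (t N) (x - y N))"
    by (intro gauss_poly.intros) auto
  then show ?case by simp
qed

section \<open>Test functions that are finite or countable sums of heat kernels\<close>

lemma fourier_measurable [measurable]:
  assumes [measurable]: "u \<in> borel_measurable borel"
  shows "fourier u \<in> borel_measurable borel" "inv_fourier u \<in> borel_measurable borel"
  unfolding fourier_def inv_fourier_def by measurable

lemma nabla_minus_measurable [measurable]:
  assumes [measurable]: "u \<in> borel_measurable borel"
  shows "nabla_minus \<sigma> u j \<in> borel_measurable borel"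
  unfolding nabla_minus_def by measurable

text \<open>Linearity has to be checked at both integrals in \<open>nabla_minus\<close>, each of
  which must converge summand by summand; the explicit transforms and
  \<open>integrable_symbol_heat\<close> provide this.\<close>

lemma nabla_minus_sum_heat:
  fixes y :: "nat \<Rightarrow> real^'n::finite"
  assumes \<sigma>: "0 < \<sigma>" "\<sigma> < 1" and t: "\<And>i. i < N \<Longrightarrow> t i > 0"
  shows "nabla_minus \<sigma> (\<lambda>x. \<Sum>i<N. m i * heat (t i) (x - y i)) j x = (\<Sum>i<N. m i * nabla_minus \<sigma> (\<lambda>x. heat (t i) (x - y i)) j x)"
proof -
  let ?f = "\<lambda>i \<xi>. exp (- t i * (2 * pi * norm \<xi>)\<^sup>2) * exp (- 2 * of_real pi * \<i> * of_real (y i \<bullet> \<xi>))"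
  have F: "fourier (\<lambda>x. of_real (\<Sum>i<N. m i * heat (t i) (x - y i))) \<xi> = (\<Sum>i<N. of_real (m i) * ?f i \<xi>)" for \<xi>
  proof -
    have "has_bochner_integral lborel (\<lambda>x. \<Sum>i<N. of_real (m i) * (of_real (heat (t i) (x - y i)) * exp (- 2 * of_real pi * \<i> * of_real (x \<bullet> \<xi>)))) (\<Sum>i<N. of_real (m i) * ?f i \<xi>)"
      by (intro has_bochner_integral_sum has_bochner_integral_mult_right fourier_heat t) auto
    then show ?thesis unfolding fourier_def
      by (simp add: has_bochner_integral_iff sum_distrib_right mult.assoc)
  qed
  have F1: "fourier (\<lambda>x. of_real (heat (t i) (x - y i))) \<xi> = ?f i \<xi>" if "i < N" for i \<xi>
    unfolding fourier_def by (rule has_bochner_integral_integral_eq[OF fourier_heat[OF t[OF that]]])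
  let ?s = "\<lambda>\<xi>. (- 2 * of_real pi * \<i> * of_real (\<xi> $ j)) * of_real ((2 * pi * norm \<xi>) powr (\<sigma> - 1)) :: complex"
  let ?e = "\<lambda>\<xi>. exp (2 * of_real pi * \<i> * of_real (x \<bullet> \<xi>)) :: complex"
  have I: "integrable lborel (\<lambda>\<xi>. ?s \<xi> * ?f i \<xi> * ?e \<xi>)" if "i < N" for i
    using integrable_symbol_heat[OF \<sigma> t[OF that], of j "x - y i"]
    by (rule iffD1[OF Bochner_Integration.integrable_cong, rotated -1])
       (simp_all add: mult.assoc inner_diff_left ring_distribs exp_diff exp_minus field_simps)
  have "nabla_minus \<sigma> (\<lambda>x. \<Sum>i<N. m i * heat (t i) (x - y i)) j x = (LINT \<xi>|lborel. (\<Sum>i<N. of_real (m i) * (?s \<xi> * ?f i \<xi> * ?e \<xi>)))"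
    unfolding nabla_minus_def inv_fourier_def F by (intro Bochner_Integration.integral_cong refl) (simp add: sum_distrib_left sum_distrib_right mult_ac)
  also have "\<dots> = (\<Sum>i<N. of_real (m i) * (LINT \<xi>|lborel. ?s \<xi> * ?f i \<xi> * ?e \<xi>))"
    by (subst Bochner_Integration.integral_sum) (use I in auto)
  also have "\<dots> = (\<Sum>i<N. m i * nabla_minus \<sigma> (\<lambda>x. heat (t i) (x - y i)) j x)"
    unfolding nabla_minus_def inv_fourier_def by (intro sum.cong refl) (simp add: F1)
  finally show ?thesis .
qed

lemma seminorm_sum_heat_le:
  fixes y :: "nat \<Rightarrow> real^'n::finite"
  assumes \<sigma>: "0 < \<sigma>" "\<sigma> < 1" and t: "\<And>i. i < N \<Longrightarrow> t i > 0" and m: "\<And>i. i < N \<Longrightarrow> m i \<ge> 0"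
  shows "seminorm_minus \<sigma> (\<lambda>x. \<Sum>i<N. m i * heat (t i) (x - y i)) \<le>
    ennreal (seminorm_heat_const \<sigma> TYPE('n)) * (\<Sum>i<N. ennreal (m i) * ennreal (t i powr (- \<sigma> / 2)))"
proof -
  let ?c = "2 * sqrt 2 ^ CARD('n) * (2 / (1 - \<sigma>) + 2 / \<sigma>) / Gamma ((1 - \<sigma>) / 2)"
  have c: "?c \<ge> 0" using \<sigma> by auto
  have 1: "(\<integral>\<^sup>+x. norm (nabla_minus \<sigma> (\<lambda>x. \<Sum>i<N. m i * heat (t i) (x - y i)) j x) \<partial>lborel)
     \<le> ennreal ?c * (\<Sum>i<N. ennreal (m i) * ennreal (t i powr (- \<sigma> / 2)))" (is "?L \<le> _") for j
  proof -
    have "?L \<le> (\<integral>\<^sup>+x. (\<Sum>i<N. ennreal (m i) * ennreal (norm (nabla_minus \<sigma> (\<lambda>x. heat (t i) (x - y i)) j x))) \<partial>lborel)"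
    proof (intro nn_integral_mono)
      fix x
      have "norm (nabla_minus \<sigma> (\<lambda>x. \<Sum>i<N. m i * heat (t i) (x - y i)) j x) \<le> (\<Sum>i<N. m i * norm (nabla_minus \<sigma> (\<lambda>x. heat (t i) (x - y i)) j x))"
        by (subst nabla_minus_sum_heat[OF \<sigma> t], assumption, rule sum_norm_le) (use m in \<open>auto simp: norm_mult\<close>)
      then have "ennreal (norm (nabla_minus \<sigma> (\<lambda>x. \<Sum>i<N. m i * heat (t i) (x - y i)) j x)) \<le> ennreal (\<Sum>i<N. m i * norm (nabla_minus \<sigma> (\<lambda>x. heat (t i) (x - y i)) j x))"
        by (rule ennreal_leI)
      also have "\<dots> = (\<Sum>i<N. ennreal (m i) * ennreal (norm (nabla_minus \<sigma> (\<lambda>x. heat (t i) (x - y i)) j x)))"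
        using m by (subst sum_ennreal[symmetric]) (auto simp: ennreal_mult')
      finally show "ennreal (norm (nabla_minus \<sigma> (\<lambda>x. \<Sum>i<N. m i * heat (t i) (x - y i)) j x)) \<le> \<dots>" .
    qed
    also have "\<dots> = (\<Sum>i<N. ennreal (m i) * (\<integral>\<^sup>+x. norm (nabla_minus \<sigma> (\<lambda>x. heat (t i) (x - y i)) j x) \<partial>lborel))"
      by (subst nn_integral_sum) (auto intro!: sum.cong nn_integral_cmult)
    also have "\<dots> \<le> (\<Sum>i<N. ennreal (m i) * ennreal (?c * t i powr (- \<sigma> / 2)))"
      using t by (intro sum_mono mult_left_mono nn_integral_nabla_heat_le[OF \<sigma>]) auto
    also have "\<dots> = ennreal ?c * (\<Sum>i<N. ennreal (m i) * ennreal (t i powr (- \<sigma> / 2)))"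
      unfolding ennreal_mult'[OF c] by (simp only: sum_distrib_left mult.left_commute)
    finally show ?thesis .
  qed
  have "seminorm_minus \<sigma> (\<lambda>x. \<Sum>i<N. m i * heat (t i) (x - y i)) \<le> (\<Sum>j\<in>(UNIV::'n set). ennreal ?c * (\<Sum>i<N. ennreal (m i) * ennreal (t i powr (- \<sigma> / 2))))"
    unfolding seminorm_minus_def by (intro sum_mono 1)
  also have "\<dots> = ennreal (real CARD('n) * ?c) * (\<Sum>i<N. ennreal (m i) * ennreal (t i powr (- \<sigma> / 2)))"
    unfolding ennreal_mult'[OF of_nat_0_le_iff] by (simp add: ennreal_of_nat_eq_real_of_nat mult.assoc)
  finally show ?thesis by (simp only: seminorm_heat_const_def)
qed

text \<open>A compactness argument as in Dini's theorem. The sets where a partial sum exceeds 1 are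
  open, increase with the number of terms and cover K, so one finite sum, which is a Schwartz
  function, is admissible. The strict inequality makes these sets open and a finite sum
  sufficient.\<close>

lemma cap_compact_le_series:
  fixes y :: "nat \<Rightarrow> real^'n::finite" and m :: "nat \<Rightarrow> ennreal"
  assumes \<sigma>: "0 < \<sigma>" "\<sigma> < 1" and t: "\<And>i. t i > 0" and K: "compact K"
    and V: "\<And>x. x \<in> K \<Longrightarrow> 1 < (\<Sum>i. m i * ennreal (heat (t i) (x - y i)))"
  shows "cap_compact \<sigma> K \<le> ennreal (seminorm_heat_const \<sigma> TYPE('n)) * (\<Sum>i. m i * ennreal (t i powr (- \<sigma> / 2)))"
\<comment> \<open>An infinite coefficient makes the right-hand side infinite, since the constant and
  all powers of the times are positive.\<close>
proof (cases "\<exists>i. m i = \<top>")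
  case True
  then obtain i where i: "m i = \<top>" by blast
  have "(\<Sum>i. m i * ennreal (t i powr (- \<sigma> / 2))) \<ge> m i * ennreal (t i powr (- \<sigma> / 2))"
    using sum_le_suminf[of "\<lambda>i. m i * ennreal (t i powr (- \<sigma> / 2))" "{i}"] by simp
  moreover have "m i * ennreal (t i powr (- \<sigma> / 2)) = \<top>" using i t[of i] by (simp add: ennreal_top_mult ennreal_eq_0_iff)
  ultimately have "(\<Sum>i. m i * ennreal (t i powr (- \<sigma> / 2))) = \<top>" by (simp add: top.extremum_unique)
  moreover have "seminorm_heat_const \<sigma> TYPE('n) > 0"
    using \<sigma> by (auto simp: seminorm_heat_const_def intro!: mult_pos_pos divide_pos_pos add_pos_pos)
  ultimately show ?thesis by (simp add: ennreal_mult_top)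
next
  case False
  define r where "r i = enn2real (m i)" for i
  have r: "m i = ennreal (r i)" "r i \<ge> 0" for i using False by (auto simp: r_def less_top)
  define f where "f N x = (\<Sum>i<N. r i * heat (t i) (x - y i))" for N x
  have mono: "f M x \<le> f N x" if "M \<le> N" for M N x
    unfolding f_def using that t r(2) by (intro sum_mono2) (auto simp: less_imp_le)
  have "K \<subseteq> (\<Union>N. {x. f N x > 1})"
  proof
    fix x assume "x \<in> K"
    then have "1 < (SUP N. (\<Sum>i<N. m i * ennreal (heat (t i) (x - y i))))" using V by (simp add: suminf_eq_SUP)
    then obtain N where "1 < (\<Sum>i<N. m i * ennreal (heat (t i) (x - y i)))" by (auto simp: less_SUP_iff)
    also have "(\<Sum>i<N. m i * ennreal (heat (t i) (x - y i))) = (\<Sum>i<N. ennreal (r i * heat (t i) (x - y i)))"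
      by (intro sum.cong refl) (simp only: r(1) ennreal_mult'[OF r(2)])
    also have "\<dots> = ennreal (f N x)" unfolding f_def by (intro sum_ennreal mult_nonneg_nonneg r(2) heat_nonneg t)
    finally show "x \<in> (\<Union>N. {x. f N x > 1})" by auto
  qed
  moreover have "open {x. f N x > 1}" for N
  proof -
    have "t i \<noteq> 0" for i using t[of i] by simp
    then have "continuous_on UNIV (f N)" unfolding f_def heat_def by (intro continuous_intros) auto
    then show ?thesis by (intro open_Collect_less) auto
  qed
  ultimately obtain C where C: "finite C" "K \<subseteq> (\<Union>N\<in>C. {x. f N x > 1})"
    using compactE_image[OF K, of UNIV "\<lambda>N. {x. f N x > 1}"] by (metis UNIV_I)
  \<comment> \<open>The inserted 0 keeps \<open>Max\<close> meaningful for an empty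
    subcover.\<close>
  define N where "N = Max (insert 0 C)"
  have N: "1 \<le> f N x" if x: "x \<in> K" for x
  proof -
    obtain M where "M \<in> C" "f M x > 1" using C(2) x by blast
    moreover have "M \<le> N" using \<open>M \<in> C\<close> C(1) by (auto simp: N_def)
    ultimately show ?thesis using mono[of M N x] by linarith
  qed
  have "f N \<in> schwartz_class" unfolding f_def by (intro gauss_poly_schwartz gauss_poly_sum_heat t)
  then have "cap_compact \<sigma> K \<le> seminorm_minus \<sigma> (f N)" unfolding cap_compact_def using N by (intro INF_lower) auto
  also have "\<dots> \<le> ennreal (seminorm_heat_const \<sigma> TYPE('n)) * (\<Sum>i<N. ennreal (r i) * ennreal (t i powr (- \<sigma> / 2)))"
    unfolding f_def by (rule seminorm_sum_heat_le[OF \<sigma> t r(2)])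
  also have "\<dots> \<le> ennreal (seminorm_heat_const \<sigma> TYPE('n)) * (\<Sum>i. m i * ennreal (t i powr (- \<sigma> / 2)))"
    unfolding r(1)[symmetric] by (intro mult_left_mono sum_le_suminf) auto
  finally show ?thesis .
qed

text \<open>Doubling the time halves the exponent, which makes room for moving the centre by less
  than sqrt t; the remaining error is exp(1/8). The factor 2^n compares the normalisations at times
  2t and 4t', using t' < 2t.\<close>

lemma heat_harnack:
  fixes x y y' :: "real^'n::finite"
  assumes t: "0 < t" "t < t'" "t' < 2 * t" and y: "(dist y y')\<^sup>2 < t"
  shows "heat (2 * t) (x - y) \<le> 2 ^ CARD('n) * exp (1/8) * heat (4 * t') (x - y')"
proof -
  have "(norm (x - y'))\<^sup>2 \<le> (norm (x - y) + dist y y')\<^sup>2"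
    using norm_triangle_ineq[of "x - y" "y - y'"] by (intro power_mono) (auto simp: dist_norm)
  also have "\<dots> \<le> 2 * (norm (x - y))\<^sup>2 + 2 * (dist y y')\<^sup>2"
    using sum_squares_bound[of "norm (x - y)" "dist y y'"] by (simp add: power2_sum)
  also have "\<dots> \<le> 2 * (norm (x - y))\<^sup>2 + 2 * t" using y by simp
  finally have "(norm (x - y'))\<^sup>2 / (16 * t') \<le> (2 * (norm (x - y))\<^sup>2 + 2 * t) / (16 * t)"
    using t by (intro frac_le) auto
  also have "\<dots> = (norm (x - y))\<^sup>2 / (8 * t) + 1/8" using t by (simp add: field_simps)
  finally have e: "exp (- ((norm (x - y))\<^sup>2 / (8 * t))) \<le> exp (1/8) * exp (- ((norm (x - y'))\<^sup>2 / (16 * t')))"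
    by (simp flip: exp_add)
  have "sqrt (16 * pi * t') \<le> sqrt (2\<^sup>2 * (8 * pi * t))" using t by (intro real_sqrt_le_mono) simp
  also have "\<dots> = 2 * sqrt (8 * pi * t)" unfolding real_sqrt_mult by simp
  finally have "sqrt (16 * pi * t') ^ CARD('n) \<le> 2 ^ CARD('n) * sqrt (8 * pi * t) ^ CARD('n)"
    using t unfolding power_mult_distrib[symmetric] by (intro power_mono) auto
  then have p: "1 / sqrt (8 * pi * t) ^ CARD('n) \<le> 2 ^ CARD('n) / sqrt (16 * pi * t') ^ CARD('n)"
    using t by (simp add: field_simps)
  have "heat (2 * t) (x - y) = exp (- ((norm (x - y))\<^sup>2 / (8 * t))) * (1 / sqrt (8 * pi * t) ^ CARD('n))"
    by (simp add: heat_def mult.assoc)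
  also have "\<dots> \<le> (exp (1/8) * exp (- ((norm (x - y'))\<^sup>2 / (16 * t')))) * (2 ^ CARD('n) / sqrt (16 * pi * t') ^ CARD('n))"
    using e p t by (intro mult_mono) auto
  also have "\<dots> = 2 ^ CARD('n) * exp (1/8) * heat (4 * t') (x - y')" by (simp add: heat_def mult_ac)
  finally show ?thesis .
qed

definition cap_const :: "real \<Rightarrow> 'n::finite itself \<Rightarrow> real" where
  "cap_const \<sigma> _ = seminorm_heat_const \<sigma> TYPE('n) * (2 ^ CARD('n) * exp (1/8))"

text \<open>The test function is not a Schwartz function, but the parameter space can be cut into countably many
  cells on each of which all heat kernels are dominated by a single one.\<close>
lemma cap_compact_le_heat_superposition:
  fixes \<rho> :: "real \<times> (real^'n::finite) \<Rightarrow> ennreal"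
  assumes \<sigma>: "0 < \<sigma>" "\<sigma> < 1" and K: "compact K"
    and [measurable]: "\<rho> \<in> borel_measurable borel"
    and V: "\<And>x. x \<in> K \<Longrightarrow> 1 < (\<integral>\<^sup>+z\<in>{0<..} \<times> UNIV. \<rho> z * ennreal (heat (2 * fst z) (x - snd z)) \<partial>lborel)"
  shows "cap_compact \<sigma> K \<le> ennreal (cap_const \<sigma> TYPE('n)) * (\<integral>\<^sup>+z\<in>{0<..} \<times> UNIV. \<rho> z * ennreal (fst z powr (- \<sigma> / 2)) \<partial>lborel)"
proof -
  obtain D :: "(real \<times> (real^'n)) set" where D: "countable D" "\<And>X. open X \<Longrightarrow> X \<noteq> {} \<Longrightarrow> \<exists>d\<in>D. d \<in> X"
    using countable_dense_exists by blast
  have [measurable]: "(fst :: real \<times> (real^'n) \<Rightarrow> real) \<in> borel_measurable borel" "(snd :: real \<times> (real^'n) \<Rightarrow> real^'n) \<in> borel_measurable borel"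
    by (intro borel_measurable_continuous_onI continuous_intros)+
  have "D \<noteq> {}" using D(2)[of UNIV] by auto
  define d where "d = from_nat_into D"
  have d: "range d = D" unfolding d_def using \<open>D \<noteq> {}\<close> D(1) by (rule range_from_nat_into)
  \<comment> \<open>The parameters (time, centre) to which \<open>heat_harnack\<close> applies with
    the dense point \<open>d i\<close> as (t', y').\<close>
  define N where "N i = {z. 0 < fst z \<and> fst z < fst (d i) \<and> fst (d i) < 2 * fst z \<and> (dist (snd z) (snd (d i)))\<^sup>2 < fst z}" for i
  have No: "open (N i)" for i unfolding N_def
    by (intro open_Collect_conj open_Collect_less continuous_intros)
  have "{0<..} \<times> UNIV \<subseteq> (\<Union>i. N i)"
  proof
    fix z :: "real \<times> (real^'n)" assume "z \<in> {0<..} \<times> UNIV"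
    then have z: "fst z > 0" by auto
    let ?X = "{w. fst z < fst w \<and> fst w < 2 * fst z \<and> (dist (snd z) (snd w))\<^sup>2 < fst z}"
    have "open ?X" by (intro open_Collect_conj open_Collect_less continuous_intros)
    moreover have "(3/2 * fst z, snd z) \<in> ?X" using z by simp
    ultimately obtain w where "w \<in> D" "w \<in> ?X" using D(2)[of ?X] by blast
    then obtain i where "d i \<in> ?X" using d by auto
    then show "z \<in> (\<Union>i. N i)" using z by (auto simp: N_def)
  qed
  then have U: "(\<Union>i. N i) = {0<..} \<times> UNIV" by (auto simp: N_def)
  define M where "M = disjointed N"
  have MN: "M i \<subseteq> N i" for i unfolding M_def by (rule disjointed_subset)
  have [measurable]: "M i \<in> sets borel" for i
    unfolding M_def using No by (auto simp: disjointed_def)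
  have ind: "(\<Sum>i. indicator (M i) z) = (indicator ({0<..} \<times> UNIV) z :: ennreal)" for z
    unfolding U[symmetric] UN_disjointed_eq[of N, symmetric] M_def
    by (rule suminf_indicator) (rule disjoint_family_disjointed)
  have split: "(\<integral>\<^sup>+z\<in>{0<..} \<times> UNIV. f z \<partial>lborel) = (\<Sum>i. \<integral>\<^sup>+z\<in>M i. f z \<partial>lborel)"
    if [measurable]: "f \<in> borel_measurable borel" for f :: "real \<times> (real^'n) \<Rightarrow> ennreal"
  proof -
    have "f z * indicator ({0<..} \<times> UNIV) z = (\<Sum>i. f z * indicator (M i) z)" for z
      unfolding ennreal_suminf_cmult ind ..
    then have "(\<integral>\<^sup>+z\<in>{0<..} \<times> UNIV. f z \<partial>lborel) = (\<integral>\<^sup>+z. (\<Sum>i. f z * indicator (M i) z) \<partial>lborel)"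
      by (simp only:)
    also have "\<dots> = (\<Sum>i. \<integral>\<^sup>+z\<in>M i. f z \<partial>lborel)" by (rule nn_integral_suminf) measurable
    finally show ?thesis .
  qed
  \<comment> \<open>The time 4t' of \<open>heat_harnack\<close>. A dense point of nonpositive time
    has an empty cell; the value 1 merely keeps all times positive.\<close>
  define t where "t i = (if fst (d i) > 0 then 4 * fst (d i) else 1)" for i
  have t: "t i > 0" for i by (simp add: t_def)
  let ?c = "2 ^ CARD('n) * exp (1/8) :: real"
  define m where "m i = ennreal ?c * (\<integral>\<^sup>+z\<in>M i. \<rho> z \<partial>lborel)" for i
  have inN: "0 < fst z" "t i = 4 * fst (d i)" "fst z < fst (d i)" "fst (d i) < 2 * fst z" "(dist (snd z) (snd (d i)))\<^sup>2 < fst z" if "z \<in> M i" for z i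
    using MN[of i] that by (auto simp: N_def t_def)
  have "1 < (\<Sum>i. m i * ennreal (heat (t i) (x - snd (d i))))" if "x \<in> K" for x
  proof -
    note V[OF that]
    also have "(\<integral>\<^sup>+z\<in>{0<..} \<times> UNIV. \<rho> z * ennreal (heat (2 * fst z) (x - snd z)) \<partial>lborel) = (\<Sum>i. \<integral>\<^sup>+z\<in>M i. \<rho> z * ennreal (heat (2 * fst z) (x - snd z)) \<partial>lborel)"
      by (rule split) measurable
    also have "\<dots> \<le> (\<Sum>i. m i * ennreal (heat (t i) (x - snd (d i))))"
    proof (intro suminf_le)
      fix i
      have "(\<integral>\<^sup>+z\<in>M i. \<rho> z * ennreal (heat (2 * fst z) (x - snd z)) \<partial>lborel) \<le> (\<integral>\<^sup>+z. (\<rho> z * indicator (M i) z) * ennreal (?c * heat (t i) (x - snd (d i))) \<partial>lborel)"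
      proof (intro nn_integral_mono)
        fix z
        show "\<rho> z * ennreal (heat (2 * fst z) (x - snd z)) * indicator (M i) z \<le> (\<rho> z * indicator (M i) z) * ennreal (?c * heat (t i) (x - snd (d i)))"
        proof (cases "z \<in> M i")
          case True
          have "heat (2 * fst z) (x - snd z) \<le> ?c * heat (t i) (x - snd (d i))"
            unfolding inN(2)[OF True] by (rule heat_harnack) (use inN[OF True] in auto)
          then show ?thesis using True by (simp add: mult_left_mono ennreal_leI)
        qed simp
      qed
      also have "\<dots> = m i * ennreal (heat (t i) (x - snd (d i)))"
      proof -
        have "ennreal (?c * heat (t i) (x - snd (d i))) = ennreal ?c * ennreal (heat (t i) (x - snd (d i)))"
          by (rule ennreal_mult') simp
        moreover have "(\<integral>\<^sup>+z. (\<rho> z * indicator (M i) z) * ennreal (?c * heat (t i) (x - snd (d i))) \<partial>lborel)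
           = (\<integral>\<^sup>+z\<in>M i. \<rho> z \<partial>lborel) * ennreal (?c * heat (t i) (x - snd (d i)))"
          by (rule nn_integral_multc) measurable
        ultimately show ?thesis unfolding m_def by (simp only: mult_ac)
      qed
      finally show "(\<integral>\<^sup>+z\<in>M i. \<rho> z * ennreal (heat (2 * fst z) (x - snd z)) \<partial>lborel) \<le> \<dots>" .
    qed auto
    finally show ?thesis .
  qed
  from cap_compact_le_series[OF \<sigma> t K this]
  have "cap_compact \<sigma> K \<le> ennreal (seminorm_heat_const \<sigma> TYPE('n)) * (\<Sum>i. m i * ennreal (t i powr (- \<sigma> / 2)))" .
  also have "(\<Sum>i. m i * ennreal (t i powr (- \<sigma> / 2))) \<le> (\<Sum>i. ennreal ?c * (\<integral>\<^sup>+z\<in>M i. \<rho> z * ennreal (fst z powr (- \<sigma> / 2)) \<partial>lborel))"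
  proof (intro suminf_le)
    fix i
    have "(\<integral>\<^sup>+z\<in>M i. \<rho> z \<partial>lborel) * ennreal (t i powr (- \<sigma> / 2)) = (\<integral>\<^sup>+z. (\<rho> z * indicator (M i) z) * ennreal (t i powr (- \<sigma> / 2)) \<partial>lborel)"
      by (subst nn_integral_multc) auto
    also have "\<dots> \<le> (\<integral>\<^sup>+z\<in>M i. \<rho> z * ennreal (fst z powr (- \<sigma> / 2)) \<partial>lborel)"
    proof (intro nn_integral_mono)
      fix z
      show "\<rho> z * indicator (M i) z * ennreal (t i powr (- \<sigma> / 2)) \<le> \<rho> z * ennreal (fst z powr (- \<sigma> / 2)) * indicator (M i) z"
      proof (cases "z \<in> M i")
        case True
        \<comment> \<open>The representing time exceeds all times in its cell, so replacing them by
          it does not raise the cost, a negative power of time.\<close>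
        have "t i powr (- \<sigma> / 2) \<le> fst z powr (- \<sigma> / 2)" using inN[OF True] \<sigma> by (intro powr_mono2') auto
        then show ?thesis using True by (auto intro!: mult_left_mono ennreal_leI)
      qed auto
    qed
    finally show "m i * ennreal (t i powr (- \<sigma> / 2)) \<le> ennreal ?c * (\<integral>\<^sup>+z\<in>M i. \<rho> z * ennreal (fst z powr (- \<sigma> / 2)) \<partial>lborel)"
      unfolding m_def mult.assoc by (rule mult_left_mono) simp
  qed auto
  also have "\<dots> = ennreal ?c * (\<integral>\<^sup>+z\<in>{0<..} \<times> UNIV. \<rho> z * ennreal (fst z powr (- \<sigma> / 2)) \<partial>lborel)"
    by (subst split) auto
  finally have "cap_compact \<sigma> K \<le> ennreal (seminorm_heat_const \<sigma> TYPE('n)) * (ennreal ?c * (\<integral>\<^sup>+z\<in>{0<..} \<times> UNIV. \<rho> z * ennreal (fst z powr (- \<sigma> / 2)) \<partial>lborel))"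
    by (simp add: mult_left_mono)
  then show ?thesis unfolding cap_const_def by (simp add: ennreal_mult'' mult.assoc)
qed

section \<open>Fourier transforms of Schwartz functions\<close>

text \<open>Integrable majorant for Schwartz functions, in the role that doubled heat kernels play
  for Gaussians. The exponent is the dimension because each of the n factors 1 + |x|^2 dominates one
  factor 1 + x_b^2, which leaves a product of Cauchy densities.\<close>

definition bracket :: "'a::euclidean_space \<Rightarrow> real" where
  "bracket x = 1 / (1 + (norm x)\<^sup>2) ^ DIM('a)"

lemma bracket_pos: "bracket x > 0"
  by (simp add: bracket_def add_pos_nonneg)

lemma bracket_measurable [measurable]: "bracket \<in> borel_measurable borel"
  unfolding bracket_def[abs_def] by measurable

lemma integrable_bracket: "integrable lborel (bracket :: 'a::euclidean_space \<Rightarrow> real)"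
proof (rule Bochner_Integration.integrable_bound)
  have "integrable lborel (\<lambda>x::real. inverse (1 + x\<^sup>2))"
    using integrable_inverse_1_plus_square by (simp add: set_integrable_def)
  then have "has_bochner_integral lborel (\<lambda>x::'a. \<Prod>b\<in>Basis. inverse (1 + (x \<bullet> b)\<^sup>2)) (\<Prod>b\<in>(Basis::'a set). LINT x|lborel. inverse (1 + x\<^sup>2))"
    by (intro has_bochner_integral_lborel_prod) (simp add: has_bochner_integral_iff)
  then show "integrable lborel (\<lambda>x::'a. \<Prod>b\<in>Basis. inverse (1 + (x \<bullet> b)\<^sup>2))" by (simp add: has_bochner_integral_iff)
  show "AE x in lborel. norm (bracket x) \<le> norm (\<Prod>b\<in>Basis. inverse (1 + ((x::'a) \<bullet> b)\<^sup>2))"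
  proof (rule AE_I2)
    fix x :: 'a
    have "(\<Prod>b\<in>(Basis::'a set). inverse (1 + (norm x)\<^sup>2)) \<le> (\<Prod>b\<in>Basis. inverse (1 + (x \<bullet> b)\<^sup>2))"
    proof (rule prod_mono)
      fix b :: 'a assume "b \<in> Basis"
      then have "\<bar>x \<bullet> b\<bar> \<le> norm x" by (rule Basis_le_norm)
      then have "(x \<bullet> b)\<^sup>2 \<le> (norm x)\<^sup>2" using power_mono[of "\<bar>x \<bullet> b\<bar>" "norm x" 2] by simp
      then show "0 \<le> inverse (1 + (norm x)\<^sup>2) \<and> inverse (1 + (norm x)\<^sup>2) \<le> inverse (1 + (x \<bullet> b)\<^sup>2)"
        by (auto intro!: le_imp_inverse_le simp: add_pos_nonneg)
    qed
    moreover have "(\<Prod>b\<in>(Basis::'a set). inverse (1 + (norm x)\<^sup>2)) = bracket x"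
      by (simp add: bracket_def inverse_eq_divide power_one_over)
    ultimately show "norm (bracket x) \<le> norm (\<Prod>b\<in>Basis. inverse (1 + (x \<bullet> b)\<^sup>2))"
      using bracket_pos[of x] by (simp add: less_imp_le prod_nonneg)
  qed
qed measurable

lemma bracket_shift:
  assumes "norm e \<le> 1" shows "bracket (x + e :: 'a::euclidean_space) \<le> 3 ^ DIM('a) * bracket x"
proof -
  have "(norm x)\<^sup>2 \<le> (norm (x + e) + norm e)\<^sup>2"
    using norm_triangle_ineq4[of "x + e" e] by (intro power_mono) auto
  also have "\<dots> \<le> 2 * (norm (x + e))\<^sup>2 + 2 * (norm e)\<^sup>2"
    using sum_squares_bound[of "norm (x + e)" "norm e"] by (simp add: power2_sum)
  finally have 1: "(norm x)\<^sup>2 \<le> 2 * (norm (x + e))\<^sup>2 + 2 * (norm e)\<^sup>2" .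
  have "N \<le> 2 * a + 2 * b \<Longrightarrow> b \<le> 1 \<Longrightarrow> 0 \<le> a \<Longrightarrow> 1 + N \<le> 3 * (1 + a)" for N a b :: real by simp
  from this[OF 1 power_le_one[OF norm_ge_zero assms] zero_le_power2]
  have "1 + (norm x)\<^sup>2 \<le> 3 * (1 + (norm (x + e))\<^sup>2)" .
  then have "(1 + (norm x)\<^sup>2) ^ DIM('a) \<le> 3 ^ DIM('a) * (1 + (norm (x + e))\<^sup>2) ^ DIM('a)"
    unfolding power_mult_distrib[symmetric] by (intro power_mono) auto
  moreover have "(1 + (norm x)\<^sup>2) ^ DIM('a) > 0" "(1 + (norm (x + e))\<^sup>2) ^ DIM('a) > 0"
    by (simp_all add: add_pos_nonneg)
  ultimately show ?thesis unfolding bracket_def by (simp add: field_simps)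
qed

lemma decay_imp_bracket:
  fixes f :: "'a::euclidean_space \<Rightarrow> 'b::real_normed_vector"
  assumes "\<And>x. norm (f x) \<le> A" "\<And>x. norm x ^ (2 * DIM('a)) * norm (f x) \<le> B"
  shows "norm (f x) \<le> 2 ^ DIM('a) * (A + B) * bracket x"
proof -
  let ?r = "(norm x)\<^sup>2" and ?k = "DIM('a)"
  have "(1 + ?r) ^ ?k \<le> 2 ^ ?k * (1 + ?r ^ ?k)"
  proof (cases "?r \<le> 1")
    case True
    then have "(1 + ?r) ^ ?k \<le> 2 ^ ?k * 1" by (simp add: power_mono)
    also have "\<dots> \<le> 2 ^ ?k * (1 + ?r ^ ?k)" by (intro mult_left_mono) auto
    finally show ?thesis .
  next
    case False
    then have "(1 + ?r) ^ ?k \<le> (2 * ?r) ^ ?k" by (intro power_mono) auto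
    also have "\<dots> \<le> 2 ^ ?k * (1 + ?r ^ ?k)" by (simp add: power_mult_distrib)
    finally show ?thesis .
  qed
  then have "(1 + ?r) ^ ?k * norm (f x) \<le> 2 ^ ?k * (1 + ?r ^ ?k) * norm (f x)" by (intro mult_right_mono) auto
  also have "\<dots> = 2 ^ ?k * (norm (f x) + norm x ^ (2 * ?k) * norm (f x))"
    by (simp add: algebra_simps flip: power_mult)
  also have "\<dots> \<le> 2 ^ ?k * (A + B)" by (intro mult_left_mono add_mono assms) auto
  finally show ?thesis unfolding bracket_def by (simp add: field_simps add_pos_nonneg)
qed

section \<open>Decay of Schwartz functions and of their transforms, and Fourier inversion\<close>

lemma schwartz_partial:
  assumes "u \<in> schwartz_class" shows "partial_deriv j u \<in> schwartz_class"
proof -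
  have "iter_partial_deriv js (partial_deriv j u) = iter_partial_deriv (js @ [j]) u" for js
    by (simp add: iter_partial_deriv_def)
  then show ?thesis using assms unfolding schwartz_class_def by simp
qed

lemma schwartz_differentiable:
  assumes "u \<in> schwartz_class" shows "u differentiable (at x)"
proof -
  have "iter_partial_deriv [] u differentiable_on UNIV" using assms unfolding schwartz_class_def by blast
  then show ?thesis by (simp add: iter_partial_deriv_def differentiable_on_def)
qed

lemma schwartz_measurable:
  assumes "u \<in> schwartz_class" shows "u \<in> borel_measurable borel"
  using schwartz_differentiable[OF assms] differentiable_imp_continuous_within
  by (intro borel_measurable_continuous_onI) (auto simp: continuous_on_eq_continuous_at)

lemma schwartz_le_bracket:
  fixes u :: "real^'n::finite \<Rightarrow> real"
  assumes "u \<in> schwartz_class" shows "\<exists>C\<ge>0. \<forall>x. \<bar>u x\<bar> \<le> C * bracket x"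
proof -
  have "bounded (range (\<lambda>x. norm x ^ k * iter_partial_deriv [] u x))" for k
    using assms unfolding schwartz_class_def by blast
  then have "\<exists>B. \<forall>x. norm x ^ k * \<bar>u x\<bar> \<le> B" for k
    by (auto simp: bounded_iff iter_partial_deriv_def abs_mult)
  then obtain B where B: "\<And>k x. norm x ^ k * \<bar>u x\<bar> \<le> B k" by metis
  have u: "\<bar>u x\<bar> \<le> 2 ^ DIM(real^'n) * (B 0 + B (2 * DIM(real^'n))) * bracket x" for x
    using decay_imp_bracket[of u "B 0" "B (2 * DIM(real^'n))" x] B[of _ 0] B[of _ "2 * DIM(real^'n)"] by simp
  have "B 0 \<ge> 0" "B (2 * DIM(real^'n)) \<ge> 0"
    using B[of 0 0] B[of 0 "2 * DIM(real^'n)"] by (smt (verit) abs_ge_zero zero_le_mult_iff norm_ge_zero zero_le_power)+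
  then show ?thesis using u by (intro exI[of _ "2 ^ DIM(real^'n) * (B 0 + B (2 * DIM(real^'n)))"]) auto
qed

lemma schwartz_integrable:
  fixes u :: "real^'n::finite \<Rightarrow> real"
  assumes "u \<in> schwartz_class" shows "integrable lborel u"
proof -
  obtain C where C: "C \<ge> 0" "\<And>x. \<bar>u x\<bar> \<le> C * bracket x" using schwartz_le_bracket[OF assms] by blast
  show ?thesis
    by (rule Bochner_Integration.integrable_bound[of _ "\<lambda>x. C * bracket x"])
       (use C schwartz_measurable[OF assms] integrable_bracket in \<open>auto intro!: AE_I2 simp: less_imp_le[OF bracket_pos]\<close>)
qed

lemma schwartz_directional:
  assumes "u \<in> schwartz_class"
  shows "((\<lambda>h. u (y + h *\<^sub>R axis j 1)) has_vector_derivative partial_deriv j u y) (at 0)"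
proof -
  have "(u has_derivative frechet_derivative u (at y)) (at (y + 0 *\<^sub>R axis j 1))"
    using schwartz_differentiable[OF assms] by (simp add: frechet_derivative_works[symmetric])
  moreover have "((\<lambda>h. y + h *\<^sub>R axis j 1) has_derivative (\<lambda>h. h *\<^sub>R axis j 1)) (at (0::real))"
    by (auto intro!: derivative_eq_intros)
  ultimately have "(u \<circ> (\<lambda>h. y + h *\<^sub>R axis j 1) has_derivative frechet_derivative u (at y) \<circ> (\<lambda>h. h *\<^sub>R axis j 1)) (at 0)"
    by (intro diff_chain_at) auto
  moreover have "linear (frechet_derivative u (at y))"
    using linear_frechet_derivative[OF schwartz_differentiable[OF assms]] .
  ultimately show ?thesis
    by (simp add: has_vector_derivative_def o_def partial_deriv_def linear_cmul)
qed

text \<open>Gives \<open>fourier_inversion\<close> its rate of convergence. Bounds on the partial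
  derivatives bound the total derivative, which is linear and can be expanded along the
  axes.\<close>

lemma schwartz_lipschitz:
  fixes u :: "real^'n::finite \<Rightarrow> real"
  assumes u: "u \<in> schwartz_class"
  shows "\<exists>L\<ge>0. \<forall>x y. \<bar>u x - u y\<bar> \<le> L * norm (x - y)"
proof -
  have "\<exists>B\<ge>0. \<forall>x. \<bar>partial_deriv j u x\<bar> \<le> B" for j
  proof -
    obtain C where C: "C \<ge> 0" "\<And>x. \<bar>partial_deriv j u x\<bar> \<le> C * bracket x"
      using schwartz_le_bracket[OF schwartz_partial[OF u]] by blast
    have "\<bar>partial_deriv j u x\<bar> \<le> C" for x
    proof -
      have "bracket x \<le> 1" by (simp add: bracket_def one_le_power divide_le_eq_1 add_pos_nonneg)
      then show ?thesis using C(2)[of x] mult_left_le[of "bracket x" C] C(1) by linarith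
    qed
    then show ?thesis using C(1) by blast
  qed
  then obtain B where B: "\<And>j. B j \<ge> 0" "\<And>j x. \<bar>partial_deriv j u x\<bar> \<le> B j" by metis
  have "norm (u x - u y) \<le> (\<Sum>j\<in>UNIV. B j) * norm (x - y)" for x y
  proof (rule differentiable_bound[where S=UNIV and f'="\<lambda>x. frechet_derivative u (at x)"])
    fix x
    show "(u has_derivative frechet_derivative u (at x)) (at x within UNIV)"
      using schwartz_differentiable[OF u] by (simp add: frechet_derivative_works[symmetric])
    have lin: "linear (frechet_derivative u (at x))" using linear_frechet_derivative[OF schwartz_differentiable[OF u]] .
    show "onorm (frechet_derivative u (at x)) \<le> (\<Sum>j\<in>UNIV. B j)"
    proof (rule onorm_le)
      fix h :: "real^'n"
      have "frechet_derivative u (at x) h = frechet_derivative u (at x) (\<Sum>j\<in>UNIV. h $ j *\<^sub>R axis j 1)"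
        using basis_expansion[of h] by (simp add: scalar_mult_eq_scaleR)
      also have "\<dots> = (\<Sum>j\<in>UNIV. h $ j * partial_deriv j u x)"
        by (simp add: linear_sum[OF lin] linear_cmul[OF lin] partial_deriv_def)
      also have "norm \<dots> \<le> (\<Sum>j\<in>UNIV. norm h * B j)"
        by (rule sum_norm_le) (auto simp: abs_mult intro!: mult_mono component_le_norm_cart B)
      also have "\<dots> = (\<Sum>j\<in>UNIV. B j) * norm h" by (simp add: sum_distrib_left mult.commute)
      finally show "norm (frechet_derivative u (at x) h) \<le> (\<Sum>j\<in>UNIV. B j) * norm h" .
    qed
  qed auto
  then show ?thesis using B(1) by (intro exI[of _ "\<Sum>j\<in>UNIV. B j"]) (auto intro!: sum_nonneg)
qed

lemma norm_exp_imag [simp]: "norm (exp (2 * of_real pi * \<i> * of_real r)) = 1" "norm (exp (- (2 * of_real pi * \<i> * of_real r))) = 1"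
  "norm (exp (- 2 * of_real pi * \<i> * of_real r)) = 1"
  by simp_all

lemma exp_imag_directional:
  fixes y \<xi> :: "real^'n::finite"
  shows "((\<lambda>h. exp (c * \<i> * of_real ((y + h *\<^sub>R axis j 1) \<bullet> \<xi>))) has_vector_derivative (c * \<i> * of_real (\<xi> $ j)) * exp (c * \<i> * of_real (y \<bullet> \<xi>))) (at 0)"
proof -
  have "((\<lambda>z. exp (c * \<i> * (of_real (y \<bullet> \<xi>) + z * of_real (\<xi> $ j)))) has_field_derivative
    (c * \<i> * of_real (\<xi> $ j)) * exp (c * \<i> * of_real (y \<bullet> \<xi>))) (at (of_real 0))"
    by (rule derivative_eq_intros refl | simp)+
  from has_vector_derivative_real_field[OF this] show ?thesis
    by (simp add: inner_add_left inner_axis')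
qed

lemma fourier_partial:
  fixes u :: "real^'n::finite \<Rightarrow> real"
  assumes u: "u \<in> schwartz_class"
  shows "fourier (\<lambda>x. of_real (partial_deriv j u x)) \<xi> = (2 * of_real pi * \<i> * of_real (\<xi> $ j)) * fourier (\<lambda>x. of_real (u x)) \<xi>"
proof -
  let ?e = "\<lambda>x. exp (- 2 * of_real pi * \<i> * of_real (x \<bullet> \<xi>)) :: complex"
  obtain C where C: "C \<ge> 0" "\<And>x. \<bar>u x\<bar> \<le> C * bracket x" using schwartz_le_bracket[OF u] by blast
  obtain C' where C': "C' \<ge> 0" "\<And>x. \<bar>partial_deriv j u x\<bar> \<le> C' * bracket x"
    using schwartz_le_bracket[OF schwartz_partial[OF u]] by blast
  have i: "integrable lborel (\<lambda>x. of_real (v x) * ?e x)" if v: "v \<in> schwartz_class" for v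
    by (rule Bochner_Integration.integrable_bound[of _ v]) (use schwartz_integrable[OF v] schwartz_measurable[OF v] in \<open>auto simp: norm_mult\<close>)
  have "has_bochner_integral lborel (\<lambda>x. of_real (partial_deriv j u x) * ?e x + of_real (u x) * ((- 2 * of_real pi * \<i> * of_real (\<xi> $ j)) * ?e x)) 0"
  proof (rule integral_directional_derivative_eq_0[where f="\<lambda>x. of_real (u x) * ?e x" and e="axis j 1"
        and g="\<lambda>x. (C' + C * (2 * pi * \<bar>\<xi> $ j\<bar>)) * (3 ^ DIM(real^'n) * bracket x)"])
    show "integrable lborel (\<lambda>x. of_real (u x) * ?e x)" by (rule i[OF u])
    show "integrable lborel (\<lambda>x::real^'n. (C' + C * (2 * pi * \<bar>\<xi> $ j\<bar>)) * (3 ^ DIM(real^'n) * bracket x))"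
      using integrable_bracket by (intro integrable_mult_right) auto
    fix y h
    show "((\<lambda>h. of_real (u (y + h *\<^sub>R axis j 1)) * ?e (y + h *\<^sub>R axis j 1)) has_vector_derivative
       of_real (partial_deriv j u y) * ?e y + of_real (u y) * ((- 2 * of_real pi * \<i> * of_real (\<xi> $ j)) * ?e y)) (at 0)"
    proof -
      have 1: "((\<lambda>h. of_real (u (y + h *\<^sub>R axis j 1)) :: complex) has_vector_derivative of_real (partial_deriv j u y)) (at 0)"
        using has_vector_derivative_of_real schwartz_directional[OF u] has_real_derivative_iff_has_vector_derivative by blast
      show ?thesis
        by (rule has_vector_derivative_eq_rhs, rule has_vector_derivative_mult[OF 1 exp_imag_directional]) simp
    qed
    assume "\<bar>h\<bar> \<le> (1::real)"
    let ?y = "y + h *\<^sub>R axis j 1"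
    have "norm (of_real (partial_deriv j u ?y) * ?e ?y + of_real (u ?y) * ((- 2 * of_real pi * \<i> * of_real (\<xi> $ j)) * ?e ?y))
       \<le> \<bar>partial_deriv j u ?y\<bar> + \<bar>u ?y\<bar> * (2 * pi * \<bar>\<xi> $ j\<bar>)"
      by (rule order.trans[OF norm_triangle_ineq]) (simp add: norm_mult)
    also have "\<dots> \<le> C' * bracket ?y + C * bracket ?y * (2 * pi * \<bar>\<xi> $ j\<bar>)"
      by (intro add_mono mult_right_mono C C') auto
    also have "\<dots> = (C' + C * (2 * pi * \<bar>\<xi> $ j\<bar>)) * bracket ?y" by (simp add: algebra_simps)
    also have "\<dots> \<le> (C' + C * (2 * pi * \<bar>\<xi> $ j\<bar>)) * (3 ^ DIM(real^'n) * bracket y)"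
      using C(1) C'(1) \<open>\<bar>h\<bar> \<le> 1\<close> by (intro mult_left_mono bracket_shift) auto
    finally show "norm (of_real (partial_deriv j u ?y) * ?e ?y + of_real (u ?y) * ((- 2 * of_real pi * \<i> * of_real (\<xi> $ j)) * ?e ?y)) \<le> \<dots>" .
  qed
  then have "(LINT x|lborel. of_real (partial_deriv j u x) * ?e x + (- 2 * of_real pi * \<i> * of_real (\<xi> $ j)) * (of_real (u x) * ?e x)) = 0"
    by (simp add: has_bochner_integral_iff mult.left_commute)
  then have "fourier (\<lambda>x. of_real (partial_deriv j u x)) \<xi> + (- 2 * of_real pi * \<i> * of_real (\<xi> $ j)) * fourier (\<lambda>x. of_real (u x)) \<xi> = 0"
    unfolding fourier_def
    by (subst (asm) Bochner_Integration.integral_add)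
       (use i[OF u] i[OF schwartz_partial[OF u]] in \<open>auto simp: mult.assoc\<close>)
  then show ?thesis by (simp add: add_eq_0_iff)
qed

lemma norm_fourier_le:
  "norm (fourier (\<lambda>x. of_real (u x)) \<xi>) \<le> (LINT x|lborel. \<bar>u x\<bar>)"
  unfolding fourier_def by (rule order.trans[OF integral_norm_bound]) (simp add: norm_mult)

text \<open>Repeated differentiation in one direction gives decay in that coordinate. For each
  frequency the largest coordinate controls the norm up to the factor n, so pure iterated
  derivatives are enough.\<close>

lemma fourier_schwartz_decay:
  fixes u :: "real^'n::finite \<Rightarrow> real"
  assumes u: "u \<in> schwartz_class"
  shows "\<exists>C. \<forall>\<xi>. norm \<xi> ^ m * norm (fourier (\<lambda>x. of_real (u x)) \<xi>) \<le> C"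
proof -
  define v where "v j k = (partial_deriv j ^^ k) u" for j k
  have v: "v j k \<in> schwartz_class" for j k by (induction k) (auto simp: v_def u schwartz_partial)
  have F: "norm (fourier (\<lambda>x. of_real (v j k x)) \<xi>) = (2 * pi * \<bar>\<xi> $ j\<bar>) ^ k * norm (fourier (\<lambda>x. of_real (u x)) \<xi>)" for j k \<xi>
  proof (induction k)
    case (Suc k)
    have "v j (Suc k) = partial_deriv j (v j k)" by (simp add: v_def)
    then show ?case using fourier_partial[OF v, of j j k \<xi>] Suc by (simp add: norm_mult)
  qed (simp add: v_def)
  define I where "I j = (LINT x|lborel. \<bar>v j m x\<bar>)" for j
  have B: "\<bar>\<xi> $ j\<bar> ^ m * norm (fourier (\<lambda>x. of_real (u x)) \<xi>) \<le> I j" for \<xi> j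
  proof -
    have "\<bar>\<xi> $ j\<bar> ^ m \<le> (2 * pi * \<bar>\<xi> $ j\<bar>) ^ m"
      using pi_ge_two by (intro power_mono) (auto simp: mult_le_cancel_right1 intro: order.trans[of _ "2*2"])
    then have "\<bar>\<xi> $ j\<bar> ^ m * norm (fourier (\<lambda>x. of_real (u x)) \<xi>) \<le> (2 * pi * \<bar>\<xi> $ j\<bar>) ^ m * norm (fourier (\<lambda>x. of_real (u x)) \<xi>)"
      by (intro mult_right_mono) auto
    also have "\<dots> \<le> I j" unfolding F[symmetric] I_def by (rule norm_fourier_le)
    finally show ?thesis .
  qed
  have "norm \<xi> ^ m * norm (fourier (\<lambda>x. of_real (u x)) \<xi>) \<le> real CARD('n) ^ m * (\<Sum>j\<in>UNIV. I j)" for \<xi>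
  proof -
    have "\<exists>j. \<forall>i. \<bar>\<xi> $ i\<bar> \<le> \<bar>\<xi> $ j\<bar>"
    proof -
      have "Max (range (\<lambda>i. \<bar>\<xi> $ i\<bar>)) \<in> range (\<lambda>i. \<bar>\<xi> $ i\<bar>)" by (intro Max_in) auto
      then obtain j where "Max (range (\<lambda>i. \<bar>\<xi> $ i\<bar>)) = \<bar>\<xi> $ j\<bar>" by blast
      moreover have "\<bar>\<xi> $ i\<bar> \<le> Max (range (\<lambda>i. \<bar>\<xi> $ i\<bar>))" for i by (intro Max_ge) auto
      ultimately show ?thesis by auto
    qed
    then obtain j where j: "\<And>i. \<bar>\<xi> $ i\<bar> \<le> \<bar>\<xi> $ j\<bar>" by blast
    have "norm \<xi> \<le> (\<Sum>i\<in>UNIV. \<bar>\<xi> $ i\<bar>)" by (rule norm_le_l1_cart)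
    also have "\<dots> \<le> real CARD('n) * \<bar>\<xi> $ j\<bar>" using sum_bounded_above[of UNIV "\<lambda>i. \<bar>\<xi> $ i\<bar>"] j by auto
    finally have "norm \<xi> ^ m \<le> (real CARD('n) * \<bar>\<xi> $ j\<bar>) ^ m" by (intro power_mono) auto
    then have "norm \<xi> ^ m * norm (fourier (\<lambda>x. of_real (u x)) \<xi>) \<le> (real CARD('n) * \<bar>\<xi> $ j\<bar>) ^ m * norm (fourier (\<lambda>x. of_real (u x)) \<xi>)"
      by (intro mult_right_mono) auto
    also have "\<dots> = real CARD('n) ^ m * (\<bar>\<xi> $ j\<bar> ^ m * norm (fourier (\<lambda>x. of_real (u x)) \<xi>))" by (simp add: power_mult_distrib)
    also have "\<dots> \<le> real CARD('n) ^ m * I j" by (intro mult_left_mono B) auto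
    also have "\<dots> \<le> real CARD('n) ^ m * (\<Sum>j\<in>UNIV. I j)"
      by (intro mult_left_mono member_le_sum) (auto simp: I_def)
    finally show ?thesis .
  qed
  then show ?thesis by blast
qed

lemma integrable_fourier_weight:
  fixes u :: "real^'n::finite \<Rightarrow> real"
  assumes u: "u \<in> schwartz_class"
  shows "integrable lborel (\<lambda>\<xi>. norm \<xi> ^ k * norm (fourier (\<lambda>x. of_real (u x)) \<xi>))"
proof -
  let ?f = "\<lambda>\<xi>. norm \<xi> ^ k * norm (fourier (\<lambda>x. of_real (u x)) \<xi>)"
  note [measurable] = schwartz_measurable[OF u]
  obtain A where A: "\<And>\<xi>. ?f \<xi> \<le> A" using fourier_schwartz_decay[OF u, of k] by blast
  obtain B where B: "\<And>\<xi>. norm \<xi> ^ (2 * DIM(real^'n) + k) * norm (fourier (\<lambda>x. of_real (u x)) \<xi>) \<le> B"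
    using fourier_schwartz_decay[OF u] by blast
  have "norm (?f \<xi>) \<le> 2 ^ DIM(real^'n) * (A + B) * bracket \<xi>" for \<xi>
    by (rule decay_imp_bracket) (use A B in \<open>auto simp: power_add mult.assoc\<close>)
  then show ?thesis
    by (intro Bochner_Integration.integrable_bound[of _ "\<lambda>\<xi>. 2 ^ DIM(real^'n) * (A + B) * bracket \<xi>" ?f] integrable_mult_right integrable_bracket AE_I2)
       (auto intro: order.trans[OF _ abs_ge_self])
qed

text \<open>Replaces polar coordinates. The negative power is written as an Euler integral, Tonelli
  leaves Gaussian integrals of total size at most (1 + \<tau>)^(-1/2) in any dimension, and
  \<open>nn_integral_powr_div_sqrt\<close> with t = 1 bounds what remains.\<close>

lemma integrable_powr_gauss:
  assumes z: "0 < z" "z < 1/2"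
  shows "integrable lborel (\<lambda>\<xi>::real^'n::finite. (2 * pi * norm \<xi>) powr (- 2 * z) * exp (- 1 * (2 * pi * norm \<xi>)\<^sup>2))"
proof (rule integrableI_bounded)
  have gz: "Gamma z > 0" using z by simp
  let ?f = "\<lambda>\<xi>::real^'n. (2 * pi * norm \<xi>) powr (- 2 * z) * exp (- 1 * (2 * pi * norm \<xi>)\<^sup>2)"
  let ?k = "\<lambda>\<xi>::real^'n. \<lambda>\<tau>. indicator {0<..} \<tau> * (\<tau> powr (z - 1) * exp (- \<tau> * (2 * pi * norm \<xi>)\<^sup>2))"
  have g: "ennreal (norm (?f \<xi>)) \<le> ennreal (1 / Gamma z) * (\<integral>\<^sup>+\<tau>. ennreal (?k \<xi> \<tau>) \<partial>lborel) * ennreal (exp (- 1 * (2 * pi * norm \<xi>)\<^sup>2))" for \<xi>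
  proof (cases "\<xi> = 0")
    case False
    have "((2 * pi * norm \<xi>)\<^sup>2) powr (- z) = (2 * pi * norm \<xi>) powr (- 2 * z)"
      using False powr_powr[of "2 * pi * norm \<xi>" 2 "- z"] by simp
    then have "has_bochner_integral lborel (?k \<xi>) (Gamma z * (2 * pi * norm \<xi>) powr (- 2 * z))"
      using has_bochner_integral_gamma[OF z(1), of "(2 * pi * norm \<xi>)\<^sup>2"] False by simp
    then have "(\<integral>\<^sup>+\<tau>. ennreal (?k \<xi> \<tau>) \<partial>lborel) = ennreal (Gamma z * (2 * pi * norm \<xi>) powr (- 2 * z))"
      by (subst nn_integral_eq_integral) (auto simp: has_bochner_integral_iff)
    then show ?thesis using gz by (simp flip: ennreal_mult')
  qed simp
  have q: "(\<integral>\<^sup>+\<xi>. ennreal (exp (- (1 + \<tau>) * (2 * pi * norm (\<xi>::real^'n))\<^sup>2)) \<partial>lborel) \<le> ennreal (1 / sqrt (1 + \<tau>))" if "\<tau> > 0" for \<tau>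
  proof -
    have "(\<integral>\<^sup>+\<xi>. ennreal (exp (- (1 + \<tau>) * (2 * pi * norm (\<xi>::real^'n))\<^sup>2)) \<partial>lborel)
      = (\<integral>\<^sup>+\<xi>. ennreal (sqrt (1 / (4 * pi * (1 + \<tau>))) ^ CARD('n)) * ennreal (heat (1 / (16 * pi\<^sup>2 * (1 + \<tau>))) (\<xi> - 0 :: real^'n)) \<partial>lborel)"
      using that by (intro nn_integral_cong) (subst gauss_eq_heat, auto simp: ennreal_mult')
    also have "\<dots> = ennreal (sqrt (1 / (4 * pi * (1 + \<tau>))) ^ CARD('n))"
      using that by (subst nn_integral_cmult) (use nn_integral_heat(2)[of "1 / (16 * pi\<^sup>2 * (1 + \<tau>))" "0::real^'n"] in auto)
    also have "\<dots> \<le> ennreal (1 / sqrt (1 + \<tau>))"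
    proof (rule ennreal_leI)
      \<comment> \<open>The base of the n-th power is at most 1, so that power is at most the first
        one, uniformly in the dimension.\<close>
      have a: "1 \<le> 4 * pi * (1 + \<tau>)" "1 + \<tau> \<le> 4 * pi * (1 + \<tau>)"
        using that pi_ge_two by (smt (verit) mult_le_cancel_right1)+
      then have "sqrt (1 / (4 * pi * (1 + \<tau>))) ^ CARD('n) \<le> sqrt (1 / (4 * pi * (1 + \<tau>))) ^ 1"
        by (intro power_decreasing) auto
      also have "\<dots> \<le> sqrt (1 / (1 + \<tau>))"
        using a that unfolding power_one_right by (intro real_sqrt_le_mono divide_left_mono) auto
      finally show "sqrt (1 / (4 * pi * (1 + \<tau>))) ^ CARD('n) \<le> 1 / sqrt (1 + \<tau>)" by (simp add: real_sqrt_divide)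
    qed
    finally show ?thesis .
  qed
  have "(\<integral>\<^sup>+\<xi>. ennreal (norm (?f \<xi>)) \<partial>lborel) \<le> (\<integral>\<^sup>+\<xi>. ennreal (1 / Gamma z) * (\<integral>\<^sup>+\<tau>. ennreal (?k \<xi> \<tau>) \<partial>lborel) * ennreal (exp (- 1 * (2 * pi * norm \<xi>)\<^sup>2)) \<partial>lborel)"
    by (intro nn_integral_mono g)
  also have "\<dots> = (\<integral>\<^sup>+\<xi>. ennreal (1 / Gamma z) * (\<integral>\<^sup>+\<tau>. ennreal (?k \<xi> \<tau>) * ennreal (exp (- 1 * (2 * pi * norm \<xi>)\<^sup>2)) \<partial>lborel) \<partial>lborel)"
    unfolding mult.assoc by (subst nn_integral_multc) auto
  also have "\<dots> = ennreal (1 / Gamma z) * (\<integral>\<^sup>+\<xi>. (\<integral>\<^sup>+\<tau>. ennreal (?k \<xi> \<tau>) * ennreal (exp (- 1 * (2 * pi * norm \<xi>)\<^sup>2)) \<partial>lborel) \<partial>lborel)"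
    by (rule nn_integral_cmult) measurable
  also have "(\<integral>\<^sup>+\<xi>. (\<integral>\<^sup>+\<tau>. ennreal (?k \<xi> \<tau>) * ennreal (exp (- 1 * (2 * pi * norm \<xi>)\<^sup>2)) \<partial>lborel) \<partial>lborel)
    = (\<integral>\<^sup>+\<tau>. (\<integral>\<^sup>+\<xi>. ennreal (?k \<xi> \<tau>) * ennreal (exp (- 1 * (2 * pi * norm \<xi>)\<^sup>2)) \<partial>lborel) \<partial>lborel)"
    by (subst lborel_pair.Fubini') auto
  also have "\<dots> \<le> (\<integral>\<^sup>+\<tau>\<in>{0<..}. ennreal (\<tau> powr (z - 1) / sqrt (1 + \<tau>)) \<partial>lborel)"
  proof (rule nn_integral_mono)
    fix \<tau> :: real
    show "(\<integral>\<^sup>+\<xi>. ennreal (?k \<xi> \<tau>) * ennreal (exp (- 1 * (2 * pi * norm \<xi>)\<^sup>2)) \<partial>lborel) \<le> ennreal (\<tau> powr (z - 1) / sqrt (1 + \<tau>)) * indicator {0<..} \<tau>"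
    proof (cases "\<tau> > 0")
      case True
      have e: "exp (- \<tau> * (2 * pi * norm \<xi>)\<^sup>2) * exp (- 1 * (2 * pi * norm \<xi>)\<^sup>2) = exp (- (1 + \<tau>) * (2 * pi * norm \<xi>)\<^sup>2)" for \<xi> :: "real^'n"
        by (simp add: algebra_simps flip: exp_add)
      have "(\<integral>\<^sup>+\<xi>. ennreal (?k \<xi> \<tau>) * ennreal (exp (- 1 * (2 * pi * norm \<xi>)\<^sup>2)) \<partial>lborel)
        = (\<integral>\<^sup>+\<xi>. ennreal (\<tau> powr (z - 1)) * ennreal (exp (- (1 + \<tau>) * (2 * pi * norm (\<xi>::real^'n))\<^sup>2)) \<partial>lborel)"
        using True unfolding e[symmetric] by (intro nn_integral_cong) (simp add: mult.assoc flip: ennreal_mult')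
      also have "\<dots> \<le> ennreal (\<tau> powr (z - 1)) * ennreal (1 / sqrt (1 + \<tau>))"
        by (subst nn_integral_cmult, measurable) (rule mult_left_mono[OF q[OF True]], simp)
      also have "\<dots> = ennreal (\<tau> powr (z - 1) / sqrt (1 + \<tau>))" by (simp flip: ennreal_mult')
      finally show ?thesis using True by simp
    qed simp
  qed
  also have "\<dots> \<le> ennreal ((1 / z + 1 / (1/2 - z)) * 1 powr (z - 1/2))" by (rule nn_integral_powr_div_sqrt[OF z]) simp
  finally have "(\<integral>\<^sup>+\<xi>. ennreal (norm (?f \<xi>)) \<partial>lborel) \<le> ennreal (1 / Gamma z) * ennreal ((1 / z + 1 / (1/2 - z)) * 1 powr (z - 1/2))"
    by (meson mult_left_mono order_trans zero_le)
  also have "\<dots> < \<infinity>" by (simp add: ennreal_mult_less_top)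
  finally show "(\<integral>\<^sup>+\<xi>. ennreal (norm (?f \<xi>)) \<partial>lborel) < \<infinity>" .
qed measurable

lemma integrable_fourier_singular:
  fixes u :: "real^'n::finite \<Rightarrow> real"
  assumes u: "u \<in> schwartz_class" and z: "0 < z" "z < 1/2"
  shows "integrable lborel (\<lambda>\<xi>. (2 * pi * norm \<xi>) powr (- 2 * z) * norm (fourier (\<lambda>x. of_real (u x)) \<xi>))"
proof -
  note [measurable] = schwartz_measurable[OF u]
  obtain A where A: "\<And>\<xi>. norm (fourier (\<lambda>x. of_real (u x)) \<xi>) \<le> A" using norm_fourier_le by blast
  have A0: "A \<ge> 0" using A[of 0] norm_ge_zero by (rule order.trans[rotated])
  let ?w = "\<lambda>\<xi>::real^'n. (2 * pi * norm \<xi>) powr (- 2 * z)"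
  show ?thesis
  proof (rule Bochner_Integration.integrable_bound)
    \<comment> \<open>First term for 2 pi |\<xi>| at most 1, where \<open>exp 1\<close> compensates
      the Gaussian and \<open>A\<close> bounds the transform; second term elsewhere, where the
      weight is at most 1.\<close>
    show "integrable lborel (\<lambda>\<xi>::real^'n. A * exp 1 * (?w \<xi> * exp (- 1 * (2 * pi * norm \<xi>)\<^sup>2)) + norm \<xi> ^ 0 * norm (fourier (\<lambda>x. of_real (u x)) \<xi>))"
      by (intro Bochner_Integration.integrable_add integrable_mult_right integrable_powr_gauss z integrable_fourier_weight u)
    show "AE \<xi> in lborel. norm (?w \<xi> * norm (fourier (\<lambda>x. of_real (u x)) \<xi>)) \<le>
       norm (A * exp 1 * (?w \<xi> * exp (- 1 * (2 * pi * norm \<xi>)\<^sup>2)) + norm \<xi> ^ 0 * norm (fourier (\<lambda>x. of_real (u x)) \<xi>))"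
    proof (rule AE_I2)
      fix \<xi> :: "real^'n"
      have "?w \<xi> * norm (fourier (\<lambda>x. of_real (u x)) \<xi>) \<le> A * exp 1 * (?w \<xi> * exp (- 1 * (2 * pi * norm \<xi>)\<^sup>2)) + norm (fourier (\<lambda>x. of_real (u x)) \<xi>)"
      proof (cases "2 * pi * norm \<xi> \<le> 1")
        case True
        then have "(2 * pi * norm \<xi>)\<^sup>2 \<le> 1" by (intro power_le_one) auto
        then have "1 \<le> exp 1 * exp (- 1 * (2 * pi * norm \<xi>)\<^sup>2)" by (simp flip: exp_add)
        then have "?w \<xi> * A * 1 \<le> ?w \<xi> * A * (exp 1 * exp (- 1 * (2 * pi * norm \<xi>)\<^sup>2))" using A0 by (intro mult_left_mono) auto
        moreover have "?w \<xi> * norm (fourier (\<lambda>x. of_real (u x)) \<xi>) \<le> ?w \<xi> * A" by (intro mult_left_mono A) auto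
        ultimately have "?w \<xi> * norm (fourier (\<lambda>x. of_real (u x)) \<xi>) \<le> A * exp 1 * (?w \<xi> * exp (- 1 * (2 * pi * norm \<xi>)\<^sup>2))" by (simp add: mult_ac)
        then show ?thesis by (simp add: add_increasing2)
      next
        case False
        then have "?w \<xi> \<le> 1 powr (- 2 * z)" using z by (intro powr_mono2') auto
        then have "?w \<xi> * norm (fourier (\<lambda>x. of_real (u x)) \<xi>) \<le> 1 * norm (fourier (\<lambda>x. of_real (u x)) \<xi>)" by (intro mult_right_mono) auto
        then show ?thesis using A0 by (simp add: add_increasing)
      qed
      then show "norm (?w \<xi> * norm (fourier (\<lambda>x. of_real (u x)) \<xi>)) \<le>
       norm (A * exp 1 * (?w \<xi> * exp (- 1 * (2 * pi * norm \<xi>)\<^sup>2)) + norm \<xi> ^ 0 * norm (fourier (\<lambda>x. of_real (u x)) \<xi>))"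
        using A0 by (simp add: abs_mult)
    qed
  qed measurable
qed

text \<open>A Gaussian factor of time t makes Fubini applicable and turns the inverse transform into
  the heat mean of \<open>u\<close>. As t tends to 0, the frequency side converges by domination and
  the heat means converge to \<open>u\<close> by the Lipschitz bound.\<close>

lemma fourier_inversion:
  fixes u :: "real^'n::finite \<Rightarrow> real"
  assumes u: "u \<in> schwartz_class"
  shows "inv_fourier (fourier (\<lambda>x. of_real (u x))) x = of_real (u x)"
proof -
  note [measurable] = schwartz_measurable[OF u]
  let ?F = "fourier (\<lambda>x. of_real (u x))" and ?e = "\<lambda>\<xi>. exp (2 * of_real pi * \<i> * of_real (x \<bullet> \<xi>)) :: complex"
  obtain L where L: "L \<ge> 0" "\<And>x y. \<bar>u x - u y\<bar> \<le> L * norm (x - y)" using schwartz_lipschitz[OF u] by blast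
  have Fi: "integrable lborel (\<lambda>\<xi>. norm (?F \<xi>))" using integrable_fourier_weight[OF u, of 0] by simp
  have ui: "integrable lborel u" by (rule schwartz_integrable[OF u])
  have i2: "integrable lborel (\<lambda>y. heat t (x - y) * u y)" if t: "t > 0" for t
  proof (rule Bochner_Integration.integrable_bound[of _ "\<lambda>y. (1 / sqrt t ^ CARD('n)) * u y"])
    have "norm (heat t (x - y) * u y) \<le> norm ((1 / sqrt t ^ CARD('n)) * u y)" for y
      using mult_right_mono[OF heat_le[OF t, of "x - y"], of "\<bar>u y\<bar>"] t by (simp add: abs_mult)
    then show "AE y in lborel. norm (heat t (x - y) * u y) \<le> norm ((1 / sqrt t ^ CARD('n)) * u y)" by simp
  qed (use ui in auto)
  have P: "(LINT \<xi>|lborel. of_real (exp (- t * (2 * pi * norm \<xi>)\<^sup>2)) * (?F \<xi> * ?e \<xi>)) = of_real (LINT y|lborel. heat t (x - y) * u y)" if t: "t > 0" for t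
  proof -
    define f where "f \<xi> y = complex_of_real (exp (- t * (2 * pi * norm \<xi>)\<^sup>2)) * ?e \<xi> * (of_real (u y) * exp (- 2 * of_real pi * \<i> * of_real (y \<bullet> \<xi>)))" for \<xi> y :: "real^'n"
    have gi: "integrable lborel (\<lambda>\<xi>::real^'n. exp (- t * (2 * pi * norm \<xi>)\<^sup>2))"
      using has_bochner_integral_Re[OF heat_inv_fourier[OF t, of 0]] by (auto simp: has_bochner_integral_iff)
    have nf: "norm (f \<xi> y) = exp (- t * (2 * pi * norm \<xi>)\<^sup>2) * \<bar>u y\<bar>" for \<xi> y by (simp add: f_def norm_mult)
    have F: "integrable (lborel \<Otimes>\<^sub>M lborel) (case_prod f)"
    proof (rule lborel_pair.Fubini_integrable)
      show "case_prod f \<in> borel_measurable (lborel \<Otimes>\<^sub>M lborel)" unfolding f_def by measurable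
      show "integrable lborel (\<lambda>\<xi>. LINT y|lborel. norm (case_prod f (\<xi>, y)))" using gi by (simp add: nf)
      have "integrable lborel (f \<xi>)" for \<xi>
        by (rule Bochner_Integration.integrable_bound[of _ u]) (use ui nf t in \<open>auto simp: f_def[abs_def] norm_mult intro!: AE_I2 mult_left_le_one_le\<close>)
      then show "AE \<xi> in lborel. integrable lborel (\<lambda>y. case_prod f (\<xi>, y))" by simp
    qed
    have "(LINT \<xi>|lborel. of_real (exp (- t * (2 * pi * norm \<xi>)\<^sup>2)) * (?F \<xi> * ?e \<xi>)) = (LINT \<xi>|lborel. (LINT y|lborel. f \<xi> y))"
    proof -
      have "(LINT y|lborel. f \<xi> y) = of_real (exp (- t * (2 * pi * norm \<xi>)\<^sup>2)) * ?e \<xi> * ?F \<xi>" for \<xi>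
        unfolding f_def fourier_def by (rule integral_mult_right_zero)
      then show ?thesis by (simp only: mult_ac)
    qed
    also have "\<dots> = (LINT y|lborel. (LINT \<xi>|lborel. f \<xi> y))" by (rule lborel_pair.Fubini_integral[OF F, symmetric])
    also have "\<dots> = (LINT y|lborel. of_real (heat t (x - y)) * of_real (u y))"
    proof (intro Bochner_Integration.integral_cong refl)
      fix y
      have "(LINT \<xi>|lborel. f \<xi> y) = (LINT \<xi>|lborel. (exp (- t * (2 * pi * norm \<xi>)\<^sup>2) * exp (2 * of_real pi * \<i> * of_real ((x - y) \<bullet> \<xi>))) * of_real (u y))"
        unfolding f_def by (intro Bochner_Integration.integral_cong refl) (simp add: inner_diff_left ring_distribs exp_diff exp_minus field_simps)
      also have "\<dots> = of_real (heat t (x - y)) * of_real (u y)"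
        using has_bochner_integral_mult_left[OF heat_inv_fourier[OF t, of "x - y"], of "of_real (u y)"] by (simp only: has_bochner_integral_iff)
      finally show "(LINT \<xi>|lborel. f \<xi> y) = of_real (heat t (x - y)) * of_real (u y)" .
    qed
    also have "\<dots> = of_real (LINT y|lborel. heat t (x - y) * u y)"
      unfolding of_real_mult[symmetric] by (rule integral_of_real[OF i2[OF t]])
    finally show ?thesis .
  qed
  define T where "T i = 1 / real (Suc i)" for i
  have T: "T i > 0" "T \<longlonglongrightarrow> 0" for i unfolding T_def using LIMSEQ_inverse_real_of_nat by (auto simp: inverse_eq_divide)
  have "(\<lambda>i. LINT \<xi>|lborel. of_real (exp (- T i * (2 * pi * norm \<xi>)\<^sup>2)) * (?F \<xi> * ?e \<xi>)) \<longlonglongrightarrow> (LINT \<xi>|lborel. ?F \<xi> * ?e \<xi>)"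
  proof (rule integral_dominated_convergence[OF _ _ Fi])
    show "AE \<xi> in lborel. (\<lambda>i. of_real (exp (- T i * (2 * pi * norm \<xi>)\<^sup>2)) * (?F \<xi> * ?e \<xi>)) \<longlonglongrightarrow> ?F \<xi> * ?e \<xi>"
    proof (rule AE_I2)
      fix \<xi> :: "real^'n"
      have "(\<lambda>i. of_real (exp (- T i * (2 * pi * norm \<xi>)\<^sup>2)) * (?F \<xi> * ?e \<xi>)) \<longlonglongrightarrow> of_real (exp (- 0 * (2 * pi * norm \<xi>)\<^sup>2)) * (?F \<xi> * ?e \<xi>)"
        by (intro tendsto_intros T)
      then show "(\<lambda>i. of_real (exp (- T i * (2 * pi * norm \<xi>)\<^sup>2)) * (?F \<xi> * ?e \<xi>)) \<longlonglongrightarrow> ?F \<xi> * ?e \<xi>" by simp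
    qed
    show "AE \<xi> in lborel. norm (of_real (exp (- T i * (2 * pi * norm \<xi>)\<^sup>2)) * (?F \<xi> * ?e \<xi>)) \<le> norm (?F \<xi>)" for i
      using T(1)[of i] by (intro AE_I2) (auto simp: norm_mult intro!: mult_left_le_one_le)
  qed measurable
  then have 1: "(\<lambda>i. of_real (LINT y|lborel. heat (T i) (x - y) * u y)) \<longlonglongrightarrow> inv_fourier ?F x"
    by (simp only: P[OF T(1)] inv_fourier_def)
  \<comment> \<open>The error is at most the Lipschitz constant times the first absolute moment of
    the kernel, which \<open>norm_heat_le\<close> shows to be of order sqrt t.\<close>
  have d: "\<bar>(LINT y|lborel. heat t (x - y) * u y) - u x\<bar> \<le> L * (2 * sqrt 2 ^ CARD('n) * sqrt t)" if t: "t > 0" for t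
  proof -
    have h1: "has_bochner_integral lborel (\<lambda>y. heat t (x - y) * u x) (1 * u x)"
      by (intro has_bochner_integral_mult_left has_bochner_integral_reflect heat_integral t)
    have h3: "has_bochner_integral lborel (\<lambda>y. L * (2 * sqrt 2 ^ CARD('n) * sqrt t) * heat (2 * t) (x - y)) (L * (2 * sqrt 2 ^ CARD('n) * sqrt t) * 1)"
      using t by (intro has_bochner_integral_mult_right has_bochner_integral_reflect heat_integral) auto
    have "(LINT y|lborel. heat t (x - y) * u y) - u x = (LINT y|lborel. heat t (x - y) * u y - heat t (x - y) * u x)"
      using h1 i2[OF t] by (simp add: has_bochner_integral_iff)
    also have "\<bar>\<dots>\<bar> \<le> (LINT y|lborel. L * (2 * sqrt 2 ^ CARD('n) * sqrt t) * heat (2 * t) (x - y))"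
      unfolding real_norm_def[symmetric]
    proof (rule Bochner_Integration.integral_norm_bound_integral)
      fix y
      have "norm (heat t (x - y) * u y - heat t (x - y) * u x) = heat t (x - y) * \<bar>u x - u y\<bar>"
        using t by (simp add: abs_mult abs_minus_commute flip: right_diff_distrib)
      also have "\<dots> \<le> heat t (x - y) * (L * norm (x - y))" by (intro mult_left_mono L) (use t in auto)
      also have "\<dots> = L * (norm (x - y) * heat t (x - y))" by simp
      also have "\<dots> \<le> L * (2 * sqrt 2 ^ CARD('n) * sqrt t * heat (2 * t) (x - y))" by (intro mult_left_mono norm_heat_le t L)
      finally show "norm (heat t (x - y) * u y - heat t (x - y) * u x) \<le> L * (2 * sqrt 2 ^ CARD('n) * sqrt t) * heat (2 * t) (x - y)" by (simp add: mult_ac)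
    qed (use h1 h3 i2[OF t] in \<open>auto simp: has_bochner_integral_iff\<close>)
    also have "\<dots> = L * (2 * sqrt 2 ^ CARD('n) * sqrt t)" using h3 by (simp only: has_bochner_integral_iff mult_1_right)
    finally show ?thesis .
  qed
  have "(\<lambda>i. L * (2 * sqrt 2 ^ CARD('n) * sqrt (T i))) \<longlonglongrightarrow> L * (2 * sqrt 2 ^ CARD('n) * sqrt 0)"
    by (intro tendsto_intros T)
  then have l: "(\<lambda>i. L * (2 * sqrt 2 ^ CARD('n) * sqrt (T i))) \<longlonglongrightarrow> 0" by (simp only: real_sqrt_zero mult_zero_right)
  have "(\<lambda>i. (LINT y|lborel. heat (T i) (x - y) * u y) - u x) \<longlonglongrightarrow> 0"
    by (rule Lim_null_comparison[OF always_eventually l], unfold real_norm_def) (rule allI, rule d[OF T(1)])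
  then have "(\<lambda>i. of_real (LINT y|lborel. heat (T i) (x - y) * u y) :: complex) \<longlonglongrightarrow> of_real (u x)"
    by (intro tendsto_of_real) (simp add: LIM_zero_iff)
  with 1 show ?thesis using LIMSEQ_unique by blast
qed

section \<open>The potential of the fractional gradient\<close>

lemma norm_exp_imag_diff_le: "norm (exp (2 * of_real pi * \<i> * of_real r) - 1) \<le> 2 * pi * \<bar>r\<bar>"
  using iexp_approx1[of "2 * pi * r" 0] by (simp add: abs_mult mult_ac)

text \<open>Differentiation under the integral. The inequality |exp(2 pi i r) - 1| <= 2 pi |r|
  bounds all quotients by the first moment of the symbol; the limit is taken along sequences, where
  dominated convergence applies.\<close>

lemma inv_fourier_directional:
  fixes M :: "real^'n::finite \<Rightarrow> complex"
  assumes M: "integrable lborel M" and M': "integrable lborel (\<lambda>\<xi>. norm \<xi> * norm (M \<xi>))"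
  shows "((\<lambda>h. inv_fourier M (y + h *\<^sub>R axis j 1)) has_vector_derivative
    inv_fourier (\<lambda>\<xi>. (2 * of_real pi * \<i> * of_real (\<xi> $ j)) * M \<xi>) y) (at 0)"
proof -
  let ?e = "\<lambda>y \<xi>. exp (2 * of_real pi * \<i> * of_real (y \<bullet> \<xi>)) :: complex"
  let ?a = "axis j 1 :: real^'n"
  let ?D = "inv_fourier (\<lambda>\<xi>. (2 * of_real pi * \<i> * of_real (\<xi> $ j)) * M \<xi>) y"
  have [measurable]: "M \<in> borel_measurable borel" using M by auto
  have Me: "integrable lborel (\<lambda>\<xi>. M \<xi> * ?e y \<xi>)" for y
    by (rule Bochner_Integration.integrable_bound[OF M]) (auto simp: norm_mult)
  have "((\<lambda>h. (inv_fourier M (y + h *\<^sub>R ?a) - inv_fourier M y) /\<^sub>R h) \<longlongrightarrow> ?D) (at 0)"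
    unfolding tendsto_at_iff_sequentially
  proof (intro allI impI)
    fix X :: "nat \<Rightarrow> real" assume X0: "\<forall>i. X i \<in> UNIV - {0}" and X: "X \<longlonglongrightarrow> 0"
    let ?q = "\<lambda>i \<xi>. (M \<xi> * ?e (y + X i *\<^sub>R ?a) \<xi> - M \<xi> * ?e y \<xi>) /\<^sub>R X i"
    have lim: "(\<lambda>i. LINT \<xi>|lborel. ?q i \<xi>) \<longlonglongrightarrow> (LINT \<xi>|lborel. (2 * of_real pi * \<i> * of_real (\<xi> $ j)) * M \<xi> * ?e y \<xi>)"
    proof (rule integral_dominated_convergence[where w="\<lambda>\<xi>. 2 * pi * (norm \<xi> * norm (M \<xi>))"])
      show "integrable lborel (\<lambda>\<xi>. 2 * pi * (norm \<xi> * norm (M \<xi>)))" using M' by simp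
      show "AE \<xi> in lborel. (\<lambda>i. ?q i \<xi>) \<longlonglongrightarrow> (2 * of_real pi * \<i> * of_real (\<xi> $ j)) * M \<xi> * ?e y \<xi>"
      proof (rule AE_I2)
        fix \<xi> :: "real^'n"
        have "((\<lambda>h. ?e (y + h *\<^sub>R ?a) \<xi>) has_vector_derivative (2 * of_real pi * \<i> * of_real (\<xi> $ j)) * ?e y \<xi>) (at 0)"
          by (rule exp_imag_directional)
        then have "((\<lambda>h. (?e (y + h *\<^sub>R ?a) \<xi> - ?e y \<xi>) /\<^sub>R h) \<longlongrightarrow> (2 * of_real pi * \<i> * of_real (\<xi> $ j)) * ?e y \<xi>) (at 0)"
          by (simp add: has_vector_derivative_iff_quotient)
        then have "((\<lambda>h. (?e (y + h *\<^sub>R ?a) \<xi> - ?e y \<xi>) /\<^sub>R h) \<circ> X) \<longlonglongrightarrow> (2 * of_real pi * \<i> * of_real (\<xi> $ j)) * ?e y \<xi>"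
          using X0 X unfolding tendsto_at_iff_sequentially by blast
        then have "(\<lambda>i. M \<xi> * ((?e (y + X i *\<^sub>R ?a) \<xi> - ?e y \<xi>) /\<^sub>R X i)) \<longlonglongrightarrow> M \<xi> * ((2 * of_real pi * \<i> * of_real (\<xi> $ j)) * ?e y \<xi>)"
          by (intro tendsto_mult_left) (simp add: o_def)
        then show "(\<lambda>i. ?q i \<xi>) \<longlonglongrightarrow> (2 * of_real pi * \<i> * of_real (\<xi> $ j)) * M \<xi> * ?e y \<xi>"
          by (simp add: algebra_simps scaleR_diff_right)
      qed
      show "AE \<xi> in lborel. norm (?q i \<xi>) \<le> 2 * pi * (norm \<xi> * norm (M \<xi>))" for i
      proof (rule AE_I2)
        fix \<xi> :: "real^'n"
        have "?e (y + X i *\<^sub>R ?a) \<xi> = ?e y \<xi> * exp (2 * of_real pi * \<i> * of_real (X i * \<xi> $ j))"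
          by (simp add: inner_add_left inner_axis' ring_distribs flip: exp_add)
        then have "M \<xi> * ?e (y + X i *\<^sub>R ?a) \<xi> - M \<xi> * ?e y \<xi> = M \<xi> * ?e y \<xi> * (exp (2 * of_real pi * \<i> * of_real (X i * \<xi> $ j)) - 1)"
          by (simp add: algebra_simps)
        then have "norm (M \<xi> * ?e (y + X i *\<^sub>R ?a) \<xi> - M \<xi> * ?e y \<xi>) = norm (M \<xi>) * norm (exp (2 * of_real pi * \<i> * of_real (X i * \<xi> $ j)) - 1)"
          by (simp only: norm_mult norm_exp_imag mult_1_right)
        also have "\<dots> \<le> norm (M \<xi>) * (2 * pi * \<bar>X i * \<xi> $ j\<bar>)" by (intro mult_left_mono norm_exp_imag_diff_le) auto
        also have "\<dots> = \<bar>X i\<bar> * (2 * pi * (\<bar>\<xi> $ j\<bar> * norm (M \<xi>)))" by (simp add: abs_mult)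
        also have "\<dots> \<le> \<bar>X i\<bar> * (2 * pi * (norm \<xi> * norm (M \<xi>)))"
          by (intro mult_left_mono mult_right_mono component_le_norm_cart) auto
        finally have "norm (M \<xi> * ?e (y + X i *\<^sub>R ?a) \<xi> - M \<xi> * ?e y \<xi>) / \<bar>X i\<bar> \<le> 2 * pi * (norm \<xi> * norm (M \<xi>))"
          using X0 by (subst pos_divide_le_eq) (auto simp: mult.commute)
        then show "norm (?q i \<xi>) \<le> 2 * pi * (norm \<xi> * norm (M \<xi>))" by (simp add: divide_inverse_commute)
      qed
    qed measurable
    have q: "(LINT \<xi>|lborel. ?q i \<xi>) = (inv_fourier M (y + X i *\<^sub>R ?a) - inv_fourier M y) /\<^sub>R X i" for i
      unfolding inv_fourier_def using Me[of y] Me[of "y + X i *\<^sub>R ?a"] by simp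
    show "((\<lambda>h. (inv_fourier M (y + h *\<^sub>R ?a) - inv_fourier M y) /\<^sub>R h) \<circ> X) \<longlonglongrightarrow> ?D"
      using lim unfolding q by (simp only: o_def inv_fourier_def)
  qed
  then show ?thesis by (simp add: has_vector_derivative_iff_quotient)
qed

text \<open>The forward counterpart of \<open>dheat_inv_fourier\<close>, this time with the
  derivative on the kernel. Through it a plane wave convolved with \<open>dheat\<close> becomes a
  multiple of itself.\<close>

lemma dheat_fourier:
  fixes \<eta> :: "real^'n::finite" assumes t: "t > 0"
  shows "has_bochner_integral lborel (\<lambda>x. of_real (dheat t j x) * exp (\<i> * of_real (x \<bullet> \<eta>))) (- \<i> * of_real (\<eta> $ j) * exp (- t * (norm \<eta>)\<^sup>2))"
proof -
  let ?e = "\<lambda>x. exp (\<i> * of_real (x \<bullet> \<eta>)) :: complex"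
  let ?C = "2 * sqrt 2 ^ CARD('n) / sqrt t" and ?B = "sqrt 2 ^ CARD('n) * \<bar>\<eta> $ j\<bar>"
  have hf: "has_bochner_integral lborel (\<lambda>x. of_real (heat t x) * ?e x) (complex_of_real (exp (- t * (norm \<eta>)\<^sup>2)))"
    using heat_fourier[OF t, of \<eta>] by (simp only: of_real_exp)
  have "has_bochner_integral lborel (\<lambda>x. of_real (dheat t j x) * ?e x + of_real (heat t x) * ((\<i> * of_real (\<eta> $ j)) * ?e x)) 0"
  proof (rule integral_directional_derivative_eq_0[where f="\<lambda>x. of_real (heat t x) * ?e x" and e="axis j 1"
        and g="\<lambda>x. (?C + ?B) * (exp (1 / (4 * (2 * t))) * sqrt 2 ^ CARD('n) * heat (2 * (2 * t)) x)"])
    show "integrable lborel (\<lambda>x. of_real (heat t x) * ?e x)" using hf by (simp add: has_bochner_integral_iff)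
    show "integrable lborel (\<lambda>x::real^'n. (?C + ?B) * (exp (1 / (4 * (2 * t))) * sqrt 2 ^ CARD('n) * heat (2 * (2 * t)) x))"
      using t by (intro integrable_mult_right heat_integrable) auto
    fix y :: "real^'n" and h :: real
    show "((\<lambda>h. of_real (heat t (y + h *\<^sub>R axis j 1)) * ?e (y + h *\<^sub>R axis j 1)) has_vector_derivative
       of_real (dheat t j y) * ?e y + of_real (heat t y) * ((\<i> * of_real (\<eta> $ j)) * ?e y)) (at 0)"
    proof -
      have 1: "((\<lambda>h. of_real (heat t (y + h *\<^sub>R axis j 1)) :: complex) has_vector_derivative of_real (dheat t j y)) (at 0)"
        using has_vector_derivative_of_real heat_directional[OF t] has_real_derivative_iff_has_vector_derivative by blast
      show ?thesis
        by (rule has_vector_derivative_eq_rhs, rule has_vector_derivative_mult[OF 1 exp_imag_directional[of 1, simplified]]) simp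
    qed
    assume "\<bar>h\<bar> \<le> 1"
    let ?y = "y + h *\<^sub>R axis j 1"
    have "norm (of_real (dheat t j ?y) * ?e ?y + of_real (heat t ?y) * ((\<i> * of_real (\<eta> $ j)) * ?e ?y))
       \<le> \<bar>dheat t j ?y\<bar> + heat t ?y * \<bar>\<eta> $ j\<bar>"
      using t by (intro order.trans[OF norm_triangle_ineq]) (simp add: norm_mult)
    also have "\<dots> \<le> ?C * heat (2 * t) ?y + sqrt 2 ^ CARD('n) * heat (2 * t) ?y * \<bar>\<eta> $ j\<bar>"
      by (intro add_mono mult_right_mono dheat_le heat_le_double t) auto
    also have "\<dots> = (?C + ?B) * heat (2 * t) ?y" by (simp add: algebra_simps)
    also have "\<dots> \<le> (?C + ?B) * (exp (1 / (4 * (2 * t))) * sqrt 2 ^ CARD('n) * heat (2 * (2 * t)) y)"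
      using t \<open>\<bar>h\<bar> \<le> 1\<close> by (intro mult_left_mono heat_shift_le) auto
    finally show "norm (of_real (dheat t j ?y) * ?e ?y + of_real (heat t ?y) * ((\<i> * of_real (\<eta> $ j)) * ?e ?y)) \<le> \<dots>" .
  qed
  from has_bochner_integral_diff[OF this has_bochner_integral_mult_right[OF hf, of "\<i> * of_real (\<eta> $ j)"]]
  show ?thesis by (simp add: algebra_simps)
qed

text \<open>Here \<open>g\<close> is minus the fractional gradient and \<open>w\<close> is the Riesz potential \<open>I\<^bsub>1-s\<^esub> u\<close>.\<close>
lemma fractional_gradient_potential:
  fixes u :: "real^'n::finite \<Rightarrow> real"
  assumes u: "u \<in> schwartz_class" and s: "0 < s" "s < 1"
  obtains w :: "real^'n \<Rightarrow> real" and g :: "'n \<Rightarrow> real^'n \<Rightarrow> real" and B :: real where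
    "w \<in> borel_measurable borel" "\<And>j. g j \<in> borel_measurable borel"
    "\<And>x. \<bar>w x\<bar> \<le> B" "\<And>j x. \<bar>g j x\<bar> \<le> B"
    "\<And>y j. ((\<lambda>h. w (y + h *\<^sub>R axis j 1)) has_vector_derivative g j y) (at 0)"
    "\<And>j x. \<bar>g j x\<bar> \<le> norm (nabla_minus s u j x)"
    "\<And>x. ennreal \<bar>w x\<bar> \<le> (\<integral>\<^sup>+t\<in>{0<..}. ennreal \<bar>\<Sum>j\<in>UNIV. LINT y|lborel. dheat t j (x - y) * g j y\<bar> \<partial>lborel)"
    "\<And>x. ennreal (Gamma ((1 + s) / 2) * \<bar>u x\<bar>) \<le>
       (\<integral>\<^sup>+t\<in>{0<..}. ennreal (t powr ((s - 1) / 2) * \<bar>\<Sum>j\<in>UNIV. LINT y|lborel. dheat t j (x - y) * g j y\<bar>) \<partial>lborel)"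
proof -
  note [measurable] = schwartz_measurable[OF u]
  let ?F = "fourier (\<lambda>x. of_real (u x))"
  define z where "z = (1 - s) / 2"
  have z: "0 < z" "z < 1/2" "s - 1 = - 2 * z" using s by (auto simp: z_def)
  \<comment> \<open>The symbol of \<open>w\<close>. Its singularity at the origin has order 1 - s <
    1 and is therefore integrable.\<close>
  define M where "M \<xi> = of_real ((2 * pi * norm \<xi>) powr (s - 1)) * ?F \<xi>" for \<xi>
  have [measurable]: "M \<in> borel_measurable borel" unfolding M_def by measurable
  define S where "S j \<xi> = (- 2 * of_real pi * \<i> * of_real (\<xi> $ j)) * M \<xi>" for j \<xi>
  have [measurable]: "S j \<in> borel_measurable borel" for j unfolding S_def by measurable
  have Mn: "integrable lborel (\<lambda>\<xi>. norm (M \<xi>))"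
    using integrable_fourier_singular[OF u z(1,2)] unfolding M_def norm_mult norm_of_real z(3) by simp
  have M: "integrable lborel M" by (rule Bochner_Integration.integrable_bound[OF Mn]) auto
  have M': "integrable lborel (\<lambda>\<xi>. norm \<xi> * norm (M \<xi>))"
  proof (rule Bochner_Integration.integrable_bound)
    show "integrable lborel (\<lambda>\<xi>. norm (M \<xi>) + norm \<xi> ^ 1 * norm (?F \<xi>))"
      by (intro Bochner_Integration.integrable_add Mn integrable_fourier_weight u)
    have "norm \<xi> * norm (M \<xi>) \<le> norm (M \<xi>) + norm \<xi> ^ 1 * norm (?F \<xi>)" for \<xi> :: "real^'n"
    proof (cases "norm \<xi> \<le> 1")
      case True
      then have "norm \<xi> * norm (M \<xi>) \<le> norm (M \<xi>)" by (intro mult_left_le_one_le) auto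
      then show ?thesis by (simp add: add_increasing2)
    next
      case False
      then have "1 \<le> 2 * pi * norm \<xi>" using pi_ge_two mult_mono[of 1 "2 * pi" 1 "norm \<xi>"] by simp
      then have "(2 * pi * norm \<xi>) powr (s - 1) \<le> 1 powr (s - 1)" using s by (intro powr_mono2') auto
      then have "norm (M \<xi>) \<le> norm (?F \<xi>)" by (auto simp: M_def norm_mult intro!: mult_left_le_one_le)
      then have "norm \<xi> * norm (M \<xi>) \<le> norm \<xi> * norm (?F \<xi>)" by (intro mult_left_mono) auto
      then show ?thesis by (simp add: add_increasing)
    qed
    then show "AE \<xi> in lborel. norm (norm \<xi> * norm (M \<xi>)) \<le> norm (norm (M \<xi>) + norm \<xi> ^ 1 * norm (?F \<xi>))" by simp
  qed measurable
  have Sn: "norm (S j \<xi>) \<le> 2 * pi * (norm \<xi> * norm (M \<xi>))" for j \<xi>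
    using mult_right_mono[OF component_le_norm_cart[of \<xi> j], of "norm (M \<xi>)"] by (simp add: S_def norm_mult)
  have Si: "integrable lborel (S j)" for j
    by (rule Bochner_Integration.integrable_bound[of _ "\<lambda>\<xi>. 2 * pi * (norm \<xi> * norm (M \<xi>))"]) (use M' Sn in auto)
  have nab: "nabla_minus s u j = inv_fourier (S j)" for j
    unfolding nabla_minus_def S_def M_def by (simp add: mult.assoc)
  define w where "w x = Re (inv_fourier M x)" for x
  \<comment> \<open>Taking the real part can only lower the modulus, which is the direction required
    for comparison with the seminorm.\<close>
  define g where "g j x = - Re (nabla_minus s u j x)" for j x
  have ifb: "norm (inv_fourier N x) \<le> (LINT \<xi>|lborel. norm (N \<xi>))" for N x
    unfolding inv_fourier_def by (rule order.trans[OF integral_norm_bound]) (simp add: norm_mult)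
  define B where "B = (LINT \<xi>|lborel. norm (M \<xi>)) + (\<Sum>j\<in>UNIV. LINT \<xi>|lborel. norm (S j \<xi>))"
  have nn: "(LINT \<xi>|lborel. norm (M \<xi>)) \<ge> 0" "(LINT \<xi>|lborel. norm (S j \<xi>)) \<ge> 0" for j by auto
  have wB: "\<bar>w x\<bar> \<le> B" for x
  proof -
    have "(\<Sum>j\<in>UNIV. LINT \<xi>|lborel. norm (S j \<xi>)) \<ge> 0" by (intro sum_nonneg nn)
    then show ?thesis unfolding w_def B_def using abs_Re_le_cmod[of "inv_fourier M x"] ifb[of M x] by linarith
  qed
  have gB: "\<bar>g j x\<bar> \<le> B" for j x
  proof -
    have "\<bar>g j x\<bar> \<le> (LINT \<xi>|lborel. norm (S j \<xi>))"
      unfolding g_def nab using abs_Re_le_cmod[of "inv_fourier (S j) x"] ifb[of "S j" x] by simp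
    also have "\<dots> \<le> (\<Sum>j\<in>UNIV. LINT \<xi>|lborel. norm (S j \<xi>))" by (intro member_le_sum nn) auto
    finally show ?thesis unfolding B_def using nn(1) by linarith
  qed
  have wd: "((\<lambda>h. w (y + h *\<^sub>R axis j 1)) has_vector_derivative g j y) (at 0)" for y j
  proof -
    have "((\<lambda>h. Re (inv_fourier M (y + h *\<^sub>R axis j 1))) has_vector_derivative Re (inv_fourier (\<lambda>\<xi>. (2 * of_real pi * \<i> * of_real (\<xi> $ j)) * M \<xi>) y)) (at 0)"
      by (rule bounded_linear.has_vector_derivative[OF bounded_linear_Re inv_fourier_directional[OF M M']])
    moreover have "inv_fourier (\<lambda>\<xi>. (2 * of_real pi * \<i> * of_real (\<xi> $ j)) * M \<xi>) y = - nabla_minus s u j y"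
      unfolding nab S_def inv_fourier_def by simp
    ultimately show ?thesis by (simp add: w_def g_def)
  qed
  \<comment> \<open>The symbol of minus the Laplacian of \<open>w\<close>, times the plane wave at
    x. Multiplication by (2 pi |\<xi>|)^(-2\<zeta>) gives back \<open>w\<close> for \<zeta> = 1 and
    \<open>u\<close> for \<zeta> = (1 + s)/2.\<close>
  define G where "G x \<xi> = of_real ((2 * pi * norm \<xi>)\<^sup>2) * M \<xi> * exp (2 * of_real pi * \<i> * of_real (x \<bullet> \<xi>))" for x \<xi>
  have [measurable]: "G x \<in> borel_measurable borel" for x unfolding G_def by measurable
  let ?\<Phi> = "\<lambda>t x. \<Sum>j\<in>UNIV. LINT y|lborel. dheat t j (x - y) * g j y"
  \<comment> \<open>The divergence of the smoothed gradient is the Laplacian of the smoothed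
    potential, computed on the Fourier side.\<close>
  have Phi: "?\<Phi> t x = Re (- (LINT \<xi>|lborel. exp (- t * (2 * pi * norm \<xi>)\<^sup>2) *\<^sub>R G x \<xi>))" if t: "t > 0" for t x
  proof -
    let ?T = "\<lambda>j \<xi>. of_real ((2 * pi * \<xi> $ j)\<^sup>2) * (exp (- t * (2 * pi * norm \<xi>)\<^sup>2) *\<^sub>R (M \<xi> * exp (2 * of_real pi * \<i> * of_real (x \<bullet> \<xi>))))"
    let ?C = "2 * sqrt 2 ^ CARD('n) / sqrt t"
    have dn: "integrable lborel (\<lambda>y. \<bar>dheat t j (x - y)\<bar>)" for j
      by (rule Bochner_Integration.integrable_bound[of _ "\<lambda>y. ?C * heat (2 * t) (x - y)"])
         (use t dheat_le[OF t] in \<open>auto intro!: AE_I2 order.trans[OF _ abs_ge_self]\<close>)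
    have j: "integrable lborel (?T j)" "(LINT y|lborel. of_real (dheat t j (x - y)) * nabla_minus s u j y) = (LINT \<xi>|lborel. ?T j \<xi>)" for j
    proof -
      define f where "f \<xi> y = S j \<xi> * (of_real (dheat t j (x - y)) * exp (2 * of_real pi * \<i> * of_real (y \<bullet> \<xi>)))" for \<xi> y
      have nf: "norm (f \<xi> y) = norm (S j \<xi>) * \<bar>dheat t j (x - y)\<bar>" for \<xi> y by (simp add: f_def norm_mult)
      have fi: "has_bochner_integral lborel (f \<xi>) (?T j \<xi>)" for \<xi>
      proof -
        have "has_bochner_integral lborel (\<lambda>y. of_real (dheat t j (x - y)) * exp (\<i> * of_real ((x - y) \<bullet> ((- 2 * pi) *\<^sub>R \<xi>))))
          (- \<i> * of_real (((- 2 * pi) *\<^sub>R \<xi>) $ j) * exp (- t * (norm ((- 2 * pi) *\<^sub>R \<xi>))\<^sup>2))"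
          by (rule has_bochner_integral_reflect[OF dheat_fourier[OF t]])
        from has_bochner_integral_mult_left[OF this, of "exp (2 * of_real pi * \<i> * of_real (x \<bullet> \<xi>))"]
        have "has_bochner_integral lborel (\<lambda>y. of_real (dheat t j (x - y)) * exp (2 * of_real pi * \<i> * of_real (y \<bullet> \<xi>)))
          ((2 * of_real pi * \<i> * of_real (\<xi> $ j)) * of_real (exp (- t * (2 * pi * norm \<xi>)\<^sup>2)) * exp (2 * of_real pi * \<i> * of_real (x \<bullet> \<xi>)))"
          by (simp add: mult.assoc inner_diff_left ring_distribs mult_ac flip: exp_add)
        from has_bochner_integral_mult_right[OF this, of "S j \<xi>"] show ?thesis
          unfolding f_def S_def by (simp add: scaleR_conv_of_real power2_eq_square mult_ac)
      qed
      have F: "integrable (lborel \<Otimes>\<^sub>M lborel) (case_prod f)"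
      proof (rule lborel_pair.Fubini_integrable)
        show "case_prod f \<in> borel_measurable (lborel \<Otimes>\<^sub>M lborel)" unfolding f_def by measurable
        show "integrable lborel (\<lambda>\<xi>. LINT y|lborel. norm (case_prod f (\<xi>, y)))" using Si[of j] by (simp add: nf)
        show "AE \<xi> in lborel. integrable lborel (\<lambda>y. case_prod f (\<xi>, y))" using fi by (simp add: has_bochner_integral_iff)
      qed
      show "integrable lborel (?T j)"
        using lborel_pair.integrable_fst[OF F] by (simp only: has_bochner_integral_integral_eq[OF fi])
      have "(LINT y|lborel. of_real (dheat t j (x - y)) * nabla_minus s u j y) = (LINT y|lborel. (LINT \<xi>|lborel. f \<xi> y))"
      proof (intro Bochner_Integration.integral_cong refl)
        fix y
        have "(LINT \<xi>|lborel. f \<xi> y) = (LINT \<xi>|lborel. of_real (dheat t j (x - y)) * (S j \<xi> * exp (2 * of_real pi * \<i> * of_real (y \<bullet> \<xi>))))"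
          unfolding f_def by (simp only: mult_ac)
        also have "\<dots> = of_real (dheat t j (x - y)) * nabla_minus s u j y"
          unfolding nab inv_fourier_def by (rule integral_mult_right_zero)
        finally show "of_real (dheat t j (x - y)) * nabla_minus s u j y = (LINT \<xi>|lborel. f \<xi> y)" ..
      qed
      also have "\<dots> = (LINT \<xi>|lborel. (LINT y|lborel. f \<xi> y))" by (rule lborel_pair.Fubini_integral[OF F])
      also have "\<dots> = (LINT \<xi>|lborel. ?T j \<xi>)" by (simp only: has_bochner_integral_integral_eq[OF fi])
      finally show "(LINT y|lborel. of_real (dheat t j (x - y)) * nabla_minus s u j y) = (LINT \<xi>|lborel. ?T j \<xi>)" .
    qed
    have r: "(LINT y|lborel. dheat t j (x - y) * g j y) = - Re (LINT y|lborel. of_real (dheat t j (x - y)) * nabla_minus s u j y)" for j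
    proof -
      have "integrable lborel (\<lambda>y. of_real (dheat t j (x - y)) * nabla_minus s u j y)"
      proof (rule Bochner_Integration.integrable_bound[of _ "\<lambda>y. (LINT \<xi>|lborel. norm (S j \<xi>)) * \<bar>dheat t j (x - y)\<bar>"])
        have "norm (of_real (dheat t j (x - y)) * nabla_minus s u j y) \<le> (LINT \<xi>|lborel. norm (S j \<xi>)) * \<bar>dheat t j (x - y)\<bar>" for y
          using mult_right_mono[OF ifb[of "S j" y], of "\<bar>dheat t j (x - y)\<bar>"] by (simp add: nab norm_mult mult.commute)
        then show "AE y in lborel. norm (of_real (dheat t j (x - y)) * nabla_minus s u j y) \<le> norm ((LINT \<xi>|lborel. norm (S j \<xi>)) * \<bar>dheat t j (x - y)\<bar>)"
          by (auto intro!: AE_I2 order.trans[OF _ abs_ge_self])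
      qed (use dn in auto)
      then have "(LINT y|lborel. Re (of_real (dheat t j (x - y)) * nabla_minus s u j y)) = Re (LINT y|lborel. of_real (dheat t j (x - y)) * nabla_minus s u j y)"
        by (rule integral_Re)
      then show ?thesis by (simp add: g_def)
    qed
    have "?\<Phi> t x = - Re (\<Sum>j\<in>UNIV. (LINT \<xi>|lborel. ?T j \<xi>))" by (simp only: r j(2) sum_negf Re_sum)
    also have "(\<Sum>j\<in>UNIV. (LINT \<xi>|lborel. ?T j \<xi>)) = (LINT \<xi>|lborel. (\<Sum>j\<in>UNIV. ?T j \<xi>))"
      by (rule Bochner_Integration.integral_sum[symmetric]) (rule j(1))
    also have "\<dots> = (LINT \<xi>|lborel. exp (- t * (2 * pi * norm \<xi>)\<^sup>2) *\<^sub>R G x \<xi>)"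
    proof (intro Bochner_Integration.integral_cong refl)
      fix \<xi> :: "real^'n"
      have "(norm \<xi>)\<^sup>2 = (\<Sum>j\<in>UNIV. (\<xi> $ j)\<^sup>2)"
        unfolding norm_vec_def L2_set_def by (simp add: sum_nonneg)
      then have "(2 * pi * norm \<xi>)\<^sup>2 = (\<Sum>j\<in>UNIV. (2 * pi * \<xi> $ j)\<^sup>2)" by (simp add: power_mult_distrib sum_distrib_left)
      then show "(\<Sum>j\<in>UNIV. ?T j \<xi>) = exp (- t * (2 * pi * norm \<xi>)\<^sup>2) *\<^sub>R G x \<xi>"
        unfolding sum_distrib_right[symmetric] of_real_sum[symmetric] G_def by (simp only: scaleR_conv_of_real mult_ac)
    qed
    finally show ?thesis by simp
  qed
  \<comment> \<open>Stated for a general exponent because it is used twice: for \<open>w\<close>,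
    which needs the weak-type inequality, and for \<open>u\<close>.\<close>
  have sub: "ennreal \<bar>Re (Gamma \<zeta> *\<^sub>R (LINT \<xi>|lborel. (2 * pi * norm \<xi>) powr (- 2 * \<zeta>) *\<^sub>R G x \<xi>))\<bar> \<le>
     (\<integral>\<^sup>+t\<in>{0<..}. ennreal (t powr (\<zeta> - 1) * \<bar>?\<Phi> t x\<bar>) \<partial>lborel)"
    if "\<zeta> > 0" "integrable lborel (\<lambda>\<xi>. (2 * pi * norm \<xi>) powr (- 2 * \<zeta>) *\<^sub>R G x \<xi>)" for \<zeta> x
  proof -
    from has_bochner_integral_norm_le[OF has_bochner_integral_Re[OF has_bochner_integral_subordination[OF that(1) _ that(2)]]]
    have "ennreal \<bar>Re (Gamma \<zeta> *\<^sub>R (LINT \<xi>|lborel. (2 * pi * norm \<xi>) powr (- 2 * \<zeta>) *\<^sub>R G x \<xi>))\<bar> \<le>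
      (\<integral>\<^sup>+t. ennreal \<bar>Re (indicator {0<..} t *\<^sub>R (t powr (\<zeta> - 1) *\<^sub>R (LINT \<xi>|lborel. exp (- t * (2 * pi * norm \<xi>)\<^sup>2) *\<^sub>R G x \<xi>)))\<bar> \<partial>lborel)"
      by simp
    also have "\<dots> = (\<integral>\<^sup>+t\<in>{0<..}. ennreal (t powr (\<zeta> - 1) * \<bar>?\<Phi> t x\<bar>) \<partial>lborel)"
    proof (intro nn_integral_cong)
      fix t :: real
      show "ennreal \<bar>Re (indicator {0<..} t *\<^sub>R (t powr (\<zeta> - 1) *\<^sub>R (LINT \<xi>|lborel. exp (- t * (2 * pi * norm \<xi>)\<^sup>2) *\<^sub>R G x \<xi>)))\<bar>
        = ennreal (t powr (\<zeta> - 1) * \<bar>?\<Phi> t x\<bar>) * indicator {0<..} t"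
        by (cases "t > 0"; use Phi[of t x] in \<open>simp add: abs_mult\<close>)
    qed
    finally show ?thesis .
  qed
  let ?e = "\<lambda>x \<xi>. exp (2 * of_real pi * \<i> * of_real (x \<bullet> \<xi>)) :: complex"
  have w_le: "ennreal \<bar>w x\<bar> \<le> (\<integral>\<^sup>+t\<in>{0<..}. ennreal \<bar>?\<Phi> t x\<bar> \<partial>lborel)" for x
  proof -
    \<comment> \<open>At the origin both sides vanish because \<open>0 powr (s - 1)\<close> is 0, so
      this identity holds everywhere, in contrast to the one for \<open>u\<close>.\<close>
    have eq: "(2 * pi * norm \<xi>) powr (- 2 * 1) *\<^sub>R G x \<xi> = M \<xi> * ?e x \<xi>" for \<xi>
    proof (cases "\<xi> = 0")
      case False
      then have "(2 * pi * norm \<xi>) powr (- 2 * 1) * (2 * pi * norm \<xi>)\<^sup>2 = 1"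
        by (simp add: powr_minus powr_numeral)
      then show ?thesis unfolding G_def scaleR_conv_of_real mult.assoc[symmetric] of_real_mult[symmetric] by simp
    qed (simp add: G_def M_def)
    have "integrable lborel (\<lambda>\<xi>. M \<xi> * ?e x \<xi>)"
      by (rule Bochner_Integration.integrable_bound[OF M]) (auto simp: norm_mult)
    then have "ennreal \<bar>w x\<bar> \<le> (\<integral>\<^sup>+t\<in>{0<..}. ennreal (t powr (1 - 1) * \<bar>?\<Phi> t x\<bar>) \<partial>lborel)"
      using sub[of 1 x] unfolding eq w_def inv_fourier_def by simp
    also have "\<dots> = (\<integral>\<^sup>+t\<in>{0<..}. ennreal \<bar>?\<Phi> t x\<bar> \<partial>lborel)"
      by (intro nn_integral_cong) (auto simp: indicator_def)
    finally show ?thesis .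
  qed
  have u_le: "ennreal (Gamma ((1 + s) / 2) * \<bar>u x\<bar>) \<le> (\<integral>\<^sup>+t\<in>{0<..}. ennreal (t powr ((s - 1) / 2) * \<bar>?\<Phi> t x\<bar>) \<partial>lborel)" for x
  proof -
    \<comment> \<open>The solution of -2\<zeta> + 2 + (s - 1) = 0, for which all powers of |\<xi>|
      cancel.\<close>
    define \<zeta> where "\<zeta> = (1 + s) / 2"
    have zz: "\<zeta> > 0" "\<zeta> - 1 = (s - 1) / 2" using s by (auto simp: \<zeta>_def field_simps)
    have eq: "(2 * pi * norm \<xi>) powr (- 2 * \<zeta>) *\<^sub>R G x \<xi> = ?F \<xi> * ?e x \<xi>" if "\<xi> \<noteq> 0" for \<xi>
    proof -
      have "(2 * pi * norm \<xi>) powr (- 2 * \<zeta>) * (2 * pi * norm \<xi>)\<^sup>2 * (2 * pi * norm \<xi>) powr (s - 1) = (2 * pi * norm \<xi>) powr (- 2 * \<zeta> + 2 + (s - 1))"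
      proof -
        have "(2 * pi * norm \<xi>)\<^sup>2 = (2 * pi * norm \<xi>) powr 2" using that by (simp add: powr_numeral)
        then show ?thesis by (simp only: powr_add)
      qed
      also have "- 2 * \<zeta> + 2 + (s - 1) = 0" by (simp add: \<zeta>_def field_simps)
      finally have "(2 * pi * norm \<xi>) powr (- 2 * \<zeta>) * (2 * pi * norm \<xi>)\<^sup>2 * (2 * pi * norm \<xi>) powr (s - 1) = 1" using that by simp
      then show ?thesis unfolding G_def M_def scaleR_conv_of_real mult.assoc[symmetric] of_real_mult[symmetric] by simp
    qed
    have ae: "AE \<xi> in lborel. ?F \<xi> * ?e x \<xi> = (2 * pi * norm \<xi>) powr (- 2 * \<zeta>) *\<^sub>R G x \<xi>"
      using AE_lborel_singleton[of "0::real^'n"] by eventually_elim (rule eq[symmetric])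
    have "integrable lborel (\<lambda>\<xi>. ?F \<xi> * ?e x \<xi>)"
      by (rule Bochner_Integration.integrable_bound[OF integrable_fourier_weight[OF u, of 0]]) (auto simp: norm_mult)
    then have "integrable lborel (\<lambda>\<xi>. (2 * pi * norm \<xi>) powr (- 2 * \<zeta>) *\<^sub>R G x \<xi>)"
      using ae by (subst integrable_cong_AE[symmetric]) auto
    note sub[OF zz(1) this]
    also have "(LINT \<xi>|lborel. (2 * pi * norm \<xi>) powr (- 2 * \<zeta>) *\<^sub>R G x \<xi>) = inv_fourier ?F x"
      unfolding inv_fourier_def by (rule integral_cong_AE[OF _ _ ae[THEN AE_symmetric]]) measurable
    also have "\<bar>Re (Gamma \<zeta> *\<^sub>R inv_fourier ?F x)\<bar> = Gamma \<zeta> * \<bar>u x\<bar>"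
      using Gamma_real_pos[OF zz(1)] unfolding fourier_inversion[OF u] by (simp add: abs_mult)
    finally show ?thesis unfolding zz(2) unfolding \<zeta>_def .
  qed
  have gn: "\<bar>g j x\<bar> \<le> norm (nabla_minus s u j x)" for j x unfolding g_def using abs_Re_le_cmod by simp
  show ?thesis
    by (rule that[of w g B]; (rule wB gB wd gn w_le u_le)?) (unfold w_def g_def, measurable)
qed

section \<open>Truncation of the potential\<close>

text \<open>If f is not integrable, its Bochner integral is 0 by convention and the bound is
  trivial.\<close>

lemma ennreal_norm_integral_le: "ennreal (norm (integral\<^sup>L M f)) \<le> (\<integral>\<^sup>+x. norm (f x) \<partial>M)"
  by (cases "integrable M f") (auto simp: integral_norm_bound_ennreal not_integrable_integral_eq)

section \<open>A continuously differentiable truncation on the line\<close>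

lemma DERIV_max_0_square: "((\<lambda>y::real. (max 0 y)\<^sup>2) has_real_derivative 2 * max 0 y) (at y)"
proof (cases "y = 0")
  case True
  have "((\<lambda>h::real. (max 0 h)\<^sup>2 / h) \<longlongrightarrow> 0) (at 0)"
  proof (rule Lim_null_comparison[where g="\<lambda>h. \<bar>h\<bar>"])
    show "\<forall>\<^sub>F h::real in at 0. norm ((max 0 h)\<^sup>2 / h) \<le> \<bar>h\<bar>"
      by (intro always_eventually) (auto simp: max_def power2_eq_square)
    show "((\<lambda>h::real. \<bar>h\<bar>) \<longlongrightarrow> 0) (at 0)" by (rule tendsto_rabs_zero) simp
  qed
  then show ?thesis using True by (simp add: DERIV_def)
next
  case False
  then consider "y < 0" | "y > 0" by linarith
  then show ?thesis
  proof cases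
    case 1
    have "((\<lambda>y::real. 0) has_real_derivative 0) (at y)" by simp
    then have "((\<lambda>y::real. (max 0 y)\<^sup>2) has_real_derivative 0) (at y)"
      by (rule has_field_derivative_transform_within_open[where S="{..<0}"]) (use 1 in auto)
    then show ?thesis using 1 by simp
  next
    case 2
    have "((\<lambda>y::real. y\<^sup>2) has_real_derivative 2 * y) (at y)" by (auto intro!: derivative_eq_intros)
    then have "((\<lambda>y::real. (max 0 y)\<^sup>2) has_real_derivative 2 * y) (at y)"
      by (rule has_field_derivative_transform_within_open[where S="{0<..}"]) (use 2 in auto)
    then show ?thesis using 2 by simp
  qed
qed

text \<open>A C^1 substitute for the positive part of y - c: its slope grows linearly from 0 at c to
  1 at 2c. The corner is smoothed because \<open>clip c\<close> composed with \<open>w\<close> must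
  be differentiable along the axes at every point.\<close>

definition excess :: "real \<Rightarrow> real \<Rightarrow> real" where
  "excess c y = ((max 0 (y - c))\<^sup>2 - (max 0 (y - 2 * c))\<^sup>2) / (2 * c)"

text \<open>An odd truncation: the identity up to height c, and of constant modulus 3c/2 beyond 2c.
  Below, \<open>clip'\<close> is its derivative in closed form.\<close>

definition clip :: "real \<Rightarrow> real \<Rightarrow> real" where
  "clip c y = y - excess c y + excess c (- y)"

definition clip' :: "real \<Rightarrow> real \<Rightarrow> real" where
  "clip' c y = 1 - (max 0 (y - c) - max 0 (y - 2 * c)) / c - (max 0 (- y - c) - max 0 (- y - 2 * c)) / c"

lemma clip_measurable [measurable]:
  assumes [measurable]: "f \<in> borel_measurable M"
  shows "(\<lambda>x. clip c (f x)) \<in> borel_measurable M" "(\<lambda>x. clip' c (f x)) \<in> borel_measurable M"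
  unfolding clip_def clip'_def excess_def by measurable

lemma DERIV_excess:
  assumes "c > 0"
  shows "(excess c has_real_derivative (max 0 (y - c) - max 0 (y - 2 * c)) / c) (at y)"
proof -
  have m: "((\<lambda>y. (max 0 (y - d))\<^sup>2) has_real_derivative 2 * max 0 (y - d)) (at y)" for d :: real
    using DERIV_chain2[where f="\<lambda>y. (max 0 y)\<^sup>2" and g="\<lambda>y. y - d", OF DERIV_max_0_square DERIV_diff[OF DERIV_ident DERIV_const]] by simp
  have "((\<lambda>y. ((max 0 (y - c))\<^sup>2 - (max 0 (y - 2 * c))\<^sup>2) / (2 * c)) has_real_derivative (2 * max 0 (y - c) - 2 * max 0 (y - 2 * c)) / (2 * c)) (at y)"
    by (intro DERIV_cdivide DERIV_diff m)
  then show ?thesis unfolding excess_def[abs_def] by (rule DERIV_cong) (simp add: diff_divide_distrib)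
qed

lemma DERIV_clip:
  assumes "c > 0" shows "(clip c has_real_derivative clip' c y) (at y)"
proof -
  have "((\<lambda>y. excess c (- y)) has_real_derivative ((max 0 (- y - c) - max 0 (- y - 2 * c)) / c) * (- 1)) (at y)"
    by (rule DERIV_chain2[OF DERIV_excess[OF assms]]) (auto intro!: derivative_eq_intros)
  from DERIV_add[OF DERIV_diff[OF DERIV_ident DERIV_excess[OF assms]] this]
  show ?thesis unfolding clip_def[abs_def] clip'_def by (rule DERIV_cong) simp
qed

lemma clip'_cases:
  assumes "c > 0"
  shows "clip' c y = (if \<bar>y\<bar> \<le> c then 1 else if \<bar>y\<bar> \<le> 2 * c then 2 - \<bar>y\<bar> / c else 0)"
  using assms by (auto simp: clip'_def max_def field_simps abs_if)

lemma excess_cases: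
  assumes "c > 0"
  shows "excess c y = (if y \<le> c then 0 else if y \<le> 2 * c then (y - c)\<^sup>2 / (2 * c) else y - 3 * c / 2)"
  using assms by (auto simp: excess_def max_def field_simps power2_eq_square)

lemma excess_bounds:
  assumes "c > 0"
  shows "0 \<le> excess c y" "y > c \<Longrightarrow> excess c y \<le> y" "y \<le> c \<Longrightarrow> excess c y = 0" "y - 2 * c \<le> excess c y"
proof -
  have "(y - c)\<^sup>2 / (2 * c) \<le> y" if "c < y" "y \<le> 2 * c"
  proof -
    have "(y - c)\<^sup>2 \<le> c * (y - c)" unfolding power2_eq_square using that by (intro mult_right_mono) auto
    also have "\<dots> \<le> y * (2 * c)" using that assms by (simp add: algebra_simps)
    finally show ?thesis using assms by (simp add: pos_divide_le_eq)
  qed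
  then show "0 \<le> excess c y" "y > c \<Longrightarrow> excess c y \<le> y" "y \<le> c \<Longrightarrow> excess c y = 0"
    using assms by (auto simp: excess_cases)
  have "0 \<le> (y - c)\<^sup>2 / (2 * c)" using assms by simp
  then show "y - 2 * c \<le> excess c y" unfolding excess_cases[OF assms] using assms by (auto intro: order.trans[of _ 0])
qed

text \<open>As a function of y, \<open>clip' c\<close> is the trapezoid max 0 (min 1 (2 - |y|/c)),
  which grows with c. The difference is thus a multiplier in [0, 1] that lives on heights between a
  and 2b.\<close>

lemma clip'_diff_bounds:
  assumes "0 < a" "a \<le> b"
  shows "0 \<le> clip' b y - clip' a y" "clip' b y - clip' a y \<le> 1" "\<bar>y\<bar> < a \<or> 2 * b < \<bar>y\<bar> \<Longrightarrow> clip' b y - clip' a y = 0"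
proof -
  have m: "clip' c y = max 0 (min 1 (2 - \<bar>y\<bar> / c))" if "c > 0" for c
    using that by (auto simp: clip'_cases field_simps min_def max_def)
  have "\<bar>y\<bar> / b \<le> \<bar>y\<bar> / a" using assms by (intro divide_left_mono) auto
  then show "0 \<le> clip' b y - clip' a y" using assms by (simp add: m)
  show "clip' b y - clip' a y \<le> 1" using assms by (simp add: m)
  show "\<bar>y\<bar> < a \<or> 2 * b < \<bar>y\<bar> \<Longrightarrow> clip' b y - clip' a y = 0" using assms by (auto simp: clip'_cases)
qed

text \<open>Removing the band between a and b leaves \<open>clip a y\<close>, of modulus at most 2a,
  and \<open>y - clip b y\<close>, which vanishes up to height b and never exceeds |y|.\<close>

lemma clip_remainder_bound:
  assumes "0 < a" "0 < b"
  shows "\<bar>y - (clip b y - clip a y)\<bar> \<le> 2 * a + (if b < \<bar>y\<bar> then \<bar>y\<bar> else 0)"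
proof -
  have "\<bar>y - clip b y\<bar> \<le> (if b < \<bar>y\<bar> then \<bar>y\<bar> else 0)"
    using excess_bounds(1-3)[OF assms(2), of y] excess_bounds(1-3)[OF assms(2), of "- y"] assms
    unfolding clip_def by (cases "y \<ge> 0"; cases "\<bar>y\<bar> > b") (auto simp: abs_if split: if_splits)
  moreover have "\<bar>clip a y\<bar> \<le> 2 * a"
    using excess_bounds[OF assms(1), of y] excess_bounds[OF assms(1), of "- y"] assms
    unfolding clip_def by (cases "y \<ge> 0"; cases "\<bar>y\<bar> > a") (auto simp: abs_if split: if_splits)
  ultimately show ?thesis by linarith
qed

text \<open>Collects what \<open>fractional_gradient_potential\<close> provides. \<open>A\<close> is
  any positive upper bound of the mass rather than the mass itself, so one may divide by it even if
  the seminorm vanishes. \<open>B\<close> only justifies the integrations by parts; no estimate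
  depends on it.\<close>

locale gradient_field =
  fixes w :: "real^'n::finite \<Rightarrow> real" and g :: "'n \<Rightarrow> real^'n \<Rightarrow> real" and B A K :: real
  assumes K_eq: "K = 2 * sqrt 2 ^ CARD('n)"
    and w_meas [measurable]: "w \<in> borel_measurable borel"
    and g_meas [measurable]: "\<And>j. g j \<in> borel_measurable borel"
    and w_bd: "\<And>x. \<bar>w x\<bar> \<le> B" and g_bd: "\<And>j x. \<bar>g j x\<bar> \<le> B"
    and grad: "\<And>y j. ((\<lambda>h. w (y + h *\<^sub>R axis j 1)) has_vector_derivative g j y) (at 0)"
    and w_le: "\<And>x. ennreal \<bar>w x\<bar> \<le> (\<integral>\<^sup>+t\<in>{0<..}. ennreal \<bar>\<Sum>j\<in>UNIV. LINT y|lborel. dheat t j (x - y) * g j y\<bar> \<partial>lborel)"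
    and g_int: "(\<integral>\<^sup>+y. ennreal (\<Sum>j\<in>UNIV. \<bar>g j y\<bar>) \<partial>lborel) \<le> ennreal A"
    and A: "A > 0" and dim: "CARD('n) \<ge> 2"
begin

abbreviation "gn y \<equiv> \<Sum>j\<in>UNIV. \<bar>g j y\<bar>"

definition "Phi t x = (\<Sum>j\<in>UNIV. LINT y|lborel. dheat t j (x - y) * g j y)"

lemma K_pos: "K > 0" and K_ge: "K \<ge> 2"
  unfolding K_eq by simp_all

lemma dheat_le_K: "t > 0 \<Longrightarrow> \<bar>dheat t j (z :: real^'n)\<bar> \<le> K / sqrt t * heat (2 * t) z"
  unfolding K_eq by (rule dheat_le)

lemma ddheat_le_K: "t > 0 \<Longrightarrow> \<bar>ddheat t j (z :: real^'n)\<bar> \<le> K / t * heat (2 * t) z"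
  unfolding K_eq by (rule ddheat_le)

lemma dheat_integral_le:
  fixes f :: "'n \<Rightarrow> real^'n \<Rightarrow> real"
  assumes t: "t > 0" and [measurable]: "\<And>j. f j \<in> borel_measurable borel"
    and f: "\<And>y. (\<Sum>j\<in>UNIV. \<bar>f j y\<bar>) \<le> F y"
  shows "ennreal \<bar>\<Sum>j\<in>UNIV. LINT y|lborel. dheat t j (x - y) * f j y\<bar> \<le> (\<integral>\<^sup>+y. ennreal (K / sqrt t * heat (2 * t) (x - y) * F y) \<partial>lborel)"
proof -
  have "ennreal \<bar>\<Sum>j\<in>UNIV. LINT y|lborel. dheat t j (x - y) * f j y\<bar> \<le> ennreal (\<Sum>j\<in>UNIV. \<bar>LINT y|lborel. dheat t j (x - y) * f j y\<bar>)"
    by (intro ennreal_leI sum_abs)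
  also have "\<dots> = (\<Sum>j\<in>UNIV. ennreal \<bar>LINT y|lborel. dheat t j (x - y) * f j y\<bar>)" by (rule sum_ennreal[symmetric]) simp
  also have "\<dots> \<le> (\<Sum>j\<in>UNIV. (\<integral>\<^sup>+y. ennreal \<bar>dheat t j (x - y) * f j y\<bar> \<partial>lborel))"
    using ennreal_norm_integral_le[of lborel "\<lambda>y. dheat t j (x - y) * f j y" for j] by (intro sum_mono) simp
  also have "\<dots> = (\<integral>\<^sup>+y. (\<Sum>j\<in>UNIV. ennreal \<bar>dheat t j (x - y) * f j y\<bar>) \<partial>lborel)" by (rule nn_integral_sum[symmetric]) measurable
  also have "\<dots> \<le> (\<integral>\<^sup>+y. ennreal (K / sqrt t * heat (2 * t) (x - y) * F y) \<partial>lborel)"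
  proof (intro nn_integral_mono)
    fix y
    have "(\<Sum>j\<in>UNIV. \<bar>dheat t j (x - y) * f j y\<bar>) \<le> (\<Sum>j\<in>UNIV. K / sqrt t * heat (2 * t) (x - y) * \<bar>f j y\<bar>)"
      unfolding abs_mult by (intro sum_mono mult_right_mono dheat_le_K t) auto
    also have "\<dots> = K / sqrt t * heat (2 * t) (x - y) * (\<Sum>j\<in>UNIV. \<bar>f j y\<bar>)" by (rule sum_distrib_left[symmetric])
    also have "\<dots> \<le> K / sqrt t * heat (2 * t) (x - y) * F y"
      using t K_pos by (intro mult_left_mono f) auto
    finally show "(\<Sum>j\<in>UNIV. ennreal \<bar>dheat t j (x - y) * f j y\<bar>) \<le> ennreal (K / sqrt t * heat (2 * t) (x - y) * F y)"
      by (subst sum_ennreal) (auto intro: ennreal_leI)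
  qed
  finally show ?thesis .
qed

lemma Phi_le:
  assumes "t > 0"
  shows "ennreal \<bar>Phi t x\<bar> \<le> (\<integral>\<^sup>+y. ennreal (K / sqrt t * heat (2 * t) (x - y) * gn y) \<partial>lborel)"
  unfolding Phi_def by (rule dheat_integral_le[OF assms]) auto

lemma heat_double_le:
  assumes "t > 0" shows "heat (2 * t) (x::real^'n) \<le> 1 / sqrt t ^ CARD('n)"
proof -
  have "heat (2 * t) x \<le> 1 / sqrt (2 * t) ^ CARD('n)" using assms by (intro heat_le) auto
  also have "\<dots> \<le> 1 / sqrt t ^ CARD('n)" using assms by (intro divide_left_mono power_mono) auto
  finally show ?thesis .
qed

lemma Phi_le_uniform:
  assumes "t > 0" shows "ennreal \<bar>Phi t x\<bar> \<le> ennreal (K * A * (1 / sqrt t ^ (CARD('n) + 1)))"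
proof -
  note Phi_le[OF assms]
  also have "(\<integral>\<^sup>+y. ennreal (K / sqrt t * heat (2 * t) (x - y) * gn y) \<partial>lborel) \<le> (\<integral>\<^sup>+y. ennreal (K / sqrt t * (1 / sqrt t ^ CARD('n))) * ennreal (gn y) \<partial>lborel)"
  proof (intro nn_integral_mono)
    fix y
    have "K / sqrt t * heat (2 * t) (x - y) * gn y \<le> K / sqrt t * (1 / sqrt t ^ CARD('n)) * gn y"
      using assms K_pos by (intro mult_right_mono mult_left_mono heat_double_le sum_nonneg) auto
    then show "ennreal (K / sqrt t * heat (2 * t) (x - y) * gn y) \<le> ennreal (K / sqrt t * (1 / sqrt t ^ CARD('n))) * ennreal (gn y)"
      using assms K_pos by (subst ennreal_mult'[symmetric]) (auto intro: ennreal_leI)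
  qed
  also have "\<dots> = ennreal (K / sqrt t * (1 / sqrt t ^ CARD('n))) * (\<integral>\<^sup>+y. ennreal (gn y) \<partial>lborel)" by (rule nn_integral_cmult) measurable
  also have "\<dots> \<le> ennreal (K / sqrt t * (1 / sqrt t ^ CARD('n))) * ennreal A" by (intro mult_left_mono g_int) simp
  also have "\<dots> = ennreal (K * A * (1 / sqrt t ^ (CARD('n) + 1)))"
    using assms K_pos by (subst ennreal_mult'[symmetric]) (auto simp: field_simps)
  finally show ?thesis .
qed

text \<open>The weak-type Sobolev inequality for the potential, tested on a set of measure \<open>r\<^sup>n\<close>.\<close>
lemma potential_integral_le:
  assumes [measurable]: "E \<in> sets borel" and r: "r > 0" and E: "emeasure lborel E = ennreal (r ^ CARD('n))"
  shows "(\<integral>\<^sup>+x\<in>E. ennreal \<bar>w x\<bar> \<partial>lborel) \<le> ennreal (4 * K * A * r)"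
proof -
  let ?n = "CARD('n)"
  \<comment> \<open>Total mass 1 is the better bound for t below r^2; beyond, it is the supremum of
    the kernel times the measure of E.\<close>
  have inner: "(\<integral>\<^sup>+x\<in>E. ennreal (heat (2 * t) (x - y)) \<partial>lborel) \<le> ennreal (min 1 (r ^ ?n / sqrt t ^ ?n))" if t: "t > 0" for t and y :: "real^'n"
  proof -
    have "(\<integral>\<^sup>+x\<in>E. ennreal (heat (2 * t) (x - y)) \<partial>lborel) \<le> (\<integral>\<^sup>+x. ennreal (heat (2 * t) (x - y)) \<partial>lborel)"
      by (intro nn_integral_mono) (auto simp: indicator_def)
    also have "\<dots> = ennreal 1" using nn_integral_heat(2)[of "2 * t" y] t by simp
    finally have 1: "(\<integral>\<^sup>+x\<in>E. ennreal (heat (2 * t) (x - y)) \<partial>lborel) \<le> ennreal 1" .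
    have "(\<integral>\<^sup>+x\<in>E. ennreal (heat (2 * t) (x - y)) \<partial>lborel) \<le> (\<integral>\<^sup>+x. ennreal (1 / sqrt t ^ ?n) * indicator E x \<partial>lborel)"
      by (intro nn_integral_mono mult_right_mono ennreal_leI heat_double_le t) auto
    also have "\<dots> = ennreal (1 / sqrt t ^ ?n) * ennreal (r ^ ?n)" by (simp add: nn_integral_cmult E)
    also have "\<dots> = ennreal (r ^ ?n / sqrt t ^ ?n)" using t by (subst ennreal_mult'[symmetric]) auto
    finally show ?thesis using 1 by (simp add: min_def)
  qed
  have "(\<integral>\<^sup>+x\<in>E. ennreal \<bar>w x\<bar> \<partial>lborel) \<le> (\<integral>\<^sup>+x. (\<integral>\<^sup>+t. (\<integral>\<^sup>+y. ennreal (K / sqrt t * heat (2 * t) (x - y) * gn y) * indicator {0<..} t * indicator E x \<partial>lborel) \<partial>lborel) \<partial>lborel)"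
  proof (intro nn_integral_mono)
    fix x
    have "ennreal \<bar>w x\<bar> * indicator E x \<le> (\<integral>\<^sup>+t. ennreal \<bar>Phi t x\<bar> * indicator {0<..} t * indicator E x \<partial>lborel)"
      using w_le[of x, folded Phi_def] by (cases "x \<in> E") auto
    also have "\<dots> \<le> (\<integral>\<^sup>+t. (\<integral>\<^sup>+y. ennreal (K / sqrt t * heat (2 * t) (x - y) * gn y) * indicator {0<..} t * indicator E x \<partial>lborel) \<partial>lborel)"
    proof (intro nn_integral_mono)
      fix t :: real
      show "ennreal \<bar>Phi t x\<bar> * indicator {0<..} t * indicator E x \<le> (\<integral>\<^sup>+y. ennreal (K / sqrt t * heat (2 * t) (x - y) * gn y) * indicator {0<..} t * indicator E x \<partial>lborel)"
        using Phi_le[of t x] by (cases "t > 0"; cases "x \<in> E") auto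
    qed
    finally show "ennreal \<bar>w x\<bar> * indicator E x \<le> (\<integral>\<^sup>+t. (\<integral>\<^sup>+y. ennreal (K / sqrt t * heat (2 * t) (x - y) * gn y) * indicator {0<..} t * indicator E x \<partial>lborel) \<partial>lborel)" .
  qed
  also have "\<dots> = (\<integral>\<^sup>+t. (\<integral>\<^sup>+x. (\<integral>\<^sup>+y. ennreal (K / sqrt t * heat (2 * t) (x - y) * gn y) * indicator {0<..} t * indicator E x \<partial>lborel) \<partial>lborel) \<partial>lborel)"
    by (rule lborel_pair.Fubini') measurable
  also have "\<dots> = (\<integral>\<^sup>+t. (\<integral>\<^sup>+y. (\<integral>\<^sup>+x. ennreal (K / sqrt t * heat (2 * t) (x - y) * gn y) * indicator {0<..} t * indicator E x \<partial>lborel) \<partial>lborel) \<partial>lborel)"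
    by (intro nn_integral_cong lborel_pair.Fubini') measurable
  also have "\<dots> \<le> (\<integral>\<^sup>+t. ennreal (K * A / sqrt t * min 1 (r ^ ?n / sqrt t ^ ?n)) * indicator {0<..} t \<partial>lborel)"
  proof (intro nn_integral_mono)
    fix t :: real
    show "(\<integral>\<^sup>+y. (\<integral>\<^sup>+x. ennreal (K / sqrt t * heat (2 * t) (x - y) * gn y) * indicator {0<..} t * indicator E x \<partial>lborel) \<partial>lborel) \<le> ennreal (K * A / sqrt t * min 1 (r ^ ?n / sqrt t ^ ?n)) * indicator {0<..} t"
    proof (cases "t > 0")
      case True
      let ?m = "min 1 (r ^ ?n / sqrt t ^ ?n)"
      have m0: "?m \<ge> 0" using r True by simp
      have "(\<integral>\<^sup>+x. ennreal (K / sqrt t * heat (2 * t) (x - y) * gn y) * indicator {0<..} t * indicator E x \<partial>lborel) \<le> ennreal (K / sqrt t * ?m) * ennreal (gn y)" for y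
      proof -
        have c0: "K / sqrt t * gn y \<ge> 0" using True K_pos by (intro mult_nonneg_nonneg sum_nonneg) auto
        have "(\<integral>\<^sup>+x. ennreal (K / sqrt t * heat (2 * t) (x - y) * gn y) * indicator {0<..} t * indicator E x \<partial>lborel)
          = (\<integral>\<^sup>+x. ennreal (K / sqrt t * gn y) * (ennreal (heat (2 * t) (x - y)) * indicator E x) \<partial>lborel)"
        proof (intro nn_integral_cong)
          fix x
          have "ennreal (K / sqrt t * heat (2 * t) (x - y) * gn y) = ennreal (K / sqrt t * gn y) * ennreal (heat (2 * t) (x - y))"
            by (subst ennreal_mult'[OF c0, symmetric]) (simp only: mult_ac)
          then show "ennreal (K / sqrt t * heat (2 * t) (x - y) * gn y) * indicator {0<..} t * indicator E x = ennreal (K / sqrt t * gn y) * (ennreal (heat (2 * t) (x - y)) * indicator E x)"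
            using True by (simp add: mult.assoc)
        qed
        also have "\<dots> \<le> ennreal (K / sqrt t * gn y) * ennreal ?m"
          by (subst nn_integral_cmult, measurable) (intro mult_left_mono inner True, simp)
        also have "\<dots> = ennreal (K / sqrt t * ?m) * ennreal (gn y)"
          using True K_pos m0 by (subst (1 2) ennreal_mult'[symmetric]) (auto simp: mult_ac intro!: c0[simplified] sum_nonneg)
        finally show ?thesis .
      qed
      then have "(\<integral>\<^sup>+y. (\<integral>\<^sup>+x. ennreal (K / sqrt t * heat (2 * t) (x - y) * gn y) * indicator {0<..} t * indicator E x \<partial>lborel) \<partial>lborel) \<le> (\<integral>\<^sup>+y. ennreal (K / sqrt t * ?m) * ennreal (gn y) \<partial>lborel)"
        by (intro nn_integral_mono)
      also have "\<dots> = ennreal (K / sqrt t * ?m) * (\<integral>\<^sup>+y. ennreal (gn y) \<partial>lborel)" by (rule nn_integral_cmult) measurable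
      also have "\<dots> \<le> ennreal (K / sqrt t * ?m) * ennreal A" by (intro mult_left_mono g_int) simp
      also have "\<dots> = ennreal (K * A / sqrt t * ?m)"
        using A by (subst ennreal_mult''[symmetric]) (auto simp: mult_ac)
      finally show ?thesis using True by simp
    qed simp
  qed
  \<comment> \<open>Split at t = r^2, where the two entries of the minimum agree.\<close>
  also have "\<dots> \<le> (\<integral>\<^sup>+t. ennreal (K * A) * (ennreal (t powr (1/2 - 1)) * indicator {0<..r\<^sup>2} t) + ennreal (K * A * r ^ ?n) * (ennreal (t powr (- ((real ?n - 1) / 2) - 1)) * indicator {r\<^sup>2..} t) \<partial>lborel)"
  proof (intro nn_integral_mono)
    fix t :: real
    show "ennreal (K * A / sqrt t * min 1 (r ^ ?n / sqrt t ^ ?n)) * indicator {0<..} t \<le> ennreal (K * A) * (ennreal (t powr (1/2 - 1)) * indicator {0<..r\<^sup>2} t) + ennreal (K * A * r ^ ?n) * (ennreal (t powr (- ((real ?n - 1) / 2) - 1)) * indicator {r\<^sup>2..} t)"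
    proof (cases "t > 0")
      case True
      have s: "1 / sqrt t = t powr (1/2 - 1)" using True by (simp add: powr_minus powr_half_sqrt inverse_eq_divide)
      have KA: "K * A \<ge> 0" using K_pos A by simp
      show ?thesis
      proof (cases "t \<le> r\<^sup>2")
        case le: True
        have "K * A / sqrt t * min 1 (r ^ ?n / sqrt t ^ ?n) \<le> K * A / sqrt t * 1" using KA True by (intro mult_left_mono) auto
        also have "\<dots> = K * A * t powr (1/2 - 1)" unfolding s[symmetric] by simp
        finally have "ennreal (K * A / sqrt t * min 1 (r ^ ?n / sqrt t ^ ?n)) \<le> ennreal (K * A) * ennreal (t powr (1/2 - 1))"
          unfolding ennreal_mult'[OF KA, symmetric] by (rule ennreal_leI)
        then show ?thesis using True le by (simp add: add_increasing2)
      next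
        case False
        have p: "1 / (sqrt t * sqrt t ^ ?n) = t powr (- ((real ?n - 1) / 2) - 1)"
        proof -
          have "sqrt t * sqrt t ^ ?n = t powr (1/2) * (t powr (1/2)) powr real ?n"
            using True by (simp add: powr_half_sqrt powr_realpow)
          also have "\<dots> = t powr (1/2 + 1/2 * real ?n)" by (simp only: powr_powr powr_add)
          finally have "1 / (sqrt t * sqrt t ^ ?n) = t powr - (1/2 + 1/2 * real ?n)"
            by (simp only: powr_minus inverse_eq_divide)
          also have "- (1/2 + 1/2 * real ?n) = - ((real ?n - 1) / 2) - 1" by (simp add: field_simps)
          finally show ?thesis .
        qed
        have "K * A / sqrt t * min 1 (r ^ ?n / sqrt t ^ ?n) \<le> K * A / sqrt t * (r ^ ?n / sqrt t ^ ?n)" using KA True by (intro mult_left_mono) auto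
        also have "\<dots> = K * A * r ^ ?n * (1 / (sqrt t * sqrt t ^ ?n))" by simp
        also have "\<dots> = K * A * r ^ ?n * t powr (- ((real ?n - 1) / 2) - 1)" unfolding p ..
        finally have "ennreal (K * A / sqrt t * min 1 (r ^ ?n / sqrt t ^ ?n)) \<le> ennreal (K * A * r ^ ?n) * ennreal (t powr (- ((real ?n - 1) / 2) - 1))"
          using KA r by (subst ennreal_mult'[symmetric]) (auto intro: ennreal_leI)
        then show ?thesis using True False by (simp add: add_increasing)
      qed
    qed simp
  qed
  also have "\<dots> = ennreal (K * A) * ennreal ((r\<^sup>2) powr (1/2) / (1/2)) + ennreal (K * A * r ^ ?n) * ennreal ((r\<^sup>2) powr - ((real ?n - 1) / 2) / ((real ?n - 1) / 2))"
  proof -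
    have 1: "(\<integral>\<^sup>+t. ennreal (K * A) * (ennreal (t powr (1/2 - 1)) * indicator {0<..r\<^sup>2} t) \<partial>lborel) = ennreal (K * A) * ennreal ((r\<^sup>2) powr (1/2) / (1/2))"
      using nn_integral_powr_from_0[of "1/2" "r\<^sup>2"] by (subst nn_integral_cmult) auto
    have 2: "(\<integral>\<^sup>+t. ennreal (K * A * r ^ ?n) * (ennreal (t powr (- ((real ?n - 1) / 2) - 1)) * indicator {r\<^sup>2..} t) \<partial>lborel)
      = ennreal (K * A * r ^ ?n) * ennreal ((r\<^sup>2) powr - ((real ?n - 1) / 2) / ((real ?n - 1) / 2))"
      using nn_integral_powr_to_inf[of "(real ?n - 1) / 2" "r\<^sup>2"] r dim by (subst nn_integral_cmult) auto
    show ?thesis by (subst nn_integral_add, measurable) (simp only: 1 2)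
  qed
  also have "\<dots> = ennreal (K * A * (2 * r)) + ennreal (K * A * (2 / (real ?n - 1) * r))"
  proof -
    have 1: "(r\<^sup>2) powr (1/2) / (1/2) = 2 * r" using r by (simp add: powr_half_sqrt)
    have "(r\<^sup>2) powr - ((real ?n - 1) / 2) = r powr (- (real ?n - 1))"
    proof -
      have "(r\<^sup>2) powr - ((real ?n - 1) / 2) = r powr (2 * - ((real ?n - 1) / 2))"
        using r powr_powr[of r 2 "- ((real ?n - 1) / 2)"] by (simp only: powr_numeral)
      also have "2 * - ((real ?n - 1) / 2) = - (real ?n - 1)" by (simp add: field_simps)
      finally show ?thesis .
    qed
    then have "r ^ ?n * (r\<^sup>2) powr - ((real ?n - 1) / 2) = r powr (real ?n + - (real ?n - 1))"
      unfolding powr_add using r by (simp add: powr_realpow)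
    then have 2: "r ^ ?n * ((r\<^sup>2) powr - ((real ?n - 1) / 2) / ((real ?n - 1) / 2)) = 2 / (real ?n - 1) * r"
      using r by simp
    have KA: "K * A \<ge> 0" "K * A * r ^ ?n \<ge> 0" using K_pos A r by auto
    show ?thesis unfolding 1 ennreal_mult'[OF KA(1), symmetric] ennreal_mult'[OF KA(2), symmetric] mult.assoc[of "K * A" "r ^ ?n"] 2 ..
  qed
  \<comment> \<open>Since n is at least 2, the factor 2/(n - 1) is at most 2.\<close>
  also have "\<dots> \<le> ennreal (K * A * (2 * r)) + ennreal (K * A * (2 * r))"
    using K_pos A r dim by (intro add_mono ennreal_leI mult_left_mono mult_right_mono) (auto simp: divide_le_eq)
  also have "\<dots> = ennreal (4 * K * A * r)" using K_pos A r by (subst ennreal_plus[symmetric]) auto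
  finally show ?thesis .
qed

text \<open>If |w| > b on a set of measure r^n, then b r^n <= 4 K A r by
  \<open>potential_integral_le\<close>, and the choice of b turns this into r <= \<beta>. Inserting
  that into the same inequality gives the bound.\<close>

lemma potential_tail_le:
  assumes \<beta>: "\<beta> > 0" and b: "b = 4 * K * A / \<beta> ^ (CARD('n) - 1)"
  shows "(\<integral>\<^sup>+x\<in>{x. b < \<bar>w x\<bar>}. ennreal \<bar>w x\<bar> \<partial>lborel) \<le> ennreal (4 * K * A * \<beta>)"
proof -
  let ?n = "CARD('n)"
  have b0: "b > 0" using b \<beta> K_pos A by simp
  \<comment> \<open>Cutting with balls makes the measure finite, so that a power of r may be
    cancelled; monotone convergence removes the balls.\<close>
  define E where "E N = {x. b < \<bar>w x\<bar>} \<inter> cball 0 (real N)" for N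
  have [measurable]: "E N \<in> sets borel" for N
  proof -
    have "{x. b < \<bar>w x\<bar>} \<in> sets borel" by measurable
    then show ?thesis unfolding E_def by auto
  qed
  have EN: "(\<integral>\<^sup>+x\<in>E N. ennreal \<bar>w x\<bar> \<partial>lborel) \<le> ennreal (4 * K * A * \<beta>)" for N
  proof -
    have "emeasure lborel (E N) \<le> emeasure lborel (cball (0::real^'n) (real N))"
      by (intro emeasure_mono) (auto simp: E_def)
    also have "\<dots> < \<infinity>" using emeasure_bounded_finite[OF bounded_cball] .
    finally have fin: "emeasure lborel (E N) = ennreal (measure lborel (E N))" by (simp add: emeasure_eq_ennreal_measure)
    show ?thesis
    proof (cases "measure lborel (E N) = 0")
      case True
      then have "E N \<in> null_sets lborel" using fin by (intro null_setsI) auto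
      then have "AE x in lborel. x \<notin> E N" by (rule AE_not_in)
      then have "(\<integral>\<^sup>+x\<in>E N. ennreal \<bar>w x\<bar> \<partial>lborel) = (\<integral>\<^sup>+x. 0 \<partial>(lborel :: (real^'n) measure))"
        by (intro nn_integral_cong_AE) (auto elim!: eventually_mono)
      then show ?thesis by simp
    next
      case False
      then have pos: "measure lborel (E N) > 0" by (simp add: less_le)
      define r where "r = root ?n (measure lborel (E N))"
      have r: "r > 0" "r ^ ?n = measure lborel (E N)" using pos by (auto simp: r_def)
      have I: "(\<integral>\<^sup>+x\<in>E N. ennreal \<bar>w x\<bar> \<partial>lborel) \<le> ennreal (4 * K * A * r)"
        by (rule potential_integral_le) (use r fin in auto)
      have "ennreal (b * r ^ ?n) = (\<integral>\<^sup>+x. ennreal b * indicator (E N) x \<partial>lborel)"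
        using b0 fin r by (simp add: nn_integral_cmult ennreal_mult')
      also have "\<dots> \<le> (\<integral>\<^sup>+x\<in>E N. ennreal \<bar>w x\<bar> \<partial>lborel)"
        by (intro nn_integral_mono) (auto simp: E_def indicator_def intro: ennreal_leI)
      also note I
      finally have "b * r ^ ?n \<le> 4 * K * A * r" using K_pos A r by (simp add: ennreal_le_iff)
      moreover have "r ^ ?n = r * r ^ (?n - 1)" using dim by (simp flip: power_Suc)
      ultimately have "b * r ^ (?n - 1) \<le> 4 * K * A" using r by (simp add: mult.left_commute mult.commute)
      then have "r ^ (?n - 1) \<le> \<beta> ^ (?n - 1)" using b \<beta> K_pos A by (simp add: field_simps)
      then have "r \<le> \<beta>" using \<beta> dim by (intro power_le_imp_le_base[of r "?n - 2" \<beta>]) (auto simp: Suc_diff_Suc numeral_2_eq_2)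
      then have "4 * K * A * r \<le> 4 * K * A * \<beta>" using K_pos A by (intro mult_left_mono) auto
      then show ?thesis using I by (meson ennreal_leI order_trans)
    qed
  qed
  have "(\<integral>\<^sup>+x\<in>{x. b < \<bar>w x\<bar>}. ennreal \<bar>w x\<bar> \<partial>lborel) = (\<integral>\<^sup>+x. (SUP N. ennreal \<bar>w x\<bar> * indicator (E N) x) \<partial>lborel)"
  proof (intro nn_integral_cong antisym)
    fix x :: "real^'n"
    obtain N where "norm x \<le> real N" using real_arch_simple by blast
    then have "ennreal \<bar>w x\<bar> * indicator {x. b < \<bar>w x\<bar>} x \<le> ennreal \<bar>w x\<bar> * indicator (E N) x" by (auto simp: E_def indicator_def)
    then show "ennreal \<bar>w x\<bar> * indicator {x. b < \<bar>w x\<bar>} x \<le> (SUP N. ennreal \<bar>w x\<bar> * indicator (E N) x)"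
      by (rule order.trans) (rule SUP_upper, simp)
    show "(SUP N. ennreal \<bar>w x\<bar> * indicator (E N) x) \<le> ennreal \<bar>w x\<bar> * indicator {x. b < \<bar>w x\<bar>} x"
      by (intro SUP_least) (auto simp: E_def indicator_def)
  qed
  also have "\<dots> = (SUP N. \<integral>\<^sup>+x\<in>E N. ennreal \<bar>w x\<bar> \<partial>lborel)"
    by (rule nn_integral_monotone_convergence_SUP) (auto simp: incseq_def le_fun_def E_def indicator_def)
  also have "\<dots> \<le> ennreal (4 * K * A * \<beta>)" by (intro SUP_least EN)
  finally show ?thesis .
qed

text \<open>Truncating the potential removes its small and its large values, whose contribution is
  controlled through two derivatives of the heat kernel.\<close>
lemma Phi_truncated_le:
  assumes t: "t > 0" and a: "0 < a" "a \<le> b" and \<beta>: "\<beta> > 0" and b: "b = 4 * K * A / \<beta> ^ (CARD('n) - 1)"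
  shows "ennreal \<bar>Phi t x\<bar> \<le> ennreal (CARD('n) * K / t * (2 * a + 4 * K * A * \<beta> / sqrt t ^ CARD('n)))
    + (\<integral>\<^sup>+y. ennreal (K / sqrt t * heat (2 * t) (x - y) * (gn y * indicator {y. a \<le> \<bar>w y\<bar> \<and> \<bar>w y\<bar> \<le> 2 * b} y)) \<partial>lborel)"
proof -
  let ?n = "CARD('n)"
  have b0: "b > 0" using a by simp
  \<comment> \<open>The gradient of \<open>w\<close> is the sum of \<open>T'\<close> times itself,
    which lives on the retained heights, and the gradient of the remainder \<open>S\<close>. In the
    latter the derivative is moved onto the kernel.\<close>
  define T' where "T' y = clip' b (w y) - clip' a (w y)" for y
  define S where "S y = w y - (clip b (w y) - clip a (w y))" for y
  have T': "0 \<le> T' y" "T' y \<le> 1" "\<not> (a \<le> \<bar>w y\<bar> \<and> \<bar>w y\<bar> \<le> 2 * b) \<Longrightarrow> T' y = 0" for y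
    using clip'_diff_bounds[OF a, of "w y"] unfolding T'_def by auto
  have [measurable]: "T' \<in> borel_measurable borel" "S \<in> borel_measurable borel"
    unfolding T'_def S_def by measurable
  have Sb: "\<bar>S y\<bar> \<le> 2 * a + (if b < \<bar>w y\<bar> then \<bar>w y\<bar> else 0)" for y
    unfolding S_def by (rule clip_remainder_bound[OF a(1) b0])
  have B0: "B \<ge> 0" using w_bd[of 0] by simp
  have gB: "\<bar>c * g j y\<bar> \<le> B" if "\<bar>c\<bar> \<le> 1" for c j y
    using mult_mono[OF that g_bd[of j y]] by (simp add: abs_mult)
  have dS: "((\<lambda>h. S (y + h *\<^sub>R axis j 1)) has_vector_derivative (1 - T' y) * g j y) (at 0)" for y j
  proof -
    have w': "((\<lambda>h. w (y + h *\<^sub>R axis j 1)) has_real_derivative g j y) (at 0)"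
      using grad by (simp add: has_real_derivative_iff_has_vector_derivative)
    have c: "((\<lambda>h. clip c (w (y + h *\<^sub>R axis j 1))) has_real_derivative clip' c (w y) * g j y) (at 0)" if "c > 0" for c
      using DERIV_chain2[OF DERIV_clip[OF that] w'] by simp
    have "((\<lambda>h. S (y + h *\<^sub>R axis j 1)) has_real_derivative g j y - (clip' b (w y) * g j y - clip' a (w y) * g j y)) (at 0)"
      unfolding S_def by (intro DERIV_diff w' c a b0)
    then show ?thesis unfolding has_real_derivative_iff_has_vector_derivative[symmetric]
      by (rule DERIV_cong) (simp add: T'_def algebra_simps)
  qed
  have split: "(LINT y|lborel. dheat t j (x - y) * g j y) = (LINT y|lborel. ddheat t j (x - y) * S y) + (LINT y|lborel. dheat t j (x - y) * (T' y * g j y))" for j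
  proof -
    have ig: "integrable lborel (\<lambda>y. dheat t j (x - y) * f y)" if [measurable]: "f \<in> borel_measurable borel" and f: "\<And>y. \<bar>f y\<bar> \<le> B" for f
    proof (rule Bochner_Integration.integrable_bound[of _ "\<lambda>y. K / sqrt t * B * heat (2 * t) (x - y)"])
      have "norm (dheat t j (x - y) * f y) \<le> norm (K / sqrt t * B * heat (2 * t) (x - y))" for y
      proof -
        have "\<bar>dheat t j (x - y)\<bar> * \<bar>f y\<bar> \<le> (K / sqrt t * heat (2 * t) (x - y)) * B"
          using t K_pos by (intro mult_mono dheat_le_K f) auto
        then show ?thesis using t K_pos B0 by (simp add: abs_mult mult_ac)
      qed
      then show "AE y in lborel. norm (dheat t j (x - y) * f y) \<le> norm (K / sqrt t * B * heat (2 * t) (x - y))" by simp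
    qed (use t in auto)
    have i1: "integrable lborel (\<lambda>y. dheat t j (x - y) * ((1 - T' y) * g j y))"
      by (rule ig) (use T' in \<open>auto intro!: gB\<close>)
    have i2: "integrable lborel (\<lambda>y. dheat t j (x - y) * (T' y * g j y))"
      by (rule ig) (use T' in \<open>auto intro!: gB\<close>)
    have "(LINT y|lborel. dheat t j (x - y) * g j y) = (LINT y|lborel. dheat t j (x - y) * ((1 - T' y) * g j y) + dheat t j (x - y) * (T' y * g j y))"
      by (simp add: algebra_simps)
    also have "\<dots> = (LINT y|lborel. dheat t j (x - y) * ((1 - T' y) * g j y)) + (LINT y|lborel. dheat t j (x - y) * (T' y * g j y))"
      by (rule Bochner_Integration.integral_add[OF i1 i2])
    also have "(LINT y|lborel. dheat t j (x - y) * ((1 - T' y) * g j y)) = (LINT y|lborel. ddheat t j (x - y) * S y)"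
    \<comment> \<open>The time is 2t because both derivatives of the kernel at time t are dominated
      by the kernel at time 2t; \<open>M\<close> is the sum of the two constants.\<close>
    proof (rule heat_kernel_ibp[symmetric, where t="2 * t" and M="K / sqrt t + K / t" and B="2 * a + 2 * B" and j=j])
      show "\<bar>dheat t j z\<bar> \<le> (K / sqrt t + K / t) * heat (2 * t) z" for z
      proof -
        have "\<bar>dheat t j z\<bar> \<le> K / sqrt t * heat (2 * t) z" by (rule dheat_le_K[OF t])
        moreover have "0 \<le> K / t * heat (2 * t) z" using t K_pos by simp
        ultimately show ?thesis unfolding distrib_right by linarith
      qed
      show "\<bar>ddheat t j z\<bar> \<le> (K / sqrt t + K / t) * heat (2 * t) z" for z
      proof -
        have "\<bar>ddheat t j z\<bar> \<le> K / t * heat (2 * t) z" by (rule ddheat_le_K[OF t])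
        moreover have "0 \<le> K / sqrt t * heat (2 * t) z" using t K_pos by simp
        ultimately show ?thesis unfolding distrib_right by linarith
      qed
      show "\<bar>S y\<bar> \<le> 2 * a + 2 * B" for y
        using Sb[of y] w_bd[of y] B0 a by (auto split: if_splits)
      show "\<bar>(1 - T' y) * g j y\<bar> \<le> 2 * a + 2 * B" for y
        using gB[of "1 - T' y" j y] T'[of y] B0 a by auto
      show "((\<lambda>h. dheat t j (z + h *\<^sub>R axis j 1)) has_vector_derivative ddheat t j z) (at 0)" for z
        by (rule dheat_directional[OF t])
    qed (use t dS in auto)
    finally show ?thesis .
  qed
  have 1: "ennreal \<bar>LINT y|lborel. ddheat t j (x - y) * S y\<bar> \<le> ennreal (K / t * (2 * a + 4 * K * A * \<beta> / sqrt t ^ ?n))" for j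
  proof -
    have Kt: "K / t \<ge> 0" using K_pos t by simp
    have "ennreal \<bar>LINT y|lborel. ddheat t j (x - y) * S y\<bar> \<le> (\<integral>\<^sup>+y. ennreal \<bar>ddheat t j (x - y) * S y\<bar> \<partial>lborel)"
      using ennreal_norm_integral_le[of lborel "\<lambda>y. ddheat t j (x - y) * S y"] by simp
    \<comment> \<open>The part of \<open>S\<close> bounded by 2a meets a kernel of mass 1. The large
      values are only controlled in L^1, by \<open>potential_tail_le\<close>, and meet the supremum
      of the kernel.\<close>
    also have "\<dots> \<le> (\<integral>\<^sup>+y. ennreal (K / t * (2 * a)) * ennreal (heat (2 * t) (x - y)) + ennreal (K / t * (1 / sqrt t ^ ?n)) * (ennreal \<bar>w y\<bar> * indicator {y. b < \<bar>w y\<bar>} y) \<partial>lborel)"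
    proof (intro nn_integral_mono)
      fix y
      let ?h = "heat (2 * t) (x - y)" and ?v = "if b < \<bar>w y\<bar> then \<bar>w y\<bar> else 0"
      have h0: "?h \<ge> 0" using t by simp
      have "\<bar>ddheat t j (x - y) * S y\<bar> \<le> (K / t * ?h) * (2 * a + ?v)"
        unfolding abs_mult using t K_pos by (intro mult_mono Sb ddheat_le_K) auto
      also have "\<dots> = K / t * (2 * a) * ?h + K / t * (?h * ?v)" by (simp add: algebra_simps)
      also have "\<dots> \<le> K / t * (2 * a) * ?h + K / t * ((1 / sqrt t ^ ?n) * ?v)"
        using Kt by (intro add_left_mono mult_left_mono mult_right_mono heat_double_le t) auto
      finally have "ennreal \<bar>ddheat t j (x - y) * S y\<bar> \<le> ennreal (K / t * (2 * a) * ?h + K / t * ((1 / sqrt t ^ ?n) * ?v))"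
        by (rule ennreal_leI)
      also have "\<dots> = ennreal (K / t * (2 * a)) * ennreal ?h + ennreal (K / t * (1 / sqrt t ^ ?n)) * (ennreal \<bar>w y\<bar> * indicator {y. b < \<bar>w y\<bar>} y)"
      proof -
        have "ennreal (K / t * (2 * a) * ?h) = ennreal (K / t * (2 * a)) * ennreal ?h" using a by (intro ennreal_mult' mult_nonneg_nonneg Kt) auto
        moreover have "ennreal (K / t * ((1 / sqrt t ^ ?n) * ?v)) = ennreal (K / t * (1 / sqrt t ^ ?n)) * ennreal ?v"
          unfolding mult.assoc[symmetric] using t by (intro ennreal_mult' mult_nonneg_nonneg Kt) auto
        moreover have "ennreal ?v = ennreal \<bar>w y\<bar> * indicator {y. b < \<bar>w y\<bar>} y" by (simp add: indicator_def)
        ultimately show ?thesis using K_pos a h0 t by (subst ennreal_plus) auto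
      qed
      finally show "ennreal \<bar>ddheat t j (x - y) * S y\<bar> \<le> ennreal (K / t * (2 * a)) * ennreal ?h + ennreal (K / t * (1 / sqrt t ^ ?n)) * (ennreal \<bar>w y\<bar> * indicator {y. b < \<bar>w y\<bar>} y)" .
    qed
    also have "\<dots> = ennreal (K / t * (2 * a)) * (\<integral>\<^sup>+y. ennreal (heat (2 * t) (x - y)) \<partial>lborel) + ennreal (K / t * (1 / sqrt t ^ ?n)) * (\<integral>\<^sup>+y\<in>{y. b < \<bar>w y\<bar>}. ennreal \<bar>w y\<bar> \<partial>lborel)"
      by (subst nn_integral_add, measurable, subst (1 2) nn_integral_cmult, measurable)
    also have "\<dots> \<le> ennreal (K / t * (2 * a)) * 1 + ennreal (K / t * (1 / sqrt t ^ ?n)) * ennreal (4 * K * A * \<beta>)"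
      using nn_integral_heat(1)[of "2 * t" x] t by (intro add_mono mult_left_mono potential_tail_le[OF \<beta> b]) auto
    also have "\<dots> = ennreal (K / t * (2 * a) + K / t * (1 / sqrt t ^ ?n) * (4 * K * A * \<beta>))"
      using Kt a t K_pos A \<beta> by (subst ennreal_mult'[symmetric]) auto
    also have "K / t * (2 * a) + K / t * (1 / sqrt t ^ ?n) * (4 * K * A * \<beta>) = K / t * (2 * a + 4 * K * A * \<beta> / sqrt t ^ ?n)"
      by (simp add: ring_distribs)
    finally show ?thesis .
  qed
  have "\<bar>Phi t x\<bar> \<le> (\<Sum>j\<in>UNIV. \<bar>LINT y|lborel. ddheat t j (x - y) * S y\<bar>) + \<bar>\<Sum>j\<in>UNIV. LINT y|lborel. dheat t j (x - y) * (T' y * g j y)\<bar>"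
    unfolding Phi_def split sum.distrib by (rule order.trans[OF abs_triangle_ineq add_right_mono[OF sum_abs]])
  then have "ennreal \<bar>Phi t x\<bar> \<le> ennreal ((\<Sum>j\<in>UNIV. \<bar>LINT y|lborel. ddheat t j (x - y) * S y\<bar>) + \<bar>\<Sum>j\<in>UNIV. LINT y|lborel. dheat t j (x - y) * (T' y * g j y)\<bar>)"
    by (rule ennreal_leI)
  also have "\<dots> = (\<Sum>j\<in>UNIV. ennreal \<bar>LINT y|lborel. ddheat t j (x - y) * S y\<bar>) + ennreal \<bar>\<Sum>j\<in>UNIV. LINT y|lborel. dheat t j (x - y) * (T' y * g j y)\<bar>"
    by (subst ennreal_plus) (auto intro!: sum_nonneg simp: sum_ennreal)
  also have "\<dots> \<le> (\<Sum>j\<in>(UNIV::'n set). ennreal (K / t * (2 * a + 4 * K * A * \<beta> / sqrt t ^ ?n))) + (\<integral>\<^sup>+y. ennreal (K / sqrt t * heat (2 * t) (x - y) * (gn y * indicator {y. a \<le> \<bar>w y\<bar> \<and> \<bar>w y\<bar> \<le> 2 * b} y)) \<partial>lborel)"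
  proof (intro add_mono sum_mono 1 dheat_integral_le t)
    fix y
    show "(\<Sum>j\<in>UNIV. \<bar>T' y * g j y\<bar>) \<le> gn y * indicator {y. a \<le> \<bar>w y\<bar> \<and> \<bar>w y\<bar> \<le> 2 * b} y"
    proof (cases "a \<le> \<bar>w y\<bar> \<and> \<bar>w y\<bar> \<le> 2 * b")
      case True
      have "(\<Sum>j\<in>UNIV. \<bar>T' y * g j y\<bar>) \<le> gn y"
        using T'(1,2)[of y] by (intro sum_mono) (auto simp: abs_mult intro!: mult_left_le_one_le)
      then show ?thesis using True by simp
    next
      case False then show ?thesis using T'(3)[of y] by (simp add: indicator_def)
    qed
  qed measurable
  also have "(\<Sum>j\<in>(UNIV::'n set). ennreal (K / t * (2 * a + 4 * K * A * \<beta> / sqrt t ^ ?n))) = ennreal (real ?n * K / t * (2 * a + 4 * K * A * \<beta> / sqrt t ^ ?n))"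
  proof -
    have "0 \<le> K / t * (2 * a + 4 * K * A * \<beta> / sqrt t ^ ?n)" using K_pos t a A \<beta> by (intro mult_nonneg_nonneg add_nonneg_nonneg) auto
    then show ?thesis by (subst sum_ennreal) (auto simp: mult.assoc)
  qed
  finally show ?thesis .
qed

end

section \<open>Superlevel sets\<close>

text \<open>The admissible \<tau> form an interval whose endpoints have the ratio (h/l)^(1/k). The
  measure d\<tau>/\<tau> sees only this ratio, so the bound does not depend on W.\<close>

lemma nn_integral_inverse_le:
  fixes l h W k :: real
  assumes lh: "0 < l" "l \<le> h" and W: "W \<ge> 0" and k: "k > 0"
  shows "(\<integral>\<^sup>+\<tau>\<in>{0<..}. ennreal (1 / \<tau>) * indicator {\<tau>. l \<le> W * \<tau> powr - k \<and> W * \<tau> powr - k \<le> h} \<tau> \<partial>lborel) \<le> ennreal (ln (h / l) / k)"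
proof (cases "W = 0")
  case True
  then show ?thesis using lh by simp
next
  case False
  then have W: "W > 0" using assms by simp
  define p0 p1 where "p0 = (W / h) powr (1 / k)" and "p1 = (W / l) powr (1 / k)"
  have p: "0 < p0" "p0 \<le> p1" using W lh k by (auto simp: p0_def p1_def intro!: powr_mono2 divide_left_mono)
  have "(\<integral>\<^sup>+\<tau>\<in>{0<..}. ennreal (1 / \<tau>) * indicator {\<tau>. l \<le> W * \<tau> powr - k \<and> W * \<tau> powr - k \<le> h} \<tau> \<partial>lborel)
    \<le> (\<integral>\<^sup>+\<tau>\<in>{p0..p1}. ennreal (1 / \<tau>) \<partial>lborel)"
  proof (intro nn_integral_mono)
    fix \<tau> :: real
    have "p0 \<le> \<tau> \<and> \<tau> \<le> p1" if \<tau>: "\<tau> > 0" "l \<le> W * \<tau> powr - k" "W * \<tau> powr - k \<le> h"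
    proof
      have "\<tau> powr k > 0" using \<tau> by simp
      then have a: "W / h \<le> \<tau> powr k" "\<tau> powr k \<le> W / l" using \<tau> lh by (auto simp: powr_minus field_simps)
      have e: "(\<tau> powr k) powr (1 / k) = \<tau>" using \<tau> k by (simp add: powr_powr)
      show "p0 \<le> \<tau>" unfolding p0_def by (subst e[symmetric], rule powr_mono2) (use a W lh k in auto)
      show "\<tau> \<le> p1" unfolding p1_def by (subst e[symmetric], rule powr_mono2) (use a W lh k in auto)
    qed
    then show "ennreal (1 / \<tau>) * indicator {\<tau>. l \<le> W * \<tau> powr - k \<and> W * \<tau> powr - k \<le> h} \<tau> * indicator {0<..} \<tau> \<le> ennreal (1 / \<tau>) * indicator {p0..p1} \<tau>"
      by (auto simp: indicator_def)
  qed
  also have "\<dots> = ennreal (ln p1 - ln p0)"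
    by (rule nn_integral_FTC_Icc) (use p in \<open>auto intro!: derivative_eq_intros simp: has_real_derivative_iff_has_vector_derivative[symmetric]\<close>)
  also have "ln p1 - ln p0 = ln (h / l) / k"
    unfolding p0_def p1_def using W lh by (simp add: ln_powr ln_div diff_divide_distrib[symmetric])
  finally show ?thesis .
qed

lemma nn_integral_scale:
  fixes f :: "real \<Rightarrow> ennreal"
  assumes [measurable]: "f \<in> borel_measurable borel" and "c > 0"
  shows "(\<integral>\<^sup>+t. f t \<partial>lborel) = ennreal c * (\<integral>\<^sup>+t. f (c * t) \<partial>lborel)"
  using nn_integral_real_affine[of f c 0] assms by simp

text \<open>Times beyond \<open>\<kappa> R\<^sup>2\<close> are estimated by the total mass alone; before, values of the potential below
  \<open>\<delta> \<theta> A R\<^bsup>1-n\<^esup>\<close> are discarded.\<close>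
locale sobolev_levels = gradient_field w g B A K
  for w :: "real^'n::finite \<Rightarrow> real" and g :: "'n \<Rightarrow> real^'n \<Rightarrow> real" and B A K :: real +
  fixes u :: "real^'n \<Rightarrow> real" and s s' \<Gamma> \<kappa> \<delta> :: real
  assumes s: "0 < s'" "s' < s" "s < 1" and \<Gamma>: "\<Gamma> > 0"
    and u_le: "\<And>x. ennreal (\<Gamma> * \<bar>u x\<bar>) \<le> (\<integral>\<^sup>+t\<in>{0<..}. ennreal (t powr ((s - 1) / 2) * \<bar>\<Sum>j\<in>UNIV. LINT y|lborel. dheat t j (x - y) * g j y\<bar>) \<partial>lborel)"
    and \<kappa>: "\<kappa> \<ge> 1" "2 * K / (CARD('n) - s) * \<kappa> powr (- (CARD('n) - s) / 2) \<le> \<Gamma> / 4"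
    and \<delta>: "0 < \<delta>" "\<delta> \<le> 1" "\<delta> * \<kappa> ^ (CARD('n) * (CARD('n) - 1) + 1) \<le> 1"
      "\<delta> * (CARD('n) * K * (4 * \<kappa> powr ((s + 1) / 2) / (s + 1) + 8 * K * \<kappa> powr ((s + CARD('n) - 1) / 2) / (s + CARD('n) - 1))) \<le> \<Gamma> / 4"
begin

text \<open>\<open>\<theta> = t / R\<^sup>2\<close> is the time relative to the natural scale \<open>R\<close> of the level \<open>\<lambda> = A R\<^bsup>s-n\<^esup>\<close>.\<close>
definition "lo \<theta> = \<delta> * \<theta>"
text \<open>In units of A R^(1-n) this is twice the height b that belongs to \<beta> = \<delta> R
  \<theta>^n in \<open>Phi_truncated_le\<close>. The power \<theta>^n in \<beta> outweighs the
  factor t^(-n/2) that multiplies \<beta> there.\<close>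

definition "hi \<theta> = 8 * K / (\<delta> * \<theta> ^ CARD('n)) ^ (CARD('n) - 1)"
definition "mid R \<theta> = {y. lo \<theta> \<le> \<bar>w y\<bar> * R ^ (CARD('n) - 1) / A \<and> \<bar>w y\<bar> * R ^ (CARD('n) - 1) / A \<le> hi \<theta>}"

text \<open>The third condition on \<delta> yields 2 lo <= hi, which is a <= b in
  \<open>Phi_truncated_le\<close>. The ratio matters because the integral over the levels sees its
  logarithm; it is a mere power of 1/\<theta>.\<close>

lemma lo_hi:
  assumes "0 < \<theta>" "\<theta> \<le> \<kappa>"
  shows "0 < lo \<theta>" "2 * lo \<theta> \<le> hi \<theta>" "lo \<theta> \<le> hi \<theta>" "hi \<theta> / lo \<theta> = 8 * K / \<delta> ^ CARD('n) * (1 / \<theta> ^ (CARD('n) * (CARD('n) - 1) + 1))"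
proof -
  let ?n = "CARD('n)"
  have n: "?n = Suc (?n - 1)" using dim by simp
  show l: "0 < lo \<theta>" using assms \<delta> by (simp add: lo_def)
  show e: "hi \<theta> / lo \<theta> = 8 * K / \<delta> ^ ?n * (1 / \<theta> ^ (?n * (?n - 1) + 1))"
  proof -
    have "(\<delta> * \<theta> ^ ?n) ^ (?n - 1) * (\<delta> * \<theta>) = (\<delta> ^ (?n - 1) * \<delta>) * (\<theta> ^ (?n * (?n - 1)) * \<theta>)"
      by (simp add: power_mult_distrib power_mult mult_ac)
    also have "\<delta> ^ (?n - 1) * \<delta> = \<delta> ^ ?n" by (subst (2) n) (simp only: power_Suc mult.commute)
    also have "\<theta> ^ (?n * (?n - 1)) * \<theta> = \<theta> ^ (?n * (?n - 1) + 1)" by simp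
    finally show ?thesis unfolding hi_def lo_def divide_divide_eq_left by simp
  qed
  have "\<delta> ^ ?n \<le> \<delta> ^ 1" using \<delta> dim by (intro power_decreasing) auto
  moreover have "\<theta> ^ (?n * (?n - 1) + 1) \<le> \<kappa> ^ (?n * (?n - 1) + 1)" using assms by (intro power_mono) auto
  ultimately have "\<delta> ^ ?n * \<theta> ^ (?n * (?n - 1) + 1) \<le> \<delta> * \<kappa> ^ (?n * (?n - 1) + 1)" using \<delta> assms by (intro mult_mono) auto
  then have "\<delta> ^ ?n * \<theta> ^ (?n * (?n - 1) + 1) \<le> 1" using \<delta> by simp
  then have "2 * 1 \<le> 8 * K * (1 / (\<delta> ^ ?n * \<theta> ^ (?n * (?n - 1) + 1)))"
    using K_ge \<delta> assms by (intro mult_mono) (auto simp: le_divide_eq)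
  then have "2 \<le> hi \<theta> / lo \<theta>" unfolding e by simp
  then show "2 * lo \<theta> \<le> hi \<theta>" using l by (simp add: le_divide_eq)
  then show "lo \<theta> \<le> hi \<theta>" using l by simp
qed

lemma mid_measurable [measurable]:
  assumes [measurable]: "f \<in> borel_measurable M" "h \<in> borel_measurable M" "r \<in> borel_measurable M"
  shows "(\<lambda>z. indicator (mid (r z) (f z)) (h z) :: real) \<in> borel_measurable M"
    "(\<lambda>z. indicator (mid (r z) (f z)) (h z) :: ennreal) \<in> borel_measurable M"
proof -
  have [measurable]: "Measurable.pred M (\<lambda>z. h z \<in> mid (r z) (f z))"
    unfolding mid_def lo_def hi_def mem_Collect_eq by measurable
  show "(\<lambda>z. indicator (mid (r z) (f z)) (h z) :: real) \<in> borel_measurable M"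
    "(\<lambda>z. indicator (mid (r z) (f z)) (h z) :: ennreal) \<in> borel_measurable M"
    unfolding indicator_def by measurable
qed

lemma Phi_scaled_le:
  assumes R: "R > 0" and t: "0 < t" "t \<le> \<kappa> * R\<^sup>2"
  shows "ennreal \<bar>Phi t x\<bar> \<le>
    ennreal (CARD('n) * K / t * (2 * (\<delta> * A * (t / R\<^sup>2) / R ^ (CARD('n) - 1)) + 4 * K * A * (\<delta> * R * (t / R\<^sup>2) ^ CARD('n)) / sqrt t ^ CARD('n)))
    + (\<integral>\<^sup>+y. ennreal (K / sqrt t * heat (2 * t) (x - y) * (gn y * indicator (mid R (t / R\<^sup>2)) y)) \<partial>lborel)"
proof -
  let ?n = "CARD('n)" and ?\<theta> = "t / R\<^sup>2"
  have \<theta>: "0 < ?\<theta>" "?\<theta> \<le> \<kappa>" using R t by (auto simp: divide_le_eq)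
  define a where "a = lo ?\<theta> * A / R ^ (?n - 1)"
  \<comment> \<open>Half of \<open>hi\<close>, because truncation at height b retains values up to
    2b.\<close>
  define b where "b = hi ?\<theta> / 2 * A / R ^ (?n - 1)"
  define \<beta> where "\<beta> = \<delta> * R * ?\<theta> ^ ?n"
  have "lo ?\<theta> \<le> hi ?\<theta> / 2" using lo_hi(2)[OF \<theta>] by simp
  then have "a \<le> b" unfolding a_def b_def using A R by (intro divide_right_mono mult_right_mono) auto
  moreover have "a > 0" using lo_hi(1)[OF \<theta>] A R by (simp add: a_def)
  ultimately have a0: "a > 0" "a \<le> b" by auto
  have "b = 4 * K * A / \<beta> ^ (?n - 1)" unfolding b_def \<beta>_def hi_def by (simp add: power_mult_distrib mult_ac)
  moreover have "\<beta> > 0" using \<delta> R \<theta> by (simp add: \<beta>_def)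
  ultimately have "ennreal \<bar>Phi t x\<bar> \<le> ennreal (?n * K / t * (2 * a + 4 * K * A * \<beta> / sqrt t ^ ?n))
    + (\<integral>\<^sup>+y. ennreal (K / sqrt t * heat (2 * t) (x - y) * (gn y * indicator {y. a \<le> \<bar>w y\<bar> \<and> \<bar>w y\<bar> \<le> 2 * b} y)) \<partial>lborel)"
    using Phi_truncated_le[OF t(1) a0, of \<beta> x] by blast
  moreover have "{y. a \<le> \<bar>w y\<bar> \<and> \<bar>w y\<bar> \<le> 2 * b} = mid R ?\<theta>"
    unfolding a_def b_def mid_def using A R by (auto simp: field_simps)
  moreover have "a = \<delta> * A * (t / R\<^sup>2) / R ^ (?n - 1)" unfolding a_def lo_def by simp
  ultimately show ?thesis unfolding \<beta>_def by simp
qed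

lemma powr_sq: "R > 0 \<Longrightarrow> (c * R\<^sup>2) powr e = c powr e * R powr (2 * e)" if "c \<ge> 0" for c R e :: real
  using that powr_powr[of R 2 e] by (simp add: powr_mult)

text \<open>Without the powers of \<theta> in the cut-off heights both integrands would diverge at
  0. With them the exponents are (s+1)/2 - 1 and (s+n-1)/2 - 1, and integration up to \<kappa> R^2
  makes both terms multiples of A R^(s-n). The last condition on \<delta> bounds the sum of their
  coefficients.\<close>

lemma low_high_contribution:
  assumes R: "R > 0"
  shows "(\<integral>\<^sup>+t\<in>{0<..\<kappa> * R\<^sup>2}. ennreal (t powr ((s - 1) / 2) * (CARD('n) * K / t * (2 * (\<delta> * A * (t / R\<^sup>2) / R ^ (CARD('n) - 1)) + 4 * K * A * (\<delta> * R * (t / R\<^sup>2) ^ CARD('n)) / sqrt t ^ CARD('n)))) \<partial>lborel)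
    \<le> ennreal (\<Gamma> / 4 * (A * R powr (s - CARD('n))))"
proof -
  let ?n = "CARD('n)" and ?N = "real CARD('n)"
  define c1 where "c1 = ?N * K * (2 * \<delta> * A) * R powr (- 2 - (?N - 1))"
  define c2 where "c2 = ?N * K * (4 * K * A * \<delta>) * R powr (1 - 2 * ?N)"
  have c: "c1 \<ge> 0" "c2 \<ge> 0" using K_pos A \<delta> by (auto simp: c1_def c2_def)
  have e: "0 < (s + 1) / 2" "0 < (s + ?N - 1) / 2" using s dim by auto
  have eq: "t powr ((s - 1) / 2) * (?N * K / t * (2 * (\<delta> * A * (t / R\<^sup>2) / R ^ (?n - 1)) + 4 * K * A * (\<delta> * R * (t / R\<^sup>2) ^ ?n) / sqrt t ^ ?n))
     = c1 * t powr ((s + 1) / 2 - 1) + c2 * t powr ((s + ?N - 1) / 2 - 1)" if t: "t > 0" for t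
  proof -
    have R2: "1 / R\<^sup>2 = R powr - 2" using R by (simp add: powr_minus inverse_eq_divide powr_numeral)
    have Rn: "1 / R ^ (?n - 1) = R powr (- (?N - 1))"
    proof -
      have "R ^ (?n - 1) = R powr (?N - 1)" using R dim by (simp add: powr_realpow[symmetric] of_nat_diff)
      then show ?thesis by (simp only: powr_minus inverse_eq_divide)
    qed
    have 1: "?N * K / t * (2 * (\<delta> * A * (t / R\<^sup>2) / R ^ (?n - 1))) = c1"
    proof -
      have "?N * K / t * (2 * (\<delta> * A * (t / R\<^sup>2) / R ^ (?n - 1))) = ?N * K * (2 * \<delta> * A) * (1 / R\<^sup>2 * (1 / R ^ (?n - 1)))"
        using t by simp
      also have "1 / R\<^sup>2 * (1 / R ^ (?n - 1)) = R powr (- 2 - (?N - 1))"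
        unfolding R2 Rn by (simp flip: powr_add)
      finally show ?thesis by (simp only: c1_def)
    qed
    have tn: "t ^ ?n = t powr ?N" "sqrt t ^ ?n = t powr (?N / 2)"
    proof -
      show "t ^ ?n = t powr ?N" using t by (simp add: powr_realpow)
      have "sqrt t ^ ?n = (t powr (1/2)) powr ?N" using t by (simp add: powr_half_sqrt powr_realpow)
      then show "sqrt t ^ ?n = t powr (?N / 2)" by (simp add: powr_powr)
    qed
    have 2: "?N * K / t * (4 * K * A * (\<delta> * R * (t / R\<^sup>2) ^ ?n) / sqrt t ^ ?n) = c2 * t powr (?N / 2 - 1)"
    proof -
      have "?N * K / t * (4 * K * A * (\<delta> * R * (t / R\<^sup>2) ^ ?n) / sqrt t ^ ?n) = ?N * K * (4 * K * A * \<delta>) * (R * (1 / R\<^sup>2) ^ ?n) * (t ^ ?n / (sqrt t ^ ?n * t))"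
          by (simp only: power_mult_distrib divide_inverse inverse_mult_distrib mult_1_left mult_ac)
      also have "R * (1 / R\<^sup>2) ^ ?n = R powr (1 - 2 * ?N)"
      proof -
        have "(R powr - 2) ^ ?n = (R powr - 2) powr ?N" using R by (simp add: powr_realpow)
        then have "(1 / R\<^sup>2) ^ ?n = R powr (- 2 * ?N)" unfolding R2 by (simp add: powr_powr)
        moreover have "R = R powr 1" using R by simp
        ultimately show ?thesis by (metis powr_add diff_conv_add_uminus mult_minus_left)
      qed
      also have "t ^ ?n / (sqrt t ^ ?n * t) = t powr (?N / 2 - 1)"
      proof -
        have "t powr ?N / (t powr (?N / 2) * t powr 1) = t powr (?N - (?N / 2 + 1))"
          by (simp only: powr_add powr_diff)
        moreover have "?N - (?N / 2 + 1) = ?N / 2 - 1" by simp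
        ultimately show ?thesis unfolding tn using t by (simp only: powr_one)
      qed
      finally show ?thesis by (simp only: c2_def)
    qed
    have "t powr ((s - 1) / 2) * (?N * K / t * (2 * (\<delta> * A * (t / R\<^sup>2) / R ^ (?n - 1)) + 4 * K * A * (\<delta> * R * (t / R\<^sup>2) ^ ?n) / sqrt t ^ ?n))
      = t powr ((s - 1) / 2) * (c1 + c2 * t powr (?N / 2 - 1))" by (subst distrib_left[of "?N * K / t"]) (simp only: 1 2)
    also have "\<dots> = c1 * t powr ((s - 1) / 2) + c2 * (t powr ((s - 1) / 2) * t powr (?N / 2 - 1))" by (simp add: algebra_simps)
    also have "t powr ((s - 1) / 2) * t powr (?N / 2 - 1) = t powr ((s - 1) / 2 + (?N / 2 - 1))" by (simp only: powr_add)
    also have "(s - 1) / 2 + (?N / 2 - 1) = (s + ?N - 1) / 2 - 1" by (simp add: field_simps)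
    also have "c1 * t powr ((s - 1) / 2) = c1 * t powr ((s + 1) / 2 - 1)"
      by (rule arg_cong[where f="\<lambda>e. c1 * t powr e"]) (simp add: field_simps)
    finally show ?thesis .
  qed
  have "(\<integral>\<^sup>+t\<in>{0<..\<kappa> * R\<^sup>2}. ennreal (t powr ((s - 1) / 2) * (?N * K / t * (2 * (\<delta> * A * (t / R\<^sup>2) / R ^ (?n - 1)) + 4 * K * A * (\<delta> * R * (t / R\<^sup>2) ^ ?n) / sqrt t ^ ?n))) \<partial>lborel)
    = (\<integral>\<^sup>+t. ennreal c1 * (ennreal (t powr ((s + 1) / 2 - 1)) * indicator {0<..\<kappa> * R\<^sup>2} t) + ennreal c2 * (ennreal (t powr ((s + ?N - 1) / 2 - 1)) * indicator {0<..\<kappa> * R\<^sup>2} t) \<partial>lborel)"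
  proof (intro nn_integral_cong)
    fix t :: real
    show "ennreal (t powr ((s - 1) / 2) * (?N * K / t * (2 * (\<delta> * A * (t / R\<^sup>2) / R ^ (?n - 1)) + 4 * K * A * (\<delta> * R * (t / R\<^sup>2) ^ ?n) / sqrt t ^ ?n))) * indicator {0<..\<kappa> * R\<^sup>2} t
      = ennreal c1 * (ennreal (t powr ((s + 1) / 2 - 1)) * indicator {0<..\<kappa> * R\<^sup>2} t) + ennreal c2 * (ennreal (t powr ((s + ?N - 1) / 2 - 1)) * indicator {0<..\<kappa> * R\<^sup>2} t)"
    proof (cases "t \<in> {0<..\<kappa> * R\<^sup>2}")
      case True
      then have "t > 0" by simp
      then show ?thesis unfolding eq[OF \<open>t > 0\<close>] using True c
        by (subst ennreal_plus) (auto simp: ennreal_mult')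
    qed simp
  qed
  also have "\<dots> = ennreal c1 * ennreal ((\<kappa> * R\<^sup>2) powr ((s + 1) / 2) / ((s + 1) / 2)) + ennreal c2 * ennreal ((\<kappa> * R\<^sup>2) powr ((s + ?N - 1) / 2) / ((s + ?N - 1) / 2))"
  proof -
    have k0: "\<kappa> * R\<^sup>2 \<ge> 0" using \<kappa> by simp
    show ?thesis
      by (subst nn_integral_add, measurable, subst (1 2) nn_integral_cmult, measurable)
         (simp only: nn_integral_powr_from_0[OF e(1) k0] nn_integral_powr_from_0[OF e(2) k0])
  qed
  also have "\<dots> = ennreal (c1 * ((\<kappa> * R\<^sup>2) powr ((s + 1) / 2) / ((s + 1) / 2)) + c2 * ((\<kappa> * R\<^sup>2) powr ((s + ?N - 1) / 2) / ((s + ?N - 1) / 2)))"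
    unfolding ennreal_mult'[OF c(1), symmetric] ennreal_mult'[OF c(2), symmetric]
    by (rule ennreal_plus[symmetric]) (use c e in auto)
  also have "c1 * ((\<kappa> * R\<^sup>2) powr ((s + 1) / 2) / ((s + 1) / 2)) + c2 * ((\<kappa> * R\<^sup>2) powr ((s + ?N - 1) / 2) / ((s + ?N - 1) / 2))
    = \<delta> * (?N * K * (4 * \<kappa> powr ((s + 1) / 2) / (s + 1) + 8 * K * \<kappa> powr ((s + ?N - 1) / 2) / (s + ?N - 1))) * (A * R powr (s - ?N))"
  proof -
    have k0: "\<kappa> \<ge> 0" using \<kappa> by simp
    have 1: "R powr (- 2 - (?N - 1)) * R powr (2 * ((s + 1) / 2)) = R powr (s - ?N)"
      unfolding powr_add[symmetric] by (rule arg_cong[where f="\<lambda>e. R powr e"]) (simp add: field_simps)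
    have 2: "R powr (1 - 2 * ?N) * R powr (2 * ((s + ?N - 1) / 2)) = R powr (s - ?N)"
      unfolding powr_add[symmetric] by (rule arg_cong[where f="\<lambda>e. R powr e"]) (simp add: field_simps)
    have h1: "c1 * ((\<kappa> * R\<^sup>2) powr ((s + 1) / 2) / ((s + 1) / 2)) = ?N * K * (2 * \<delta> * A) * (\<kappa> powr ((s + 1) / 2) / ((s + 1) / 2)) * (R powr (- 2 - (?N - 1)) * R powr (2 * ((s + 1) / 2)))"
      unfolding c1_def powr_sq[OF k0 R] by (simp only: mult_ac times_divide_eq_right times_divide_eq_left)
    have h2: "c2 * ((\<kappa> * R\<^sup>2) powr ((s + ?N - 1) / 2) / ((s + ?N - 1) / 2)) = ?N * K * (4 * K * A * \<delta>) * (\<kappa> powr ((s + ?N - 1) / 2) / ((s + ?N - 1) / 2)) * (R powr (1 - 2 * ?N) * R powr (2 * ((s + ?N - 1) / 2)))"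
      unfolding c2_def powr_sq[OF k0 R] by (simp only: mult_ac times_divide_eq_right times_divide_eq_left)
    show ?thesis unfolding h1 h2 1 2 by (simp add: algebra_simps)
  qed
  also have "ennreal (\<delta> * (?N * K * (4 * \<kappa> powr ((s + 1) / 2) / (s + 1) + 8 * K * \<kappa> powr ((s + ?N - 1) / 2) / (s + ?N - 1))) * (A * R powr (s - ?N)))
    \<le> ennreal (\<Gamma> / 4 * (A * R powr (s - ?N)))"
    using \<delta>(4) A by (intro ennreal_leI mult_right_mono) auto
  finally show ?thesis .
qed

text \<open>The integrand is a multiple of t^(-(n-s)/2 - 1), so the tail carries the factor
  \<kappa>^(-(n-s)/2), which the condition on \<kappa> makes small.\<close>

lemma late_contribution:
  assumes R: "R > 0"
  shows "(\<integral>\<^sup>+t\<in>{\<kappa> * R\<^sup>2..}. ennreal (t powr ((s - 1) / 2) * (K * A * (1 / sqrt t ^ (CARD('n) + 1)))) \<partial>lborel) \<le> ennreal (\<Gamma> / 4 * (A * R powr (s - CARD('n))))"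
proof -
  let ?N = "real CARD('n)"
  have k: "\<kappa> * R\<^sup>2 > 0" using \<kappa> R by simp
  have e: "(?N - s) / 2 > 0" using s dim by simp
  have "(\<integral>\<^sup>+t\<in>{\<kappa> * R\<^sup>2..}. ennreal (t powr ((s - 1) / 2) * (K * A * (1 / sqrt t ^ (CARD('n) + 1)))) \<partial>lborel)
    = (\<integral>\<^sup>+t. ennreal (K * A) * (ennreal (t powr (- ((?N - s) / 2) - 1)) * indicator {\<kappa> * R\<^sup>2..} t) \<partial>lborel)"
  proof (intro nn_integral_cong)
    fix t :: real
    show "ennreal (t powr ((s - 1) / 2) * (K * A * (1 / sqrt t ^ (CARD('n) + 1)))) * indicator {\<kappa> * R\<^sup>2..} t = ennreal (K * A) * (ennreal (t powr (- ((?N - s) / 2) - 1)) * indicator {\<kappa> * R\<^sup>2..} t)"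
    proof (cases "t \<in> {\<kappa> * R\<^sup>2..}")
      case True
      then have t: "t > 0" using k by simp
      have "sqrt t ^ (CARD('n) + 1) = (t powr (1/2)) powr (?N + 1)"
        using t powr_realpow[of "sqrt t" "CARD('n) + 1"] by (simp only: powr_half_sqrt of_nat_add of_nat_1 real_sqrt_gt_zero less_imp_le)
      then have "1 / sqrt t ^ (CARD('n) + 1) = t powr - (1/2 * (?N + 1))"
        by (simp only: powr_powr powr_minus inverse_eq_divide)
      then have "t powr ((s - 1) / 2) * (1 / sqrt t ^ (CARD('n) + 1)) = t powr ((s - 1) / 2 + - (1/2 * (?N + 1)))"
        by (simp only: powr_add)
      also have "(s - 1) / 2 + - (1/2 * (?N + 1)) = - ((?N - s) / 2) - 1" by (simp add: field_simps)
      finally have "t powr ((s - 1) / 2) * (K * A * (1 / sqrt t ^ (CARD('n) + 1))) = K * A * t powr (- ((?N - s) / 2) - 1)" by (simp only: mult_ac)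
      then show ?thesis using True K_pos A by (simp add: ennreal_mult')
    qed simp
  qed
  also have "\<dots> = ennreal (K * A) * ennreal ((\<kappa> * R\<^sup>2) powr - ((?N - s) / 2) / ((?N - s) / 2))"
    by (subst nn_integral_cmult, measurable) (simp only: nn_integral_powr_to_inf[OF e k])
  also have "\<dots> = ennreal (K * A * ((\<kappa> * R\<^sup>2) powr - ((?N - s) / 2) / ((?N - s) / 2)))"
    using K_pos A by (intro ennreal_mult'[symmetric]) auto
  also have "K * A * ((\<kappa> * R\<^sup>2) powr - ((?N - s) / 2) / ((?N - s) / 2)) = 2 * K / (?N - s) * \<kappa> powr (- (?N - s) / 2) * (A * R powr (s - ?N))"
  proof -
    have k0: "\<kappa> \<ge> 0" using \<kappa> by simp
    have 1: "(\<kappa> * R\<^sup>2) powr - ((?N - s) / 2) = \<kappa> powr (- (?N - s) / 2) * R powr (s - ?N)"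
    proof -
      have "2 * - ((?N - s) / 2) = s - ?N" "- ((?N - s) / 2) = - (?N - s) / 2" by (simp_all add: field_simps)
      then show ?thesis unfolding powr_sq[OF k0 R] by (simp only:)
    qed
    show ?thesis unfolding 1 by simp
  qed
  also have "ennreal \<dots> \<le> ennreal (\<Gamma> / 4 * (A * R powr (s - ?N)))"
    using \<kappa>(2) A by (intro ennreal_leI mult_right_mono) auto
  finally show ?thesis .
qed

text \<open>A budget: the discarded values and the late times account for at most a quarter of
  \<Gamma> times the level each. Were the retained part at most one half, \<open>u_le\<close> would
  put |u x| at or below the level.\<close>

lemma superlevel_mass:
  assumes R: "R > 0" and x: "\<bar>u x\<bar> > A * R powr (s - CARD('n))"
  shows "ennreal (\<Gamma> / 2 * (A * R powr (s - CARD('n)))) <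
    (\<integral>\<^sup>+t\<in>{0<..\<kappa> * R\<^sup>2}. ennreal (t powr ((s - 1) / 2)) * (\<integral>\<^sup>+y. ennreal (K / sqrt t * heat (2 * t) (x - y) * (gn y * indicator (mid R (t / R\<^sup>2)) y)) \<partial>lborel) \<partial>lborel)"
    (is "_ < ?M")
proof (rule ccontr)
  let ?n = "CARD('n)" and ?lam = "A * R powr (s - CARD('n))"
  let ?P = "\<lambda>t. CARD('n) * K / t * (2 * (\<delta> * A * (t / R\<^sup>2) / R ^ (CARD('n) - 1)) + 4 * K * A * (\<delta> * R * (t / R\<^sup>2) ^ CARD('n)) / sqrt t ^ CARD('n))"
  let ?Q = "\<lambda>t. (\<integral>\<^sup>+y. ennreal (K / sqrt t * heat (2 * t) (x - y) * (gn y * indicator (mid R (t / R\<^sup>2)) y)) \<partial>lborel)"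
  have [measurable]: "?Q \<in> borel_measurable lborel"
  proof (rule lborel.borel_measurable_nn_integral)
    show "(\<lambda>(t, y). ennreal (K / sqrt t * heat (2 * t) (x - y) * (gn y * indicator (mid R (t / R\<^sup>2)) y))) \<in> borel_measurable (lborel \<Otimes>\<^sub>M lborel)"
      unfolding case_prod_beta by measurable
  qed
  assume "\<not> ennreal (\<Gamma> / 2 * ?lam) < ?M"
  then have M: "?M \<le> ennreal (\<Gamma> / 2 * ?lam)" by simp
  have l0: "?lam > 0" using A R by simp
  have "ennreal (\<Gamma> * \<bar>u x\<bar>) \<le> (\<integral>\<^sup>+t\<in>{0<..}. ennreal (t powr ((s - 1) / 2) * \<bar>Phi t x\<bar>) \<partial>lborel)"
    unfolding Phi_def by (rule u_le)
  also have "\<dots> \<le> (\<integral>\<^sup>+t. (ennreal (t powr ((s - 1) / 2) * ?P t) * indicator {0<..\<kappa> * R\<^sup>2} t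
      + ennreal (t powr ((s - 1) / 2) * (K * A * (1 / sqrt t ^ (?n + 1)))) * indicator {\<kappa> * R\<^sup>2..} t) + ennreal (t powr ((s - 1) / 2)) * ?Q t * indicator {0<..\<kappa> * R\<^sup>2} t \<partial>lborel)"
  proof (intro nn_integral_mono)
    fix t :: real
    show "ennreal (t powr ((s - 1) / 2) * \<bar>Phi t x\<bar>) * indicator {0<..} t \<le>
      (ennreal (t powr ((s - 1) / 2) * ?P t) * indicator {0<..\<kappa> * R\<^sup>2} t
      + ennreal (t powr ((s - 1) / 2) * (K * A * (1 / sqrt t ^ (?n + 1)))) * indicator {\<kappa> * R\<^sup>2..} t) + ennreal (t powr ((s - 1) / 2)) * ?Q t * indicator {0<..\<kappa> * R\<^sup>2} t"
    proof (cases "t > 0")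
      case t: True
      have m: "ennreal (t powr ((s - 1) / 2) * c) = ennreal (t powr ((s - 1) / 2)) * ennreal c" for c by (rule ennreal_mult') simp
      show ?thesis
      proof (cases "t \<le> \<kappa> * R\<^sup>2")
        case True
        have "ennreal (t powr ((s - 1) / 2)) * ennreal \<bar>Phi t x\<bar> \<le> ennreal (t powr ((s - 1) / 2)) * (ennreal (?P t) + ?Q t)"
          by (intro mult_left_mono Phi_scaled_le R t True) simp
        also have "\<dots> = ennreal (t powr ((s - 1) / 2) * ?P t) + ennreal (t powr ((s - 1) / 2)) * ?Q t" by (simp only: m distrib_left[of "ennreal (t powr ((s - 1) / 2))"])
        also have "\<dots> \<le> (ennreal (t powr ((s - 1) / 2) * ?P t)
          + ennreal (t powr ((s - 1) / 2) * (K * A * (1 / sqrt t ^ (?n + 1)))) * indicator {\<kappa> * R\<^sup>2..} t) + ennreal (t powr ((s - 1) / 2)) * ?Q t"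
          by (intro add_right_mono) (rule add_increasing2, simp_all)
        finally show ?thesis using t True by (simp only: m) simp
      next
        case False
        have "ennreal (t powr ((s - 1) / 2)) * ennreal \<bar>Phi t x\<bar> \<le> ennreal (t powr ((s - 1) / 2)) * ennreal (K * A * (1 / sqrt t ^ (?n + 1)))"
          by (intro mult_left_mono Phi_le_uniform t) simp
        then show ?thesis unfolding m using t False by simp
      qed
    qed simp
  qed
  also have "\<dots> = ((\<integral>\<^sup>+t\<in>{0<..\<kappa> * R\<^sup>2}. ennreal (t powr ((s - 1) / 2) * ?P t) \<partial>lborel)
      + (\<integral>\<^sup>+t\<in>{\<kappa> * R\<^sup>2..}. ennreal (t powr ((s - 1) / 2) * (K * A * (1 / sqrt t ^ (?n + 1)))) \<partial>lborel)) + ?M"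
    by (subst nn_integral_add, measurable, subst nn_integral_add, measurable)
  also have "\<dots> \<le> (ennreal (\<Gamma> / 4 * ?lam) + ennreal (\<Gamma> / 4 * ?lam)) + ennreal (\<Gamma> / 2 * ?lam)"
    by (intro add_mono low_high_contribution late_contribution R M)
  also have "\<dots> = ennreal (\<Gamma> * ?lam)"
  proof -
    have q: "0 \<le> \<Gamma> / 4 * ?lam" "0 \<le> \<Gamma> / 2 * ?lam" using \<Gamma> less_imp_le[OF l0] by (auto intro!: mult_nonneg_nonneg)
    have "\<Gamma> / 4 * ?lam + \<Gamma> / 4 * ?lam + \<Gamma> / 2 * ?lam = \<Gamma> * ?lam" by (simp add: field_simps)
    then show ?thesis
      unfolding ennreal_plus[OF q(1) q(1), symmetric] ennreal_plus[OF add_nonneg_nonneg[OF q(1) q(1)] q(2), symmetric] by (rule arg_cong)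
  qed
  finally have "\<Gamma> * \<bar>u x\<bar> \<le> \<Gamma> * ?lam" using \<Gamma> l0 by (simp add: ennreal_le_iff)
  then show False using x \<Gamma> by simp
qed

end

section \<open>The capacity of a single superlevel set\<close>

context sobolev_levels
begin

abbreviation (input) "\<gamma> \<equiv> (s - s') / 2"

text \<open>Dividing \<open>superlevel_mass\<close> by \<Gamma>/2 times the level gives a
  superposition of heat kernels above 1 on C, whose cost weighs time by t^(-s'/2). After t = R^2
  \<theta> the powers of R combine to R^2 R^(s-s'-2) R^(n-s) = R^(n-s').\<close>

lemma capacity_superlevel_le:
  assumes R: "R > 0" and C: "compact C" "\<And>x. x \<in> C \<Longrightarrow> \<bar>u x\<bar> > A * R powr (s - CARD('n))"
  shows "cap_compact s' C \<le> ennreal (cap_const s' TYPE('n) * (2 * K / \<Gamma>) / A * R powr (CARD('n) - s')) *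
    (\<integral>\<^sup>+y. (\<integral>\<^sup>+\<theta>\<in>{0<..\<kappa>}. ennreal (\<theta> powr (\<gamma> - 1) * gn y) * indicator (mid R \<theta>) y \<partial>lborel) \<partial>lborel)"
proof -
  let ?n = "CARD('n)" and ?N = "real CARD('n)" and ?lam = "A * R powr (s - CARD('n))"
  have lam: "?lam > 0" using A R by simp
  define c where "c = 2 / (\<Gamma> * ?lam) * K"
  have c: "c > 0" using \<Gamma> lam K_pos by (simp add: c_def)
  \<comment> \<open>The exponent joins (s - 1)/2 from subordination with the -1/2 of the derivative
    bound; the constant c contains the normalisation by the level.\<close>
  define \<rho> where "\<rho> z = ennreal (c * fst z powr ((s - 1) / 2 - 1 / 2) * gn (snd z)) * indicator (mid R (fst z / R\<^sup>2)) (snd z) * indicator {0<..\<kappa> * R\<^sup>2} (fst z)" for z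
  have \<rho>_prod [measurable]: "\<rho> \<in> borel_measurable (lborel \<Otimes>\<^sub>M lborel)" unfolding \<rho>_def by measurable
  then have \<rho>_borel: "\<rho> \<in> borel_measurable borel" by (simp only: lborel_prod measurable_lborel2)
  have iterate: "(\<integral>\<^sup>+z\<in>{0<..} \<times> UNIV. \<rho> z * ennreal (f z) \<partial>lborel) = (\<integral>\<^sup>+t. (\<integral>\<^sup>+y. \<rho> (t, y) * ennreal (f (t, y)) * indicator ({0<..} \<times> UNIV) (t, y) \<partial>lborel) \<partial>lborel)"
    if [measurable]: "f \<in> borel_measurable (lborel \<Otimes>\<^sub>M lborel)" for f
  proof -
    have m: "(\<lambda>z. \<rho> z * ennreal (f z) * indicator {0<..} (fst z)) \<in> borel_measurable (lborel \<Otimes>\<^sub>M lborel)" by measurable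
    have i: "indicator ({0<..} \<times> UNIV) z = (indicator {0<..} (fst z) :: ennreal)" for z :: "real \<times> (real^'n)"
      by (simp add: indicator_def mem_Times_iff)
    show ?thesis unfolding lborel_prod[symmetric] i by (rule lborel.nn_integral_fst[OF m, symmetric])
  qed
  have V: "1 < (\<integral>\<^sup>+z\<in>{0<..} \<times> UNIV. \<rho> z * ennreal (heat (2 * fst z) (x - snd z)) \<partial>lborel)" if "x \<in> C" for x
  proof -
    let ?M = "\<integral>\<^sup>+t\<in>{0<..\<kappa> * R\<^sup>2}. ennreal (t powr ((s - 1) / 2)) * (\<integral>\<^sup>+y. ennreal (K / sqrt t * heat (2 * t) (x - y) * (gn y * indicator (mid R (t / R\<^sup>2)) y)) \<partial>lborel) \<partial>lborel"
    have "(\<lambda>(t, y). ennreal (K / sqrt t * heat (2 * t) (x - y) * (gn y * indicator (mid R (t / R\<^sup>2)) y))) \<in> borel_measurable (lborel \<Otimes>\<^sub>M lborel)"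
      unfolding case_prod_beta by measurable
    note [measurable] = lborel.borel_measurable_nn_integral[OF this]
    have "ennreal (\<Gamma> / 2 * ?lam) < ?M" using superlevel_mass[OF R C(2)[OF that]] .
    then have "ennreal (2 / (\<Gamma> * ?lam)) * ennreal (\<Gamma> / 2 * ?lam) < ennreal (2 / (\<Gamma> * ?lam)) * ?M"
      using \<Gamma> lam by (intro ennreal_mult_strict_left_mono) auto
    moreover have "ennreal (2 / (\<Gamma> * ?lam)) * ennreal (\<Gamma> / 2 * ?lam) = 1"
      using \<Gamma> A R by (subst ennreal_mult'[symmetric]) auto
    ultimately have "1 < ennreal (2 / (\<Gamma> * ?lam)) * ?M" by simp
    also have "\<dots> = (\<integral>\<^sup>+t. ennreal (2 / (\<Gamma> * ?lam)) * (ennreal (t powr ((s - 1) / 2)) * (\<integral>\<^sup>+y. ennreal (K / sqrt t * heat (2 * t) (x - y) * (gn y * indicator (mid R (t / R\<^sup>2)) y)) \<partial>lborel) * indicator {0<..\<kappa> * R\<^sup>2} t) \<partial>lborel)"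
      by (rule nn_integral_cmult[symmetric]) measurable
    also have "\<dots> = (\<integral>\<^sup>+t. (\<integral>\<^sup>+y. \<rho> (t, y) * ennreal (heat (2 * t) (x - y)) * indicator ({0<..} \<times> UNIV) (t, y) \<partial>lborel) \<partial>lborel)"
    proof (intro nn_integral_cong)
      fix t :: real
      show "ennreal (2 / (\<Gamma> * ?lam)) * (ennreal (t powr ((s - 1) / 2)) * (\<integral>\<^sup>+y. ennreal (K / sqrt t * heat (2 * t) (x - y) * (gn y * indicator (mid R (t / R\<^sup>2)) y)) \<partial>lborel) * indicator {0<..\<kappa> * R\<^sup>2} t)
        = (\<integral>\<^sup>+y. \<rho> (t, y) * ennreal (heat (2 * t) (x - y)) * indicator ({0<..} \<times> UNIV) (t, y) \<partial>lborel)"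
      proof (cases "t \<in> {0<..\<kappa> * R\<^sup>2}")
        case True
        then have t: "t > 0" by simp
        have "ennreal (2 / (\<Gamma> * ?lam)) * (ennreal (t powr ((s - 1) / 2)) * (\<integral>\<^sup>+y. ennreal (K / sqrt t * heat (2 * t) (x - y) * (gn y * indicator (mid R (t / R\<^sup>2)) y)) \<partial>lborel))
          = (\<integral>\<^sup>+y. ennreal (2 / (\<Gamma> * ?lam)) * (ennreal (t powr ((s - 1) / 2)) * ennreal (K / sqrt t * heat (2 * t) (x - y) * (gn y * indicator (mid R (t / R\<^sup>2)) y))) \<partial>lborel)"
        proof -
          have [measurable]: "(\<lambda>y. ennreal (K / sqrt t * heat (2 * t) (x - y) * (gn y * indicator (mid R (t / R\<^sup>2)) y))) \<in> borel_measurable lborel"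
            by measurable
          show ?thesis by (subst nn_integral_cmult, measurable, subst nn_integral_cmult, measurable)
        qed
        also have "\<dots> = (\<integral>\<^sup>+y. \<rho> (t, y) * ennreal (heat (2 * t) (x - y)) * indicator ({0<..} \<times> UNIV) (t, y) \<partial>lborel)"
        proof (intro nn_integral_cong)
          fix y
          show "ennreal (2 / (\<Gamma> * ?lam)) * (ennreal (t powr ((s - 1) / 2)) * ennreal (K / sqrt t * heat (2 * t) (x - y) * (gn y * indicator (mid R (t / R\<^sup>2)) y)))
            = \<rho> (t, y) * ennreal (heat (2 * t) (x - y)) * indicator ({0<..} \<times> UNIV) (t, y)"
          proof (cases "y \<in> mid R (t / R\<^sup>2)")
            case in_mid: True
            have st: "t powr ((s - 1) / 2) / sqrt t = t powr ((s - 1) / 2 - 1 / 2)"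
              using t by (simp add: powr_diff powr_half_sqrt)
            have nn: "0 \<le> 2 / (\<Gamma> * ?lam)" "0 \<le> t powr ((s - 1) / 2)" "0 \<le> c * t powr ((s - 1) / 2 - 1 / 2) * gn y"
              using c \<Gamma> lam by (auto intro!: mult_nonneg_nonneg sum_nonneg)
            have "2 / (\<Gamma> * ?lam) * (t powr ((s - 1) / 2) * (K / sqrt t * heat (2 * t) (x - y) * gn y)) = c * (t powr ((s - 1) / 2) / sqrt t) * gn y * heat (2 * t) (x - y)"
              unfolding c_def by simp
            then have "2 / (\<Gamma> * ?lam) * (t powr ((s - 1) / 2) * (K / sqrt t * heat (2 * t) (x - y) * gn y)) = c * t powr ((s - 1) / 2 - 1 / 2) * gn y * heat (2 * t) (x - y)"
              unfolding st .
            then show ?thesis using in_mid True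
              by (simp only: \<rho>_def fst_conv snd_conv ennreal_mult'[OF nn(1), symmetric] ennreal_mult'[OF nn(2), symmetric] indicator_simps mult_1_right ennreal_mult'[OF nn(3), symmetric])
                 (simp add: ennreal_mult'[OF nn(3), symmetric])
          qed (simp add: \<rho>_def)
        qed
        finally show ?thesis using True by simp
      qed (simp add: \<rho>_def)
    qed
    also have "\<dots> = (\<integral>\<^sup>+z\<in>{0<..} \<times> UNIV. \<rho> z * ennreal (heat (2 * fst z) (x - snd z)) \<partial>lborel)"
      by (subst iterate) simp_all
    finally show ?thesis .
  qed
  have s': "0 < s'" "s' < 1" using s by auto
  have "cap_compact s' C \<le> ennreal (cap_const s' TYPE('n)) * (\<integral>\<^sup>+z\<in>{0<..} \<times> UNIV. \<rho> z * ennreal (fst z powr (- s' / 2)) \<partial>lborel)"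
    by (rule cap_compact_le_heat_superposition[OF s' C(1) \<rho>_borel V])
  also have "(\<integral>\<^sup>+z\<in>{0<..} \<times> UNIV. \<rho> z * ennreal (fst z powr (- s' / 2)) \<partial>lborel)
    = (\<integral>\<^sup>+t. (\<integral>\<^sup>+y. \<rho> (t, y) * ennreal (t powr (- s' / 2)) * indicator ({0<..} \<times> UNIV) (t, y) \<partial>lborel) \<partial>lborel)"
    by (subst iterate) simp_all
  also have "\<dots> = (\<integral>\<^sup>+t. (\<integral>\<^sup>+y. ennreal (c * t powr (\<gamma> - 1) * gn y) * indicator (mid R (t / R\<^sup>2)) y * indicator {0<..\<kappa> * R\<^sup>2} t \<partial>lborel) \<partial>lborel)"
  proof (intro nn_integral_cong)
    fix t :: real and y :: "real^'n"
    show "\<rho> (t, y) * ennreal (t powr (- s' / 2)) * indicator ({0<..} \<times> UNIV) (t, y) = ennreal (c * t powr (\<gamma> - 1) * gn y) * indicator (mid R (t / R\<^sup>2)) y * indicator {0<..\<kappa> * R\<^sup>2} t"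
    proof (cases "t \<in> {0<..\<kappa> * R\<^sup>2} \<and> y \<in> mid R (t / R\<^sup>2)")
      case True
      have "t powr ((s - 1) / 2 - 1 / 2) * t powr (- s' / 2) = t powr ((s - 1) / 2 - 1 / 2 + - s' / 2)" by (simp only: powr_add)
      also have "(s - 1) / 2 - 1 / 2 + - s' / 2 = \<gamma> - 1" by (simp add: field_simps)
      finally have e: "c * t powr ((s - 1) / 2 - 1 / 2) * gn y * t powr (- s' / 2) = c * t powr (\<gamma> - 1) * gn y"
        by (simp only: mult_ac)
      have "0 \<le> c * t powr ((s - 1) / 2 - 1 / 2) * gn y" using c by (auto intro!: mult_nonneg_nonneg sum_nonneg)
      from ennreal_mult'[OF this, of "t powr (- s' / 2)"] show ?thesis
        using True unfolding e by (simp add: \<rho>_def)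
    qed (auto simp: \<rho>_def)
  qed
  also have "\<dots> = ennreal (R\<^sup>2) * (\<integral>\<^sup>+\<theta>. (\<integral>\<^sup>+y. ennreal (c * (R\<^sup>2 * \<theta>) powr (\<gamma> - 1) * gn y) * indicator (mid R ((R\<^sup>2 * \<theta>) / R\<^sup>2)) y * indicator {0<..\<kappa> * R\<^sup>2} (R\<^sup>2 * \<theta>) \<partial>lborel) \<partial>lborel)"
  proof (rule nn_integral_scale)
    have "(\<lambda>(t, y). ennreal (c * t powr (\<gamma> - 1) * gn y) * indicator (mid R (t / R\<^sup>2)) y * indicator {0<..\<kappa> * R\<^sup>2} t) \<in> borel_measurable (lborel \<Otimes>\<^sub>M lborel)"
      unfolding case_prod_beta by measurable
    from lborel.borel_measurable_nn_integral[OF this] show "(\<lambda>t. \<integral>\<^sup>+y. ennreal (c * t powr (\<gamma> - 1) * gn y) * indicator (mid R (t / R\<^sup>2)) y * indicator {0<..\<kappa> * R\<^sup>2} t \<partial>lborel) \<in> borel_measurable borel" by simp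
  qed (use R in simp)
  also have "\<dots> = ennreal (R\<^sup>2) * (\<integral>\<^sup>+\<theta>. (\<integral>\<^sup>+y. ennreal (c * R powr (2 * (\<gamma> - 1))) * (ennreal (\<theta> powr (\<gamma> - 1) * gn y) * indicator (mid R \<theta>) y * indicator {0<..\<kappa>} \<theta>) \<partial>lborel) \<partial>lborel)"
  proof (rule arg_cong2[where f="(*)", OF refl], intro nn_integral_cong)
    fix \<theta> :: real and y :: "real^'n"
    have iff: "R\<^sup>2 * \<theta> \<in> {0<..\<kappa> * R\<^sup>2} \<longleftrightarrow> \<theta> \<in> {0<..\<kappa>}" using R by (auto simp: zero_less_mult_iff mult.commute)
    show "ennreal (c * (R\<^sup>2 * \<theta>) powr (\<gamma> - 1) * gn y) * indicator (mid R ((R\<^sup>2 * \<theta>) / R\<^sup>2)) y * indicator {0<..\<kappa> * R\<^sup>2} (R\<^sup>2 * \<theta>)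
      = ennreal (c * R powr (2 * (\<gamma> - 1))) * (ennreal (\<theta> powr (\<gamma> - 1) * gn y) * indicator (mid R \<theta>) y * indicator {0<..\<kappa>} \<theta>)"
    proof (cases "\<theta> \<in> {0<..\<kappa>}")
      case True
      have 1: "c * (R\<^sup>2 * \<theta>) powr (\<gamma> - 1) * gn y = (c * R powr (2 * (\<gamma> - 1))) * (\<theta> powr (\<gamma> - 1) * gn y)"
        using powr_sq[of \<theta> R "\<gamma> - 1"] True R by (simp only: mult_ac) simp
      have 2: "(R\<^sup>2 * \<theta>) / R\<^sup>2 = \<theta>" using R by simp
      have 3: "0 \<le> c * R powr (2 * (\<gamma> - 1))" using c by simp
      show ?thesis unfolding 1 2 ennreal_mult'[OF 3] using True iff by (simp add: mult.assoc)
    qed (use iff in simp)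
  qed
  also have "\<dots> = ennreal (R\<^sup>2) * (ennreal (c * R powr (2 * (\<gamma> - 1))) * (\<integral>\<^sup>+\<theta>. (\<integral>\<^sup>+y. ennreal (\<theta> powr (\<gamma> - 1) * gn y) * indicator (mid R \<theta>) y * indicator {0<..\<kappa>} \<theta> \<partial>lborel) \<partial>lborel))"
  proof -
    have m: "(\<lambda>(\<theta>, y). ennreal (\<theta> powr (\<gamma> - 1) * gn y) * indicator (mid R \<theta>) y * indicator {0<..\<kappa>} \<theta>) \<in> borel_measurable (lborel \<Otimes>\<^sub>M lborel)"
      unfolding case_prod_beta by measurable
    have my: "(\<lambda>y. ennreal (\<theta> powr (\<gamma> - 1) * gn y) * indicator (mid R \<theta>) y * indicator {0<..\<kappa>} \<theta>) \<in> borel_measurable lborel" for \<theta>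
      using measurable_Pair2[OF m, of \<theta>] by simp
    show ?thesis unfolding nn_integral_cmult[OF my]
      by (subst nn_integral_cmult[OF lborel.borel_measurable_nn_integral[OF m]]) simp
  qed
  also have "(\<integral>\<^sup>+\<theta>. (\<integral>\<^sup>+y. ennreal (\<theta> powr (\<gamma> - 1) * gn y) * indicator (mid R \<theta>) y * indicator {0<..\<kappa>} \<theta> \<partial>lborel) \<partial>lborel)
     = (\<integral>\<^sup>+y. (\<integral>\<^sup>+\<theta>\<in>{0<..\<kappa>}. ennreal (\<theta> powr (\<gamma> - 1) * gn y) * indicator (mid R \<theta>) y \<partial>lborel) \<partial>lborel)"
    by (rule lborel_pair.Fubini') measurable
  finally have fin: "cap_compact s' C \<le> ennreal (cap_const s' TYPE('n)) * (ennreal (R\<^sup>2) * (ennreal (c * R powr (2 * (\<gamma> - 1))) *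
     (\<integral>\<^sup>+y. (\<integral>\<^sup>+\<theta>\<in>{0<..\<kappa>}. ennreal (\<theta> powr (\<gamma> - 1) * gn y) * indicator (mid R \<theta>) y \<partial>lborel) \<partial>lborel)))" .
  have cc: "cap_const s' TYPE('n) \<ge> 0"
    using s' unfolding cap_const_def seminorm_heat_const_def by (auto intro!: mult_nonneg_nonneg divide_nonneg_nonneg add_nonneg_nonneg less_imp_le[OF Gamma_real_pos])
  have v: "cap_const s' TYPE('n) * (R\<^sup>2 * (c * R powr (2 * (\<gamma> - 1)))) = cap_const s' TYPE('n) * (2 * K / \<Gamma>) / A * R powr (?N - s')"
  proof -
    have "R\<^sup>2 * R powr (2 * (\<gamma> - 1)) / R powr (s - ?N) = R powr (2 + 2 * (\<gamma> - 1) - (s - ?N))"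
      using R by (simp only: powr_add powr_diff powr_numeral)
    also have "2 + 2 * (\<gamma> - 1) - (s - ?N) = ?N - s'" by (simp add: field_simps)
    finally have e: "R\<^sup>2 * R powr (2 * (\<gamma> - 1)) / R powr (s - ?N) = R powr (?N - s')" .
    have "cap_const s' TYPE('n) * (R\<^sup>2 * (c * R powr (2 * (\<gamma> - 1)))) = cap_const s' TYPE('n) * (2 * K / \<Gamma>) / A * (R\<^sup>2 * R powr (2 * (\<gamma> - 1)) / R powr (s - ?N))"
      unfolding c_def by (simp only: divide_inverse inverse_mult_distrib mult_ac)
    then show ?thesis unfolding e .
  qed
  have "ennreal (cap_const s' TYPE('n) * (R\<^sup>2 * (c * R powr (2 * (\<gamma> - 1))))) = ennreal (cap_const s' TYPE('n)) * (ennreal (R\<^sup>2) * ennreal (c * R powr (2 * (\<gamma> - 1))))"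
    by (simp only: ennreal_mult'[OF cc] ennreal_mult'[OF zero_le_power2])
  then show ?thesis using fin unfolding v by (simp only: mult.assoc)
qed

end

section \<open>Integration over the levels\<close>

text \<open>With this exponent \<open>\<eta>\<close>, the bound \<open>ln x \<le> x\<^bsup>\<eta>\<^esup> / \<eta>\<close> costs only half of the available power \<open>\<theta>\<^bsup>(s-s')/2\<^esup>\<close>.\<close>
definition level_exponent :: "nat \<Rightarrow> real \<Rightarrow> real \<Rightarrow> real" where
  "level_exponent n s s' = (s - s') / 2 / (2 * real (n * (n - 1) + 1))"

text \<open>Bounds the logarithmic length of the levels that charge one point, with the power of
  \<theta> taken out: ln x <= x^\<eta> / \<eta> for x = hi/lo, divided by k = (n-1)/(n-s'), the rate
  at which the radius to the power n - 1 decays in \<tau>.\<close>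

definition log_const :: "nat \<Rightarrow> real \<Rightarrow> real \<Rightarrow> real \<Rightarrow> real \<Rightarrow> real" where
  "log_const n K \<delta> s s' = ((8 * K / \<delta> ^ n) powr level_exponent n s s' / level_exponent n s s') / ((real n - 1) / (real n - s'))"

text \<open>The coefficient in \<open>capacity_superlevel_le\<close> times \<open>log_const\<close>
  times the integral of \<theta>^((s-s')/4 - 1) from 0 to \<kappa>.\<close>

definition embedding_const :: "nat \<Rightarrow> real \<Rightarrow> real \<Rightarrow> real \<Rightarrow> real \<Rightarrow> real \<Rightarrow> real \<Rightarrow> real \<Rightarrow> real" where
  "embedding_const n c K \<Gamma> \<kappa> \<delta> s s' = c * (2 * K / \<Gamma>) * (log_const n K \<delta> s s' * (\<kappa> powr ((s - s') / 4) / ((s - s') / 4)))"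

context sobolev_levels
begin

text \<open>The R that solves A R^(s-n) = \<tau>^((n-s)/(n-s')), as \<open>radius_level\<close>
  confirms.\<close>

definition "radius \<tau> = (A / \<tau> powr ((real CARD('n) - s) / (real CARD('n) - s'))) powr (1 / (real CARD('n) - s))"

lemma exponents: "real CARD('n) - s > 0" "real CARD('n) - s' > 0" "real CARD('n) - 1 > 0" 
  using s dim by auto

lemma radius_pos: "\<tau> > 0 \<Longrightarrow> radius \<tau> > 0"
  using A by (simp add: radius_def)

lemma radius_powr:
  assumes "\<tau> > 0"
  shows "radius \<tau> powr e = A powr (e / (real CARD('n) - s)) * \<tau> powr (- (e / (real CARD('n) - s')))"
proof -
  have "radius \<tau> powr e = (A / \<tau> powr ((real CARD('n) - s) / (real CARD('n) - s'))) powr (e / (real CARD('n) - s))" by (simp add: radius_def powr_powr)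
  also have "\<dots> = A powr (e / (real CARD('n) - s)) / (\<tau> powr ((real CARD('n) - s) / (real CARD('n) - s'))) powr (e / (real CARD('n) - s))"
    using A by (simp add: powr_divide)
  also have "(\<tau> powr ((real CARD('n) - s) / (real CARD('n) - s'))) powr (e / (real CARD('n) - s)) = \<tau> powr (e / (real CARD('n) - s'))"
    using exponents by (simp add: powr_powr)
  finally show ?thesis by (simp only: powr_minus divide_inverse)
qed

lemma radius_level:
  assumes "\<tau> > 0" shows "A * radius \<tau> powr (s - CARD('n)) = \<tau> powr ((real CARD('n) - s) / (real CARD('n) - s'))"
proof -
  have "(s - CARD('n)) / (real CARD('n) - s) = - 1" "- ((s - CARD('n)) / (real CARD('n) - s')) = (real CARD('n) - s) / (real CARD('n) - s')"
    using exponents by (auto simp: field_simps)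
  then have "radius \<tau> powr (s - CARD('n)) = A powr - 1 * \<tau> powr ((real CARD('n) - s) / (real CARD('n) - s'))" unfolding radius_powr[OF assms] by (simp only:)
  then show ?thesis using A by (simp add: powr_minus)
qed

lemma log_bound:
  assumes "0 < \<theta>" "\<theta> \<le> \<kappa>"
  shows "ln (hi \<theta> / lo \<theta>) / ((real CARD('n) - 1) / (real CARD('n) - s')) \<le> log_const CARD('n) K \<delta> s s' * \<theta> powr (- ((s - s') / 4))"
proof -
  let ?n = "CARD('n)" and ?\<eta> = "level_exponent CARD('n) s s'"
  have \<eta>: "?\<eta> > 0" unfolding level_exponent_def using s by (intro divide_pos_pos mult_pos_pos) (auto simp del: of_nat_add of_nat_mult)
  have k: "(real ?n - 1) / (real ?n - s') > 0" using exponents by simp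
  have "hi \<theta> / lo \<theta> \<ge> 1" using lo_hi(1,3)[OF assms] by simp
  then have "ln (hi \<theta> / lo \<theta>) \<le> (hi \<theta> / lo \<theta>) powr ?\<eta> / ?\<eta>" using \<eta> by (intro ln_powr_bound)
  also have "(hi \<theta> / lo \<theta>) powr ?\<eta> = (8 * K / \<delta> ^ ?n) powr ?\<eta> * (1 / \<theta> ^ (?n * (?n - 1) + 1)) powr ?\<eta>"
    unfolding lo_hi(4)[OF assms] by (rule powr_mult)
  also have "(1 / \<theta> ^ (?n * (?n - 1) + 1)) powr ?\<eta> = \<theta> powr (- ((s - s') / 4))"
  proof -
    have "1 / \<theta> ^ (?n * (?n - 1) + 1) = \<theta> powr - real (?n * (?n - 1) + 1)"
      using assms by (simp only: powr_minus inverse_eq_divide powr_realpow)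
    then have "(1 / \<theta> ^ (?n * (?n - 1) + 1)) powr ?\<eta> = \<theta> powr (- real (?n * (?n - 1) + 1) * ?\<eta>)" by (simp only: powr_powr)
    also have "- real (?n * (?n - 1) + 1) * ?\<eta> = - ((s - s') / 4)"
    proof -
      have "- x * (g / 2 / (2 * x)) = - (g / 4)" if "x > 0" for x g :: real using that by simp
      then show ?thesis unfolding level_exponent_def by (simp only: of_nat_0_less_iff)
    qed
    finally show ?thesis .
  qed
  finally have "ln (hi \<theta> / lo \<theta>) / ((real ?n - 1) / (real ?n - s')) \<le> ((8 * K / \<delta> ^ ?n) powr ?\<eta> * \<theta> powr (- ((s - s') / 4)) / ?\<eta>) / ((real ?n - 1) / (real ?n - s'))"
    using k by (intro divide_right_mono) auto
  then show ?thesis unfolding log_const_def by (simp add: mult_ac)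
qed

text \<open>For fixed y and \<theta>, the radius to the power n - 1 is a multiple of \<tau>^(-k), so
  membership in \<open>mid\<close> is the two-sided condition of
  \<open>nn_integral_inverse_le\<close>. The value of \<open>w\<close> at y enters only through W,
  on which the bound does not depend.\<close>

lemma time_integral_le:
  assumes "0 < \<theta>" "\<theta> \<le> \<kappa>"
  shows "(\<integral>\<^sup>+\<tau>\<in>{0<..}. ennreal (1 / \<tau>) * indicator (mid (radius \<tau>) \<theta>) y \<partial>lborel) \<le> ennreal (log_const CARD('n) K \<delta> s s' * \<theta> powr (- ((s - s') / 4)))"
proof -
  let ?N = "real CARD('n)" and ?k = "(real CARD('n) - 1) / (real CARD('n) - s')"
  define W where "W = \<bar>w y\<bar> * A powr ((?N - 1) / (?N - s)) / A"
  have W: "W \<ge> 0" using A by (simp add: W_def)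
  have "(\<integral>\<^sup>+\<tau>\<in>{0<..}. ennreal (1 / \<tau>) * indicator (mid (radius \<tau>) \<theta>) y \<partial>lborel)
    = (\<integral>\<^sup>+\<tau>\<in>{0<..}. ennreal (1 / \<tau>) * indicator {\<tau>. lo \<theta> \<le> W * \<tau> powr - ?k \<and> W * \<tau> powr - ?k \<le> hi \<theta>} \<tau> \<partial>lborel)"
  proof (intro nn_integral_cong)
    fix \<tau> :: real
    show "ennreal (1 / \<tau>) * indicator (mid (radius \<tau>) \<theta>) y * indicator {0<..} \<tau> = ennreal (1 / \<tau>) * indicator {\<tau>. lo \<theta> \<le> W * \<tau> powr - ?k \<and> W * \<tau> powr - ?k \<le> hi \<theta>} \<tau> * indicator {0<..} \<tau>"
    proof (cases "\<tau> > 0")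
      case True
      have "radius \<tau> ^ (CARD('n) - 1) = radius \<tau> powr (?N - 1)"
        using radius_pos[OF True] dim by (simp add: powr_realpow[symmetric] of_nat_diff)
      then have "\<bar>w y\<bar> * radius \<tau> ^ (CARD('n) - 1) / A = W * \<tau> powr - ?k"
        unfolding radius_powr[OF True] W_def by simp
      then show ?thesis by (simp add: mid_def indicator_def)
    qed simp
  qed
  also have "\<dots> \<le> ennreal (ln (hi \<theta> / lo \<theta>) / ?k)"
    using lo_hi(1,3)[OF assms] W exponents by (intro nn_integral_inverse_le) auto
  also have "\<dots> \<le> ennreal (log_const CARD('n) K \<delta> s s' * \<theta> powr (- ((s - s') / 4)))"
    by (intro ennreal_leI log_bound assms)
  finally show ?thesis .
qed

text \<open>Tonelli with \<tau> innermost. The logarithm costs \<theta>^(-(s-s')/4), which leaves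
  the integrable power \<theta>^((s-s')/4 - 1); the remaining integral over y is the mass of the
  gradient.\<close>

lemma mass_integral_le:
  "(\<integral>\<^sup>+\<tau>. ennreal (1 / \<tau>) * indicator {0<..} \<tau> * (\<integral>\<^sup>+y. (\<integral>\<^sup>+\<theta>\<in>{0<..\<kappa>}. ennreal (\<theta> powr ((s - s') / 2 - 1) * gn y) * indicator (mid (radius \<tau>) \<theta>) y \<partial>lborel) \<partial>lborel) \<partial>lborel)
    \<le> ennreal (log_const CARD('n) K \<delta> s s' * (\<kappa> powr ((s - s') / 4) / ((s - s') / 4)) * A)"
proof -
  let ?L = "log_const CARD('n) K \<delta> s s'" and ?g = "(s - s') / 4"
  have g: "?g > 0" using s by simp
  have L: "?L \<ge> 0" using K_pos \<delta> s exponents by (auto simp: log_const_def level_exponent_def intro!: divide_nonneg_nonneg)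
  have [measurable]: "radius \<in> borel_measurable borel" unfolding radius_def[abs_def] by measurable
  \<comment> \<open>A jointly measurable integrand in all three variables, so that \<tau> can be
    moved past y and then past \<theta>.\<close>
  define F where "F \<tau> y \<theta> = ennreal (\<theta> powr ((s - s') / 2 - 1) * gn y) * indicator {0<..\<kappa>} \<theta> * (ennreal (1 / \<tau>) * indicator (mid (radius \<tau>) \<theta>) y * indicator {0<..} \<tau>)" for \<tau> y \<theta>
  have Fm [measurable]: "(\<lambda>z. F (a z) (b z) (c z)) \<in> borel_measurable M"
    if [measurable]: "a \<in> borel_measurable M" "b \<in> borel_measurable M" "c \<in> borel_measurable M" for a b c and M :: "'m measure"
    unfolding F_def by measurable
  have "(\<integral>\<^sup>+\<tau>. ennreal (1 / \<tau>) * indicator {0<..} \<tau> * (\<integral>\<^sup>+y. (\<integral>\<^sup>+\<theta>\<in>{0<..\<kappa>}. ennreal (\<theta> powr ((s - s') / 2 - 1) * gn y) * indicator (mid (radius \<tau>) \<theta>) y \<partial>lborel) \<partial>lborel) \<partial>lborel)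
    = (\<integral>\<^sup>+\<tau>. (\<integral>\<^sup>+y. (\<integral>\<^sup>+\<theta>. F \<tau> y \<theta> \<partial>lborel) \<partial>lborel) \<partial>lborel)"
  proof (intro nn_integral_cong)
    fix \<tau> :: real
    have "(\<integral>\<^sup>+y. (\<integral>\<^sup>+\<theta>. F \<tau> y \<theta> \<partial>lborel) \<partial>lborel) = (\<integral>\<^sup>+y. (\<integral>\<^sup>+\<theta>. (ennreal (1 / \<tau>) * indicator {0<..} \<tau>) * (ennreal (\<theta> powr ((s - s') / 2 - 1) * gn y) * indicator (mid (radius \<tau>) \<theta>) y * indicator {0<..\<kappa>} \<theta>) \<partial>lborel) \<partial>lborel)"
      unfolding F_def by (simp only: mult_ac)
    also have "\<dots> = (\<integral>\<^sup>+y. (ennreal (1 / \<tau>) * indicator {0<..} \<tau>) * (\<integral>\<^sup>+\<theta>\<in>{0<..\<kappa>}. ennreal (\<theta> powr ((s - s') / 2 - 1) * gn y) * indicator (mid (radius \<tau>) \<theta>) y \<partial>lborel) \<partial>lborel)"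
      by (intro nn_integral_cong nn_integral_cmult) measurable
    also have "\<dots> = ennreal (1 / \<tau>) * indicator {0<..} \<tau> * (\<integral>\<^sup>+y. (\<integral>\<^sup>+\<theta>\<in>{0<..\<kappa>}. ennreal (\<theta> powr ((s - s') / 2 - 1) * gn y) * indicator (mid (radius \<tau>) \<theta>) y \<partial>lborel) \<partial>lborel)"
      by (rule nn_integral_cmult) measurable
    finally show "ennreal (1 / \<tau>) * indicator {0<..} \<tau> * (\<integral>\<^sup>+y. (\<integral>\<^sup>+\<theta>\<in>{0<..\<kappa>}. ennreal (\<theta> powr ((s - s') / 2 - 1) * gn y) * indicator (mid (radius \<tau>) \<theta>) y \<partial>lborel) \<partial>lborel) = (\<integral>\<^sup>+y. (\<integral>\<^sup>+\<theta>. F \<tau> y \<theta> \<partial>lborel) \<partial>lborel)" ..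
  qed
  also have "\<dots> = (\<integral>\<^sup>+y. (\<integral>\<^sup>+\<tau>. (\<integral>\<^sup>+\<theta>. F \<tau> y \<theta> \<partial>lborel) \<partial>lborel) \<partial>lborel)" by (rule lborel_pair.Fubini') measurable
  also have "\<dots> = (\<integral>\<^sup>+y. (\<integral>\<^sup>+\<theta>. (\<integral>\<^sup>+\<tau>. F \<tau> y \<theta> \<partial>lborel) \<partial>lborel) \<partial>lborel)" by (intro nn_integral_cong lborel_pair.Fubini') measurable
  also have "\<dots> \<le> (\<integral>\<^sup>+y. (\<integral>\<^sup>+\<theta>. ennreal (gn y * ?L) * (ennreal (\<theta> powr (?g - 1)) * indicator {0<..\<kappa>} \<theta>) \<partial>lborel) \<partial>lborel)"
  proof (intro nn_integral_mono)
    fix y \<theta>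
    show "(\<integral>\<^sup>+\<tau>. F \<tau> y \<theta> \<partial>lborel) \<le> ennreal (gn y * ?L) * (ennreal (\<theta> powr (?g - 1)) * indicator {0<..\<kappa>} \<theta>)"
    proof (cases "\<theta> \<in> {0<..\<kappa>}")
      case True
      have "(\<integral>\<^sup>+\<tau>. F \<tau> y \<theta> \<partial>lborel) = ennreal (\<theta> powr ((s - s') / 2 - 1) * gn y) * (\<integral>\<^sup>+\<tau>\<in>{0<..}. ennreal (1 / \<tau>) * indicator (mid (radius \<tau>) \<theta>) y \<partial>lborel)"
      proof -
        have "(\<lambda>\<tau>. ennreal (1 / \<tau>) * indicator (mid (radius \<tau>) \<theta>) y * indicator {0<..} \<tau>) \<in> borel_measurable lborel" by measurable
        from nn_integral_cmult[OF this] show ?thesis unfolding F_def using True by simp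
      qed
      also have "\<dots> \<le> ennreal (\<theta> powr ((s - s') / 2 - 1) * gn y) * ennreal (?L * \<theta> powr (- ?g))"
        using True by (intro mult_left_mono time_integral_le) auto
      also have "\<dots> = ennreal (\<theta> powr ((s - s') / 2 - 1) * gn y * (?L * \<theta> powr (- ?g)))"
        by (intro ennreal_mult'[symmetric] mult_nonneg_nonneg sum_nonneg) auto
      also have "\<theta> powr ((s - s') / 2 - 1) * gn y * (?L * \<theta> powr (- ?g)) = gn y * ?L * \<theta> powr (?g - 1)"
      proof -
        have "\<theta> powr ((s - s') / 2 - 1) * \<theta> powr (- ?g) = \<theta> powr ((s - s') / 2 - 1 + - ?g)" by (simp only: powr_add)
        also have "(s - s') / 2 - 1 + - ?g = ?g - 1" by (simp add: field_simps)
        finally show ?thesis by (simp only: mult_ac)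
      qed
      also have "ennreal (gn y * ?L * \<theta> powr (?g - 1)) = ennreal (gn y * ?L) * ennreal (\<theta> powr (?g - 1))"
        using L by (intro ennreal_mult' mult_nonneg_nonneg sum_nonneg) auto
      finally show ?thesis using True by simp
    qed (simp add: F_def)
  qed
  also have "\<dots> = (\<integral>\<^sup>+y. ennreal (gn y * ?L) * ennreal (\<kappa> powr ?g / ?g) \<partial>lborel)"
  proof (intro nn_integral_cong)
    fix y
    have "\<kappa> \<ge> 0" using \<kappa> by simp
    then show "(\<integral>\<^sup>+\<theta>. ennreal (gn y * ?L) * (ennreal (\<theta> powr (?g - 1)) * indicator {0<..\<kappa>} \<theta>) \<partial>lborel) = ennreal (gn y * ?L) * ennreal (\<kappa> powr ?g / ?g)"
      by (subst nn_integral_cmult, measurable) (simp only: nn_integral_powr_from_0[OF g])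
  qed
  also have "\<dots> = (\<integral>\<^sup>+y. ennreal (?L * (\<kappa> powr ?g / ?g)) * ennreal (gn y) \<partial>lborel)"
  proof (intro nn_integral_cong)
    fix y
    have nn: "0 \<le> gn y * ?L" "0 \<le> ?L * (\<kappa> powr ?g / ?g)" using L g by (auto intro!: mult_nonneg_nonneg sum_nonneg divide_nonneg_nonneg)
    show "ennreal (gn y * ?L) * ennreal (\<kappa> powr ?g / ?g) = ennreal (?L * (\<kappa> powr ?g / ?g)) * ennreal (gn y)"
      unfolding ennreal_mult'[OF nn(1), symmetric] ennreal_mult'[OF nn(2), symmetric] by (simp only: mult_ac)
  qed
  also have "\<dots> = ennreal (?L * (\<kappa> powr ?g / ?g)) * (\<integral>\<^sup>+y. ennreal (gn y) \<partial>lborel)" by (rule nn_integral_cmult) measurable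
  also have "\<dots> \<le> ennreal (?L * (\<kappa> powr ?g / ?g)) * ennreal A" by (intro mult_left_mono g_int) simp
  also have "\<dots> = ennreal (?L * (\<kappa> powr ?g / ?g) * A)"
    using L g by (intro ennreal_mult'[symmetric] mult_nonneg_nonneg divide_nonneg_nonneg) auto
  finally show ?thesis .
qed

text \<open>Along \<open>radius\<close>, R^(n-s') equals A^((n-s')/(n-s)) / \<tau>, which is where
  d\<tau>/\<tau> comes from. The factor 1/A in \<open>capacity_superlevel_le\<close> cancels the
  mass A from \<open>mass_integral_le\<close>.\<close>

lemma capacity_integral_le:
  "(\<integral>\<^sup>+\<tau>\<in>{0<..}. cap_open s' {x. \<bar>u x\<bar> > \<tau> powr ((real CARD('n) - s) / (real CARD('n) - s'))} \<partial>lborel)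
    \<le> ennreal (embedding_const CARD('n) (cap_const s' TYPE('n)) K \<Gamma> \<kappa> \<delta> s s' * A powr ((real CARD('n) - s') / (real CARD('n) - s)))"
proof -
  let ?c = "cap_const s' TYPE('n) * (2 * K / \<Gamma>)"
  let ?J = "\<lambda>\<tau>. \<integral>\<^sup>+y. (\<integral>\<^sup>+\<theta>\<in>{0<..\<kappa>}. ennreal (\<theta> powr ((s - s') / 2 - 1) * gn y) * indicator (mid (radius \<tau>) \<theta>) y \<partial>lborel) \<partial>lborel"
  have cc: "cap_const s' TYPE('n) \<ge> 0"
    using s unfolding cap_const_def seminorm_heat_const_def by (auto intro!: mult_nonneg_nonneg divide_nonneg_nonneg add_nonneg_nonneg less_imp_le[OF Gamma_real_pos])
  have c: "?c / A * A powr ((real CARD('n) - s') / (real CARD('n) - s)) \<ge> 0" using cc K_pos \<Gamma> A by (intro mult_nonneg_nonneg divide_nonneg_nonneg) auto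
  have [measurable]: "radius \<in> borel_measurable borel" unfolding radius_def[abs_def] by measurable
  have "cap_open s' {x. \<bar>u x\<bar> > \<tau> powr ((real CARD('n) - s) / (real CARD('n) - s'))} * indicator {0<..} \<tau> \<le> ennreal (?c / A * A powr ((real CARD('n) - s') / (real CARD('n) - s))) * (ennreal (1 / \<tau>) * indicator {0<..} \<tau> * ?J \<tau>)" for \<tau>
  proof (cases "\<tau> > 0")
    case True
    have sc: "radius \<tau> powr (CARD('n) - s') = A powr ((real CARD('n) - s') / (real CARD('n) - s)) * (1 / \<tau>)"
      unfolding radius_powr[OF True] using exponents(2) True by (simp add: powr_minus inverse_eq_divide)
    have "cap_open s' {x. \<bar>u x\<bar> > \<tau> powr ((real CARD('n) - s) / (real CARD('n) - s'))} \<le> ennreal (?c / A * radius \<tau> powr (CARD('n) - s')) * ?J \<tau>"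
      unfolding cap_open_def
    proof (rule SUP_least)
      fix C assume "C \<in> {C. compact C \<and> C \<subseteq> {x. \<bar>u x\<bar> > \<tau> powr ((real CARD('n) - s) / (real CARD('n) - s'))}}"
      then show "cap_compact s' C \<le> ennreal (?c / A * radius \<tau> powr (CARD('n) - s')) * ?J \<tau>"
        by (intro capacity_superlevel_le radius_pos True) (auto simp: radius_level[OF True])
    qed
    also have "?c / A * radius \<tau> powr (CARD('n) - s') = ?c / A * A powr ((real CARD('n) - s') / (real CARD('n) - s)) * (1 / \<tau>)" unfolding sc by simp
    also have "ennreal (?c / A * A powr ((real CARD('n) - s') / (real CARD('n) - s)) * (1 / \<tau>)) = ennreal (?c / A * A powr ((real CARD('n) - s') / (real CARD('n) - s))) * ennreal (1 / \<tau>)"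
      by (rule ennreal_mult'[OF c])
    finally show ?thesis using True by (simp add: mult.assoc)
  qed simp
  then have "(\<integral>\<^sup>+\<tau>\<in>{0<..}. cap_open s' {x. \<bar>u x\<bar> > \<tau> powr ((real CARD('n) - s) / (real CARD('n) - s'))} \<partial>lborel) \<le> (\<integral>\<^sup>+\<tau>. ennreal (?c / A * A powr ((real CARD('n) - s') / (real CARD('n) - s))) * (ennreal (1 / \<tau>) * indicator {0<..} \<tau> * ?J \<tau>) \<partial>lborel)"
    by (intro nn_integral_mono)
  also have "\<dots> = ennreal (?c / A * A powr ((real CARD('n) - s') / (real CARD('n) - s))) * (\<integral>\<^sup>+\<tau>. ennreal (1 / \<tau>) * indicator {0<..} \<tau> * ?J \<tau> \<partial>lborel)"
    by (rule nn_integral_cmult) measurable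
  also have "\<dots> \<le> ennreal (?c / A * A powr ((real CARD('n) - s') / (real CARD('n) - s))) * ennreal (log_const CARD('n) K \<delta> s s' * (\<kappa> powr ((s - s') / 4) / ((s - s') / 4)) * A)"
    by (intro mult_left_mono mass_integral_le) simp
  also have "\<dots> = ennreal (?c / A * A powr ((real CARD('n) - s') / (real CARD('n) - s)) * (log_const CARD('n) K \<delta> s s' * (\<kappa> powr ((s - s') / 4) / ((s - s') / 4)) * A))"
    by (rule ennreal_mult'[OF c, symmetric])
  also have "?c / A * A powr ((real CARD('n) - s') / (real CARD('n) - s)) * (log_const CARD('n) K \<delta> s s' * (\<kappa> powr ((s - s') / 4) / ((s - s') / 4)) * A) = embedding_const CARD('n) (cap_const s' TYPE('n)) K \<Gamma> \<kappa> \<delta> s s' * A powr ((real CARD('n) - s') / (real CARD('n) - s))"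
    unfolding embedding_const_def using A by simp
  finally show ?thesis .
qed

end

section \<open>Choice of the constants and removal of the strict mass bound\<close>

lemma exists_large_powr:
  fixes c e d :: real assumes "c > 0" "e > 0" "d > 0"
  shows "\<exists>\<kappa>\<ge>1. c * \<kappa> powr - e \<le> d"
proof -
  define \<kappa> where "\<kappa> = max 1 ((c / d) powr (1 / e))"
  have "c / d = ((c / d) powr (1 / e)) powr e" using assms by (simp add: powr_powr)
  also have "\<dots> \<le> \<kappa> powr e" using assms by (intro powr_mono2) (auto simp: \<kappa>_def)
  finally have "c \<le> d * \<kappa> powr e" using assms by (simp add: pos_divide_le_eq mult.commute)
  moreover have "\<kappa> powr e > 0" by (simp add: \<kappa>_def)
  ultimately have "c * \<kappa> powr - e \<le> d" by (simp add: powr_minus field_simps)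
  moreover have "\<kappa> \<ge> 1" by (simp add: \<kappa>_def)
  ultimately show ?thesis by blast
qed

theorem theorem3p5:
  fixes s' s :: real
  assumes "0 < s'" and "s' < s" and "s < 1" and "1 < CARD('n::finite)"
  shows "\<exists>c>0. \<forall>u \<in> (schwartz_class :: (real^'n \<Rightarrow> real) set).
    ennreal_powr
      (\<integral>\<^sup>+t\<in>{0<..}. cap_open s'
          {x. \<bar>u x\<bar> > t powr ((real CARD('n) - s) / (real CARD('n) - s'))} \<partial>lborel)
      ((real CARD('n) - s) / (real CARD('n) - s'))
    \<le> ennreal c * seminorm_minus s u"
proof -
  let ?N = "real CARD('n)"
  let ?p = "(?N - s) / (?N - s')" and ?q = "(?N - s') / (?N - s)"
  define K :: real where "K = 2 * sqrt 2 ^ CARD('n)"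
  define \<Gamma> where "\<Gamma> = Gamma ((1 + s) / 2)"
  have K: "K > 0" by (simp add: K_def)
  have \<Gamma>: "\<Gamma> > 0" using assms by (simp add: \<Gamma>_def)
  have N: "?N \<ge> 2" "?N - s > 0" "?N - s' > 0" using assms by auto
  have pq: "?p > 0" "?p * ?q = 1" using N by auto
  obtain \<kappa> where \<kappa>: "\<kappa> \<ge> 1" "2 * K / (?N - s) * \<kappa> powr - ((?N - s) / 2) \<le> \<Gamma> / 4"
    using exists_large_powr[of "2 * K / (?N - s)" "(?N - s) / 2" "\<Gamma> / 4"] K N \<Gamma> by auto
  define D where "D = ?N * K * (4 * \<kappa> powr ((s + 1) / 2) / (s + 1) + 8 * K * \<kappa> powr ((s + ?N - 1) / 2) / (s + ?N - 1))"
  have D: "D > 0" unfolding D_def using K N assms \<kappa> by (intro mult_pos_pos add_pos_pos divide_pos_pos) auto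
  define \<kappa>' where "\<kappa>' = \<kappa> ^ (CARD('n) * (CARD('n) - 1) + 1)"
  have \<kappa>': "\<kappa>' \<ge> 1" unfolding \<kappa>'_def by (rule one_le_power[OF \<kappa>(1)])
  \<comment> \<open>The two entries are the third and fourth conditions of
    \<open>sobolev_levels\<close> solved for \<delta>. Both involve \<kappa>, which is why \<kappa>
    was fixed first.\<close>
  define \<delta> where "\<delta> = min (1 / \<kappa>') (\<Gamma> / 4 / D)"
  have \<delta>: "0 < \<delta>" "\<delta> \<le> 1 / \<kappa>'" "\<delta> \<le> \<Gamma> / 4 / D" using \<kappa>' \<Gamma> D by (auto simp: \<delta>_def)
  have \<delta>': "\<delta> \<le> 1" "\<delta> * \<kappa>' \<le> 1" "\<delta> * D \<le> \<Gamma> / 4"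
    using \<delta> \<kappa>' D by (auto simp: pos_le_divide_eq intro: order.trans[of _ "1 / \<kappa>'"])
  \<comment> \<open>The maximum ensures a nonnegative constant, so that the extended inequality can
    be read off in the reals.\<close>
  define E where "E = max 0 (embedding_const CARD('n) (cap_const s' TYPE('n)) K \<Gamma> \<kappa> \<delta> s s')"
  have E: "E \<ge> 0" by (simp add: E_def)
  \<comment> \<open>Adding 1 keeps the constant positive even for E = 0; an infinite seminorm then
    makes the right-hand side infinite.\<close>
  have main: "ennreal_powr (\<integral>\<^sup>+t\<in>{0<..}. cap_open s' {x. \<bar>u x\<bar> > t powr ?p} \<partial>lborel) ?p \<le> ennreal (E powr ?p + 1) * seminorm_minus s u"
    if u: "u \<in> schwartz_class" for u :: "real^'n \<Rightarrow> real"
  proof (cases "seminorm_minus s u = \<top>")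
    case True
    then show ?thesis by (simp add: ennreal_mult_top add_nonneg_pos)
  next
    case False
    define S where "S = enn2real (seminorm_minus s u)"
    have S: "seminorm_minus s u = ennreal S" "S \<ge> 0" using False by (auto simp: S_def less_top)
    let ?X = "\<integral>\<^sup>+t\<in>{0<..}. cap_open s' {x. \<bar>u x\<bar> > t powr ?p} \<partial>lborel"
    have "0 < s" using assms by simp
    from fractional_gradient_potential[OF u this \<open>s < 1\<close>]
    obtain w :: "real^'n \<Rightarrow> real" and g :: "'n \<Rightarrow> real^'n \<Rightarrow> real" and B :: real where
      wg: "w \<in> borel_measurable borel" "\<And>j. g j \<in> borel_measurable borel"
      "\<And>x. \<bar>w x\<bar> \<le> B" "\<And>j x. \<bar>g j x\<bar> \<le> B"
      "\<And>y j. ((\<lambda>h. w (y + h *\<^sub>R axis j 1)) has_vector_derivative g j y) (at 0)"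
      and gn: "\<And>j x. \<bar>g j x\<bar> \<le> norm (nabla_minus s u j x)"
      and w_le: "\<And>x. ennreal \<bar>w x\<bar> \<le> (\<integral>\<^sup>+t\<in>{0<..}. ennreal \<bar>\<Sum>j\<in>UNIV. LINT y|lborel. dheat t j (x - y) * g j y\<bar> \<partial>lborel)"
      and u_le: "\<And>x. ennreal (Gamma ((1 + s) / 2) * \<bar>u x\<bar>) \<le> (\<integral>\<^sup>+t\<in>{0<..}. ennreal (t powr ((s - 1) / 2) * \<bar>\<Sum>j\<in>UNIV. LINT y|lborel. dheat t j (x - y) * g j y\<bar>) \<partial>lborel)"
      by blast
    have gS: "(\<integral>\<^sup>+y. ennreal (\<Sum>j\<in>UNIV. \<bar>g j y\<bar>) \<partial>lborel) \<le> ennreal S"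
    proof -
      have "(\<integral>\<^sup>+y. ennreal (\<Sum>j\<in>UNIV. \<bar>g j y\<bar>) \<partial>lborel) = (\<integral>\<^sup>+y. (\<Sum>j\<in>UNIV. ennreal \<bar>g j y\<bar>) \<partial>lborel)"
        by (simp add: sum_ennreal)
      also have "\<dots> = (\<Sum>j\<in>UNIV. \<integral>\<^sup>+y. ennreal \<bar>g j y\<bar> \<partial>lborel)" using wg(2) by (intro nn_integral_sum) auto
      also have "\<dots> \<le> seminorm_minus s u" unfolding seminorm_minus_def by (intro sum_mono nn_integral_mono ennreal_leI gn)
      finally show ?thesis unfolding S(1) .
    qed
    \<comment> \<open>The locale requires a positive mass bound, and \<open>S\<close> may be 0; the
      estimate is therefore proved for every A > S and passed to the limit at the end.\<close>
    have bound: "?X \<le> ennreal (E * A powr ?q)" if "A > S" for A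
    proof -
      interpret sobolev_levels w g B A K u s s' \<Gamma> \<kappa> \<delta>
      proof
        show "K = 2 * sqrt 2 ^ CARD('n)" by (rule K_def)
        show "(\<integral>\<^sup>+y. ennreal (\<Sum>j\<in>UNIV. \<bar>g j y\<bar>) \<partial>lborel) \<le> ennreal A"
          using gS that by (meson ennreal_leI less_imp_le order_trans)
        show "ennreal (\<Gamma> * \<bar>u x\<bar>) \<le> (\<integral>\<^sup>+t\<in>{0<..}. ennreal (t powr ((s - 1) / 2) * \<bar>\<Sum>j\<in>UNIV. LINT y|lborel. dheat t j (x - y) * g j y\<bar>) \<partial>lborel)" for x
          unfolding \<Gamma>_def by (rule u_le)
        show "2 * K / (?N - s) * \<kappa> powr (- (?N - s) / 2) \<le> \<Gamma> / 4" using \<kappa>(2) by (simp only: minus_divide_left)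
        show "\<delta> * (?N * K * (4 * \<kappa> powr ((s + 1) / 2) / (s + 1) + 8 * K * \<kappa> powr ((s + ?N - 1) / 2) / (s + ?N - 1))) \<le> \<Gamma> / 4"
          using \<delta>'(3) unfolding D_def .
        show "\<delta> * \<kappa> ^ (CARD('n) * (CARD('n) - 1) + 1) \<le> 1" using \<delta>'(2) unfolding \<kappa>'_def .
        show "A > 0" using that S(2) by simp
        show "CARD('n) \<ge> 2" using assms by simp
      qed (use wg w_le assms \<Gamma> \<kappa> \<delta> \<delta>' in auto)
      note capacity_integral_le
      also have "ennreal (embedding_const CARD('n) (cap_const s' TYPE('n)) K \<Gamma> \<kappa> \<delta> s s' * A powr ?q) \<le> ennreal (E * A powr ?q)"
        by (intro ennreal_leI mult_right_mono) (auto simp: E_def)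
      finally show ?thesis .
    qed
    have "?X < \<top>" using bound[of "S + 1"] by (simp add: le_less_trans ennreal_less_top)
    define r where "r = enn2real ?X"
    have X: "?X = ennreal r" "r \<ge> 0" using \<open>?X < \<top>\<close> by (auto simp: r_def)
    have "r powr ?p \<le> E powr ?p * S + E powr ?p * e" if "e > 0" for e
    proof -
      have "r \<le> E * (S + e) powr ?q"
        using bound[of "S + e"] that E unfolding X(1) by (simp add: ennreal_le_iff)
      then have "r powr ?p \<le> (E * (S + e) powr ?q) powr ?p" using X(2) pq by (intro powr_mono2) auto
      \<comment> \<open>The exponents p and q are reciprocal, so the bound becomes linear in S + e
        and the limit in e is immediate.\<close>
      also have "\<dots> = E powr ?p * (S + e) powr (?q * ?p)" using E by (simp add: powr_mult powr_powr)
      also have "?q * ?p = 1" using pq(2) by (simp only: mult.commute)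
      finally show ?thesis using S(2) that by (simp add: distrib_left)
    qed
    note eps = this
    have "r powr ?p \<le> E powr ?p * S"
    proof (rule field_le_epsilon)
      fix e :: real assume e: "e > 0"
      \<comment> \<open>The error E^p e is made at most a given d by the choice e = d / (E^p + 1),
        which also covers E^p = 0.\<close>
      have M: "M * (d / (M + 1)) \<le> d" "0 < d / (M + 1)" if "M \<ge> 0" "d > 0" for M d :: real using that by (simp_all add: field_simps)
      show "r powr ?p \<le> E powr ?p * S + e"
        by (rule order.trans[OF eps[OF M(2)[OF powr_ge_zero e]] add_left_mono[OF M(1)[OF powr_ge_zero e]]])
    qed
    also have "\<dots> \<le> (E powr ?p + 1) * S" using S(2) by (simp add: distrib_right)
    finally have "ennreal (r powr ?p) \<le> ennreal ((E powr ?p + 1) * S)" by (rule ennreal_leI)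
    also have "\<dots> = ennreal (E powr ?p + 1) * seminorm_minus s u" unfolding S(1) by (rule ennreal_mult') (simp add: add_nonneg_nonneg)
    finally show ?thesis unfolding X(1) ennreal_powr_def using X(2) by simp
  qed
  show ?thesis by (rule exI[of _ "E powr ?p + 1"]) (use main in \<open>auto simp: add_nonneg_pos\<close>)
qed

end
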